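(* The maximum witness problem for the Boolean product of two Boolean $n\times n$ matrices, with $m_1$ and $m_2$ non-zero entries respectively, admits a quantum algorithm running in $\tilde{O}(n^2+n^{1.5}\sqrt{\min\{m_1,m_2\}})$ time.
   Context: For Boolean $n\times n$ matrices $A,B$ with Boolean product $C$, a witness for a non-zero entry $C[i,j]$ is an index $k\in[n]$ with $A[i,k]=B[k,j]=1$; the maximum witness is the largest such index. The maximum witness problem (MW) is to report the maximum witness for each non-zero entry of $C$. A quantum algorithm for MW is a quantum algorithm in the QRAM model which, given access to oracles $O_A$ and $O_B$ (where $O_A$ maps $|i\rangle|j\rangle|0\rangle|z\rangle$ to $|i\rangle|j\rangle|A[i,j]\rangle|z\rangle$, each call having unit cost), computes with probability at least $2/3$ all the non-zero entries of $A\times B$ along with the maximum witness for each non-zero entry. $\tilde{O}(\cdot)$ suppresses factors polylogarithmic in $n$. *)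

theory Defs
  imports
    "HOL-Probability.SPMF"
    "HOL-Library.Discrete_Functions"
    "Jordan_Normal_Form.Matrix"
begin

section \<open>Maximum witnesses of Boolean matrix products\<close>

definition bool_prod :: "bool mat \<Rightarrow> bool mat \<Rightarrow> bool mat" where
  "bool_prod A B =
     mat (dim_row A) (dim_col B) (\<lambda>(i, j). \<exists>k < dim_col A. A $$ (i, k) \<and> B $$ (k, j))"

definition witnesses :: "bool mat \<Rightarrow> bool mat \<Rightarrow> nat \<Rightarrow> nat \<Rightarrow> nat set" where
  "witnesses A B i j = {k. k < dim_col A \<and> A $$ (i, k) \<and> B $$ (k, j)}"

definition nnz :: "bool mat \<Rightarrow> nat" where
  "nnz A = card {(i, j). i < dim_row A \<and> j < dim_col A \<and> A $$ (i, j)}"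

text \<open>
  Matrix indices start at 0, so an output entry is 0 for a zero of the product and the
  maximum witness plus one (its index in \<open>{1..n}\<close>) otherwise.  The output matrix is stored
  row by row.
\<close>

definition mw_output :: "bool mat \<Rightarrow> bool mat \<Rightarrow> (nat \<Rightarrow> nat) \<Rightarrow> bool" where
  "mw_output A B out \<longleftrightarrow>
     (\<forall>i < dim_row A. \<forall>j < dim_col B.
        out (i * dim_col B + j) =
          (if bool_prod A B $$ (i, j) then Max (witnesses A B i j) + 1 else 0))"


section \<open>Pure states of a quantum memory\<close>

text \<open>
  The quantum memory is organised in registers; the pair \<open>(r, t)\<close> is the qubit of
  significance \<open>2 ^ t\<close> in register \<open>r\<close>.  A computational basis state assigns a bit to every
  qubit, and a pure state assigns an amplitude to every basis state.  Every state that is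
  reachable from the all-zero state has finite support.
\<close>

type_synonym qubit = "nat \<times> nat"
type_synonym basis = "qubit \<Rightarrow> bool"
type_synonym qstate = "basis \<Rightarrow> complex"

definition zero_state :: qstate where
  "zero_state b = (if b = (\<lambda>_. False) then 1 else 0)"

text \<open>The value of the \<open>w\<close>-qubit word held by register \<open>r\<close> in a basis state.\<close>

definition word_of :: "nat \<Rightarrow> basis \<Rightarrow> nat \<Rightarrow> nat" where
  "word_of w b r = horner_sum of_bool 2 (map (\<lambda>t. b (r, t)) [0..<w])"

text \<open>Operands of type \<open>'a\<close> come in pairs that denote a register and a position in it.\<close>

datatype 'a gate =
    Hadamard "'a \<times> 'a"
  | T_gate "'a \<times> 'a"
  | X_gate "'a \<times> 'a"
  | CNOT "'a \<times> 'a" "'a \<times> 'a"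
  | Toffoli "'a \<times> 'a" "'a \<times> 'a" "'a \<times> 'a"
  | Oracle_A 'a 'a "'a \<times> 'a"
  | Oracle_B 'a 'a "'a \<times> 'a"
  | QRAM 'a 'a

definition flip_if :: "(basis \<Rightarrow> bool) \<Rightarrow> qubit \<Rightarrow> basis \<Rightarrow> basis" where
  "flip_if P q b = b(q := (b q \<noteq> P b))"

definition entry :: "bool mat \<Rightarrow> nat \<Rightarrow> nat \<Rightarrow> bool" where
  "entry A i j \<longleftrightarrow> i < dim_row A \<and> j < dim_col A \<and> A $$ (i, j)"

text \<open>
  \<open>|i\<rangle>|j\<rangle>|x\<rangle>|z\<rangle> \<mapsto> |i\<rangle>|j\<rangle>|x \<oplus> A[i,j]\<rangle>|z\<rangle>\<close>, where \<open>A[i,j] = 0\<close> if \<open>i\<close> or \<open>j\<close> is out of range.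
  A target inside one of the index registers would make the map non-unitary; such calls, and
  likewise all other gates with overlapping operands, have no effect.
\<close>

definition oracle_call :: "nat \<Rightarrow> bool mat \<Rightarrow> nat \<Rightarrow> nat \<Rightarrow> qubit \<Rightarrow> basis \<Rightarrow> basis" where
  "oracle_call w A ri rj q =
     flip_if (\<lambda>b. fst q \<notin> {ri, rj} \<and> entry A (word_of w b ri) (word_of w b rj)) q"

text \<open>
  \<open>|a\<rangle>|x\<rangle> \<mapsto> |a\<rangle>|x \<oplus> m[a]\<rangle>\<close> for the content \<open>m\<close> of the classical memory and \<open>w\<close>-bit words
  \<open>a\<close> and \<open>x\<close>.
\<close>

definition qram_read :: "nat \<Rightarrow> (nat \<Rightarrow> nat) \<Rightarrow> nat \<Rightarrow> nat \<Rightarrow> basis \<Rightarrow> basis" where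
  "qram_read w m ra rd b =
     (\<lambda>(r, t). b (r, t) \<noteq> (r = rd \<and> ra \<noteq> rd \<and> t < w \<and> bit (m (word_of w b ra)) t))"

text \<open>
  The gates that permute the basis states do so by involutions, so they act on amplitudes by
  composition.
\<close>

primrec apply_gate ::
  "nat \<Rightarrow> bool mat \<Rightarrow> bool mat \<Rightarrow> (nat \<Rightarrow> nat) \<Rightarrow> nat gate \<Rightarrow> qstate \<Rightarrow> qstate" where
  "apply_gate w A B m (Hadamard q) \<psi> =
     (\<lambda>b. (\<psi> (b(q := False)) + (if b q then -1 else 1) * \<psi> (b(q := True))) / complex_of_real (sqrt 2))"
| "apply_gate w A B m (T_gate q) \<psi> = (\<lambda>b. (if b q then cis (pi / 4) else 1) * \<psi> b)"
| "apply_gate w A B m (X_gate q) \<psi> = \<psi> \<circ> flip_if (\<lambda>_. True) q"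
| "apply_gate w A B m (CNOT p q) \<psi> = \<psi> \<circ> flip_if (\<lambda>b. p \<noteq> q \<and> b p) q"
| "apply_gate w A B m (Toffoli p p' q) \<psi> = \<psi> \<circ> flip_if (\<lambda>b. q \<notin> {p, p'} \<and> b p \<and> b p') q"
| "apply_gate w A B m (Oracle_A ri rj q) \<psi> = \<psi> \<circ> oracle_call w A ri rj q"
| "apply_gate w A B m (Oracle_B ri rj q) \<psi> = \<psi> \<circ> oracle_call w B ri rj q"
| "apply_gate w A B m (QRAM ra rd) \<psi> = \<psi> \<circ> qram_read w m ra rd"

definition outcome_prob :: "qstate \<Rightarrow> qubit \<Rightarrow> bool \<Rightarrow> real" where
  "outcome_prob \<psi> q v = (\<Sum>b | \<psi> b \<noteq> 0 \<and> b q = v. (cmod (\<psi> b))\<^sup>2)"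

definition collapse :: "qstate \<Rightarrow> qubit \<Rightarrow> bool \<Rightarrow> qstate" where
  "collapse \<psi> q v =
     (\<lambda>b. if b q = v then \<psi> b / complex_of_real (sqrt (outcome_prob \<psi> q v)) else 0)"


section \<open>Quantum random access machines\<close>

text \<open>
  A classical random access machine with words of \<open>w\<close> bits controls the quantum memory.
  Operands are classical variables; in particular, the registers and positions that a gate or
  a measurement refers to are read from variables.
\<close>

type_synonym vname = nat

datatype binop = Add | Sub | Mul | Div | Mod | Less | Equal

text \<open>Results are reduced modulo \<open>2 ^ w\<close>; subtraction is truncated at 0.\<close>

primrec binop_val :: "nat \<Rightarrow> binop \<Rightarrow> nat \<Rightarrow> nat \<Rightarrow> nat" where
  "binop_val w Add x y = take_bit w (x + y)"
| "binop_val w Sub x y = take_bit w (x - y)"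
| "binop_val w Mul x y = take_bit w (x * y)"
| "binop_val w Div x y = take_bit w (x div y)"
| "binop_val w Mod x y = take_bit w (x mod y)"
| "binop_val w Less x y = take_bit w (of_bool (x < y))"
| "binop_val w Equal x y = take_bit w (of_bool (x = y))"

datatype com =
    Skip
  | Const vname nat
  | Op vname binop vname vname
  | Load vname vname
  | Store vname vname
  | Gate "vname gate"
  | Measure vname "vname \<times> vname"
  | Seq com com
  | If vname com com
  | While vname com

record config =
  vars :: "vname \<Rightarrow> nat"
  mem :: "nat \<Rightarrow> nat"
  qst :: qstate
  time :: nat

definition tick :: "config \<Rightarrow> config" where
  "tick s = s\<lparr>time := Suc (time s)\<rparr>"

definition set_var :: "vname \<Rightarrow> nat \<Rightarrow> config \<Rightarrow> config" where
  "set_var x v s = s\<lparr>vars := (vars s)(x := v)\<rparr>"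

definition measure_qubit :: "vname \<Rightarrow> qubit \<Rightarrow> config \<Rightarrow> config spmf" where
  "measure_qubit x q s =
     map_spmf (\<lambda>v. set_var x (of_bool v) (s\<lparr>qst := collapse (qst s) q v\<rparr>))
       (spmf_of_pmf (bernoulli_pmf (outcome_prob (qst s) q True)))"

partial_function (spmf) while_spmf :: "('s \<Rightarrow> bool) \<Rightarrow> ('s \<Rightarrow> 's spmf) \<Rightarrow> 's \<Rightarrow> 's spmf" where
  "while_spmf P f s = (if P s then bind_spmf (f s) (while_spmf P f) else return_spmf s)"

text \<open>
  The distribution of final configurations; the missing mass is the probability of divergence.
  Every instruction, gate, query, measurement and evaluation of a branch or loop condition
  takes one unit of time.
\<close>

primrec exec :: "nat \<Rightarrow> bool mat \<Rightarrow> bool mat \<Rightarrow> com \<Rightarrow> config \<Rightarrow> config spmf" where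
  "exec w A B Skip s = return_spmf (tick s)"
| "exec w A B (Const x c) s = return_spmf (tick (set_var x (take_bit w c) s))"
| "exec w A B (Op x f y z) s =
     return_spmf (tick (set_var x (binop_val w f (vars s y) (vars s z)) s))"
| "exec w A B (Load x y) s = return_spmf (tick (set_var x (mem s (vars s y)) s))"
| "exec w A B (Store x y) s = return_spmf (tick (s\<lparr>mem := (mem s)(vars s x := vars s y)\<rparr>))"
| "exec w A B (Gate g) s =
     return_spmf (tick (s\<lparr>qst := apply_gate w A B (mem s) (map_gate (vars s) g) (qst s)\<rparr>))"
| "exec w A B (Measure x q) s = measure_qubit x (map_prod (vars s) (vars s) q) (tick s)"
| "exec w A B (Seq c d) s = bind_spmf (exec w A B c s) (exec w A B d)"
| "exec w A B (If x c d) s = (if vars s x \<noteq> 0 then exec w A B c (tick s) else exec w A B d (tick s))"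
| "exec w A B (While x c) s =
     map_spmf tick (while_spmf (\<lambda>s. vars s x \<noteq> 0) (\<lambda>s. exec w A B c (tick s)) s)"

text \<open>The program is given the dimension \<open>n\<close> in variable 0; everything else is initially zero.\<close>

definition init_config :: "nat \<Rightarrow> config" where
  "init_config n = \<lparr>vars = (\<lambda>_. 0)(0 := n), mem = (\<lambda>_. 0), qst = zero_state, time = 0\<rparr>"

text \<open>The length of the binary representation of \<open>n > 0\<close>.\<close>

definition bit_length :: "nat \<Rightarrow> nat" where
  "bit_length n = floor_log n + 1"

text \<open>
  A quantum algorithm is one program for all dimensions together with the constant \<open>c\<close> in the
  word size \<open>c * bit_length n\<close>.
\<close>

definition run :: "nat \<Rightarrow> com \<Rightarrow> nat \<Rightarrow> bool mat \<Rightarrow> bool mat \<Rightarrow> config spmf" where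
  "run c P n A B = exec (c * bit_length n) A B P (init_config n)"

definition solves_MW :: "nat \<Rightarrow> com \<Rightarrow> bool" where
  "solves_MW c P \<longleftrightarrow>
     (\<forall>n \<ge> 1. \<forall>A \<in> carrier_mat n n. \<forall>B \<in> carrier_mat n n.
        measure (measure_spmf (run c P n A B)) {s. mw_output A B (mem s)} \<ge> 2 / 3)"

definition halts_within :: "config spmf \<Rightarrow> real \<Rightarrow> bool" where
  "halts_within p T \<longleftrightarrow> lossless_spmf p \<and> (\<forall>s \<in> set_spmf p. real (time s) \<le> T)"

text \<open>
  Running time in \<open>\<tilde>O(f)\<close> for a function \<open>f\<close> of the dimension and of the numbers of
  non-zero entries of the two matrices.
\<close>

definition runs_in_soft_O :: "nat \<Rightarrow> com \<Rightarrow> (nat \<Rightarrow> nat \<Rightarrow> nat \<Rightarrow> real) \<Rightarrow> bool" where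
  "runs_in_soft_O c P f \<longleftrightarrow>
     (\<exists>(K::real) (d::nat). \<forall>n \<ge> 1. \<forall>A \<in> carrier_mat n n. \<forall>B \<in> carrier_mat n n.
        halts_within (run c P n A B) (K * f n (nnz A) (nnz B) * log 2 (real n + 1) ^ d))"

end

theory Submission
  imports Defs
begin

text \<open>
  Reading both matrices classically costs \<open>n\<^sup>2\<close> queries and reveals which one has fewer non-zero
  entries; if it is \<open>B\<close>, then the algorithm works on the transposed product \<open>B\<^sup>TA\<^sup>T\<close>.  For each row
  \<open>i\<close> of the sparser matrix the column indices of its \<open>a\<^sub>i\<close> non-zero entries are stored in increasing
  order.  For each \<open>j\<close> the position of the maximum witness in this list is then determined bit by
  bit: a Grover search in the upper half of the current range decides whether the range shrinks to
  its upper or to its lower half.  Up to logarithmic factors a search takes time \<open>\<surd>a\<^sub>i\<close>, and by the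
  Cauchy-Schwarz inequality \<open>n \<cdot> (\<Sum>i. \<surd>a\<^sub>i) \<le> n \<cdot> \<surd>(n \<cdot> m)\<close>.  A search never reports a witness that does not
  exist, and repeating it logarithmically often makes the failure probability polynomially small, so
  that a union bound applies to all searches.
\<close>

section \<open>Sure and expected outcomes of programs\<close>

text \<open>The time bound concerns every run, correctness only most runs. Hence no loop stops early
  on success, and time and failure are tracked side by side. As a reported hit is always genuine,
  soundness of the answer is a sure invariant, and only completeness needs a union bound. A range of
  the binary search has length \<open>2 ^ b\<close> and starts at a multiple of
  \<open>2 ^ b\<close>, so its addresses are the settings of \<open>b\<close> free qubits below a
  fixed prefix, and Hadamard gates on these qubits produce the uniform superposition without any
  arithmetic. To make this possible, the lists are padded to a power of two with the index
  \<open>n\<close>, which is out of range. The same qubits serve all searches, so each search has to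
  leave them clear up to a phase; this is the invariant \<open>blank\<close>. One search fails with
  probability at most \<open>(1 / 2) ^ (4 * len)\<close>, which is small against the number
  \<open>n * n * len\<close> of searches. The four logarithmic factors of the running time stem from
  writing registers in a Grover iteration, from repeating an attempt, from the iteration counts
  tried and from the bits of the position.\<close>

definition wp :: "config spmf \<Rightarrow> (config \<Rightarrow> bool) \<Rightarrow> bool" where
  "wp p Q \<longleftrightarrow> lossless_spmf p \<and> (\<forall>s\<in>set_spmf p. Q s)"

text \<open>Values in \<open>ennreal\<close> make every integral meaningful without integrability
  conditions; missing mass contributes 0.\<close>

definition expect :: "config spmf \<Rightarrow> (config \<Rightarrow> ennreal) \<Rightarrow> ennreal" where
  "expect p V = (\<integral>\<^sup>+ s. V s \<partial>measure_spmf p)"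

lemma wp_return [simp]: "wp (return_spmf s) Q \<longleftrightarrow> Q s"
  by (simp add: wp_def)

lemma wp_bind [simp]: "wp (bind_spmf p f) Q \<longleftrightarrow> wp p (\<lambda>s. wp (f s) Q)"
  by (auto simp: wp_def set_bind_spmf)

lemma wp_map [simp]: "wp (map_spmf f p) Q \<longleftrightarrow> wp p (\<lambda>s. Q (f s))"
  by (auto simp: wp_def)

lemma wp_mono: "wp p Q \<Longrightarrow> (\<And>s. s \<in> set_spmf p \<Longrightarrow> Q s \<Longrightarrow> R s) \<Longrightarrow> wp p R"
  by (auto simp: wp_def)

lemma wp_conj: "wp p (\<lambda>s. Q s \<and> R s) \<longleftrightarrow> wp p Q \<and> wp p R"
  by (auto simp: wp_def)

lemma expect_return [simp]: "expect (return_spmf s) V = V s"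
  by (simp add: expect_def nn_integral_return measure_spmf_return_spmf)

lemma expect_bind [simp]: "expect (bind_spmf p f) V = expect p (\<lambda>s. expect (f s) V)"
  unfolding expect_def
  by (simp add: measure_spmf_bind nn_integral_bind[where B="count_space UNIV"] o_def)

lemma expect_map [simp]: "expect (map_spmf f p) V = expect p (\<lambda>s. V (f s))"
  by (simp add: expect_def o_def)

lemma expect_mono: "wp p (\<lambda>s. V s \<le> V' s) \<Longrightarrow> expect p V \<le> expect p V'"
  unfolding expect_def wp_def by (intro nn_integral_mono_AE) simp

lemma expect_const_le: "expect p (\<lambda>_. v) \<le> v"
proof -
  have "emeasure (measure_spmf p) UNIV \<le> 1"
    using measure_spmf.subprob_emeasure_le_1 by blast
  then show ?thesis
    unfolding expect_def using mult_left_mono[of "emeasure (measure_spmf p) UNIV" 1 v]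
    by (simp add: space_measure_spmf)
qed

lemma expect_le: "wp p (\<lambda>s. V s \<le> v) \<Longrightarrow> expect p V \<le> v"
  using expect_mono[of p V "\<lambda>_. v"] expect_const_le[of p v] by (meson order_trans)

section \<open>What a program can change, read off its syntax\<close>

primrec modified :: "com \<Rightarrow> vname set" where
  "modified Skip = {}"
| "modified (Const x c) = {x}"
| "modified (Op x f y z) = {x}"
| "modified (Load x y) = {x}"
| "modified (Store x y) = {}"
| "modified (Gate g) = {}"
| "modified (Measure x q) = {x}"
| "modified (Seq c d) = modified c \<union> modified d"
| "modified (If x c d) = modified c \<union> modified d"
| "modified (While x c) = modified c"

primrec storefree :: "com \<Rightarrow> bool" where
  "storefree Skip = True"
| "storefree (Const x c) = True"
| "storefree (Op x f y z) = True"
| "storefree (Load x y) = True"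
| "storefree (Store x y) = False"
| "storefree (Gate g) = True"
| "storefree (Measure x q) = True"
| "storefree (Seq c d) \<longleftrightarrow> storefree c \<and> storefree d"
| "storefree (If x c d) \<longleftrightarrow> storefree c \<and> storefree d"
| "storefree (While x c) = storefree c"

primrec classical :: "com \<Rightarrow> bool" where
  "classical Skip = True"
| "classical (Const x c) = True"
| "classical (Op x f y z) = True"
| "classical (Load x y) = True"
| "classical (Store x y) = True"
| "classical (Gate g) = False"
| "classical (Measure x q) = False"
| "classical (Seq c d) \<longleftrightarrow> classical c \<and> classical d"
| "classical (If x c d) \<longleftrightarrow> classical c \<and> classical d"
| "classical (While x c) = classical c"

text \<open>Fixed-point induction: the divergent program has empty support, so the claim holds for
  it vacuously, and each unfolding prepends one step of \<open>R\<close> by transitivity.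
  Termination is not claimed.\<close>

lemma set_while_spmf:
  assumes "\<And>s s'. P s \<Longrightarrow> s' \<in> set_spmf (f s) \<Longrightarrow> R s s'" "\<And>s. R s s"
    and "\<And>s s' s''. R s s' \<Longrightarrow> R s' s'' \<Longrightarrow> R s s''"
    and "s' \<in> set_spmf (while_spmf P f s)"
  shows "R s s'"
proof -
  have "\<forall>s. \<forall>s'\<in>set_spmf (while_spmf P f s). R s s'"
  proof (induction rule: while_spmf.fixp_induct)
    case 1
    show ?case by simp
  next
    case 2
    show ?case by simp
  next
    case (3 g)
    show ?case
    proof (intro allI ballI)
      fix s s' assume s': "s' \<in> set_spmf (if P s then bind_spmf (f s) (g P f) else return_spmf s)"
      show "R s s'"
      proof (cases "P s")
        case True
        with s' obtain s1 where "s1 \<in> set_spmf (f s)" "s' \<in> set_spmf (g P f s1)"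
          by (auto simp: set_bind_spmf)
        with 3 True have "R s s1" "R s1 s'" using assms(1) by blast+
        then show ?thesis by (rule assms(3))
      next
        case False
        with s' assms(2) show ?thesis by simp
      qed
    qed
  qed
  then show ?thesis using assms(4) by blast
qed

definition frame :: "com \<Rightarrow> config \<Rightarrow> config \<Rightarrow> bool" where
  "frame c s s' \<longleftrightarrow> (\<forall>x. x \<notin> modified c \<longrightarrow> vars s' x = vars s x) \<and>
     (storefree c \<longrightarrow> mem s' = mem s) \<and> (classical c \<longrightarrow> qst s' = qst s)"

text \<open>This spares all later invariants the enumeration of untouched variables, memory and
  quantum state. In the loop case \<open>set_while_spmf\<close> applies because
  \<open>frame c\<close> is a preorder.\<close>

lemma exec_frame: "s' \<in> set_spmf (exec w A B c s) \<Longrightarrow> frame c s s'"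
proof (induction c arbitrary: s s')
  case (While x c)
  define R where "R = (\<lambda>s s'. frame c s s')"
  obtain s'' where s'': "s'' \<in> set_spmf (while_spmf (\<lambda>s. vars s x \<noteq> 0) (\<lambda>s. exec w A B c (tick s)) s)"
    and "s' = tick s''"
    using While.prems by auto
  moreover have "R s s''"
  proof (rule set_while_spmf[OF _ _ _ s''])
    fix s s' assume "s' \<in> set_spmf (exec w A B c (tick s))"
    then show "R s s'" using While.IH[of s' "tick s"] by (auto simp: R_def frame_def tick_def)
  qed (auto simp: R_def frame_def)
  ultimately show ?case by (auto simp: R_def frame_def tick_def)
next
  case (Seq c1 c2)
  then obtain s1 where "s1 \<in> set_spmf (exec w A B c1 s)" "s' \<in> set_spmf (exec w A B c2 s1)"
    by (auto simp: set_bind_spmf)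
  then have "frame c1 s s1" "frame c2 s1 s'" using Seq.IH by auto
  then show ?case by (auto simp: frame_def)
next
  case (If x c1 c2)
  then have "frame c1 (tick s) s' \<or> frame c2 (tick s) s'" by (auto split: if_splits)
  then show ?case by (auto simp: frame_def tick_def)
qed (auto simp: frame_def tick_def set_var_def measure_qubit_def)

lemma wp_frame:
  assumes "wp (exec w A B c s) Q" "\<And>s'. frame c s s' \<Longrightarrow> Q s' \<Longrightarrow> R s'"
  shows "wp (exec w A B c s) R"
  using assms wp_mono exec_frame by metis

text \<open>
  Time and the property \<open>Q\<close> hold surely, whereas the potential \<open>V\<close> is only bounded in expectation;
  for \<open>V\<close> the indicator of failure this bounds the failure probability.
\<close>

definition triple :: "nat \<Rightarrow> bool mat \<Rightarrow> bool mat \<Rightarrow> com \<Rightarrow> config \<Rightarrow> nat \<Rightarrow> (config \<Rightarrow> bool) \<Rightarrow>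
    (config \<Rightarrow> ennreal) \<Rightarrow> ennreal \<Rightarrow> bool" where
  "triple w A B c s T Q V v \<longleftrightarrow>
     wp (exec w A B c s) (\<lambda>s'. time s' \<le> time s + T \<and> Q s') \<and> expect (exec w A B c s) V \<le> v"

lemma triple_det:
  "wp (exec w A B c s) (\<lambda>s'. time s' \<le> time s + T \<and> Q s' \<and> V s' \<le> v) \<Longrightarrow> triple w A B c s T Q V v"
  unfolding triple_def by (auto simp: wp_conj intro: expect_le)

lemma triple_conseq:
  assumes "triple w A B c s T Q V v" "T \<le> T'" "v \<le> v'"
    and "\<And>s'. frame c s s' \<Longrightarrow> Q s' \<Longrightarrow> Q' s' \<and> V' s' \<le> V s'"
  shows "triple w A B c s T' Q' V' v'"
proof -
  have *: "wp (exec w A B c s) (\<lambda>s'. time s' \<le> time s + T' \<and> Q' s' \<and> V' s' \<le> V s')"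
    using assms unfolding triple_def by (auto elim!: wp_frame)
  moreover have "expect (exec w A B c s) V' \<le> expect (exec w A B c s) V"
    using * by (intro expect_mono) (simp add: wp_conj)
  ultimately show ?thesis using assms(1,3) unfolding triple_def by (auto simp: wp_conj)
qed

text \<open>Law of total expectation: \<open>V1\<close> at an intermediate state bounds the
  conditional expectation of \<open>V\<close>, and the expectation of \<open>V1\<close> is at most
  \<open>v\<close>.\<close>

lemma triple_Seq:
  assumes "triple w A B c s T1 Q1 V1 v"
    and "\<And>s1. frame c s s1 \<Longrightarrow> Q1 s1 \<Longrightarrow> triple w A B d s1 T2 Q V (V1 s1)"
  shows "triple w A B (Seq c d) s (T1 + T2) Q V v"
proof -
  have *: "wp (exec w A B c s) (\<lambda>s1. time s1 \<le> time s + T1 \<and> triple w A B d s1 T2 Q V (V1 s1))"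
    using assms unfolding triple_def by (auto elim!: wp_frame)
  have "wp (exec w A B (Seq c d) s) (\<lambda>s'. time s' \<le> time s + (T1 + T2) \<and> Q s')"
    using * unfolding triple_def by (auto elim!: wp_mono)
  moreover have "expect (exec w A B c s) (\<lambda>s. expect (exec w A B d s) V) \<le> expect (exec w A B c s) V1"
    using * by (intro expect_mono) (auto simp: triple_def elim!: wp_mono)
  ultimately show ?thesis using assms(1) unfolding triple_def by (auto simp: order_trans)
qed

text \<open>The first program carries no risk, so the bound \<open>v\<close> passes through it as a
  constant potential.\<close>

lemma triple_Seq_det:
  assumes "wp (exec w A B c s) (\<lambda>s'. time s' \<le> time s + T1 \<and> Q1 s')"
    and "\<And>s1. frame c s s1 \<Longrightarrow> Q1 s1 \<Longrightarrow> triple w A B d s1 T2 Q V v"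
  shows "triple w A B (Seq c d) s (T1 + T2) Q V v"
  using assms by (intro triple_Seq[where ?V1.0 = "\<lambda>_. v" and ?Q1.0 = Q1]) (auto intro!: triple_det elim: wp_mono)

section \<open>Counting loops\<close>

abbreviation (input) v_n :: vname where "v_n \<equiv> 0"
abbreviation (input) v_cond :: vname where "v_cond \<equiv> 1"
abbreviation (input) v_zero :: vname where "v_zero \<equiv> 2"
abbreviation (input) v_one :: vname where "v_one \<equiv> 3"

text \<open>The condition is recomputed at the end of the body, so nested loops can share
  \<open>v_cond\<close>. Test, increment and comparison cost 3 per iteration; the two initial
  instructions and the final tick cost another 3.\<close>

definition For :: "vname \<Rightarrow> vname \<Rightarrow> com \<Rightarrow> com" where
  "For i N c = Seq (Const i 0) (Seq (Op v_cond Less i N)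
     (While v_cond (Seq c (Seq (Op i Add i v_one) (Op v_cond Less i N)))))"

lemma modified_For [simp]: "modified (For i N c) = insert i (insert v_cond (modified c))"
  by (auto simp: For_def)

lemma storefree_For [simp]: "storefree (For i N c) = storefree c"
  by (simp add: For_def)

lemma classical_For [simp]: "classical (For i N c) = classical c"
  by (simp add: For_def)

lemma wp_seqI:
  assumes "wp (exec w A B c s) (\<lambda>s'. time s' \<le> time s + T \<and> Q1 s')"
    and "\<And>s1. frame c s s1 \<Longrightarrow> time s1 \<le> time s + T \<Longrightarrow> Q1 s1 \<Longrightarrow> wp (exec w A B d s1) Q"
  shows "wp (exec w A B (Seq c d) s) Q"
  using assms(1) unfolding exec.simps wp_bind by (rule wp_frame) (use assms(2) in auto)

lemma wp_lastI:
  assumes "wp (exec w A B c s) (\<lambda>s'. time s' \<le> time s + T \<and> Q1 s')"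
    and "\<And>s1. frame c s s1 \<Longrightarrow> time s1 \<le> time s + T \<Longrightarrow> Q1 s1 \<Longrightarrow> Q s1"
  shows "wp (exec w A B c s) Q"
  using assms(1) by (rule wp_frame) (use assms(2) in auto)

text \<open>The clock is left out on purpose: an invariant that is stable in this sense survives the
  bookkeeping of a loop, including its ticks.\<close>

definition same_but :: "vname set \<Rightarrow> config \<Rightarrow> config \<Rightarrow> bool" where
  "same_but X s s' \<longleftrightarrow> (\<forall>x. x \<notin> X \<longrightarrow> vars s' x = vars s x) \<and> mem s' = mem s \<and> qst s' = qst s"

text \<open>Induction on the remaining iterations \<open>m - k\<close>. \<open>V\<close> acts as a
  supermartingale: a run of the body does not increase it in expectation. By
  \<open>m < 2 ^ w\<close> the counter never wraps around.\<close>

lemma while_spmf_For: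
  fixes s0 :: config and w :: nat and V :: "nat \<Rightarrow> config \<Rightarrow> ennreal" and A B :: "bool mat"
    and c :: com and i N :: vname
  defines "loop \<equiv> while_spmf (\<lambda>s. vars s v_cond \<noteq> 0)
      (\<lambda>s. exec w A B (Seq c (Seq (Op i Add i v_one) (Op v_cond Less i N))) (tick s))"
  assumes w: "0 < w" and m: "m < 2 ^ w"
    and N: "vars s0 N = m" and one: "vars s0 v_one = 1"
    and ne: "i \<noteq> N" "i \<noteq> v_one" "i \<noteq> v_cond" "N \<noteq> v_cond"
    and nm: "i \<notin> modified c" "N \<notin> modified c" "v_one \<notin> modified c"
    and stab: "\<And>k s s'. I k s \<Longrightarrow> same_but {i, v_cond} s s' \<Longrightarrow> I k s' \<and> V k s' = V k s"
    and body: "\<And>k s. k < m \<Longrightarrow> I k s \<Longrightarrow> vars s i = k \<Longrightarrow> frame (For i N c) s0 s \<Longrightarrow>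
        triple w A B c s (T k) (I (Suc k)) (V (Suc k)) (V k s)"
  shows "k \<le> m \<Longrightarrow> I k s \<Longrightarrow> vars s i = k \<Longrightarrow> vars s v_cond = of_bool (k < m) \<Longrightarrow> frame (For i N c) s0 s \<Longrightarrow>
    wp (loop s) (\<lambda>s'. time s' \<le> time s + (\<Sum>j = k..<m. T j + 3) \<and> I m s') \<and> expect (loop s) (V m) \<le> V k s"
proof (induction "m - k" arbitrary: k s)
  case 0
  then show ?case by (simp add: loop_def while_spmf.simps[of _ _ s])
next
  case (Suc d)
  define s1 where "s1 = tick s"
  have km: "k < m" using Suc by simp
  have f1: "frame (For i N c) s0 s1" "I k s1" "V k s1 = V k s" "vars s1 i = k"
    using Suc.prems stab[of k s s1] by (auto simp: s1_def tick_def frame_def same_but_def)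
  \<comment> \<open>One unfolding of the loop. Increment and comparison are deterministic, so they
    become part of the configuration at which the loop continues.\<close>
  have loop: "loop s = bind_spmf (exec w A B c s1) (\<lambda>s2. loop (tick (set_var v_cond (binop_val w Less (vars s2 i + 1) m)
      (tick (set_var i (vars s2 i + 1) s2)))))" (is "_ = bind_spmf _ (\<lambda>s2. loop (?nxt s2))")
    if "\<And>s2. s2 \<in> set_spmf (exec w A B c s1) \<Longrightarrow> vars s2 i = k \<and> vars s2 N = m \<and> vars s2 v_one = 1"
  proof -
    have "loop s = bind_spmf (exec w A B (Seq c (Seq (Op i Add i v_one) (Op v_cond Less i N))) s1) loop"
      using Suc.prems km by (simp add: loop_def while_spmf.simps[of _ _ s] s1_def del: exec.simps)
    also have "\<dots> = bind_spmf (exec w A B c s1) (\<lambda>s2. loop (?nxt s2))"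
      unfolding exec.simps bind_spmf_assoc
    proof (rule bind_spmf_cong[OF refl])
      fix s2 assume "s2 \<in> set_spmf (exec w A B c s1)"
      from that[OF this] km m ne show "bind_spmf (return_spmf (tick (set_var i (binop_val w Add (vars s2 i) (vars s2 v_one)) s2)))
           (\<lambda>s. bind_spmf (return_spmf (tick (set_var v_cond (binop_val w Less (vars s i) (vars s N)) s))) loop) =
          loop (?nxt s2)"
        by (simp add: set_var_def tick_def take_bit_nat_eq_self)
    qed
    finally show ?thesis .
  qed
  have fr: "vars s2 i = k \<and> vars s2 N = m \<and> vars s2 v_one = 1 \<and> frame (For i N c) s0 s2"
    if "frame c s1 s2" for s2
    using that f1 N one ne nm by (auto simp: frame_def)
  have trip: "triple w A B c s1 (T k) (I (Suc k)) (V (Suc k)) (V k s)"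
    using body[OF km, of s1] f1 by simp
  define n where "n s2 = tick (set_var v_cond (binop_val w Less (vars s2 i + 1) m) (tick (set_var i (vars s2 i + 1) s2)))" for s2
  have step: "wp (loop (n s2)) (\<lambda>s'. time s' \<le> time s2 + 2 + (\<Sum>j = Suc k..<m. T j + 3) \<and> I m s') \<and>
      expect (loop (n s2)) (V m) \<le> V (Suc k) s2"
    if "frame c s1 s2" "I (Suc k) s2" for s2
  proof -
    have a: "same_but {i, v_cond} s2 (n s2)"
      by (auto simp: same_but_def tick_def set_var_def n_def)
    have b: "take_bit w (of_bool P) = (of_bool P :: nat)" for P
      using w by (cases P) (simp_all add: take_bit_nat_eq_self)
    have "frame (For i N c) s0 (n s2)" "vars (n s2) i = Suc k" "vars (n s2) v_cond = of_bool (Suc k < m)"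
      using fr[OF that(1)] ne by (auto simp: frame_def tick_def set_var_def b n_def)
    moreover have "time (n s2) = time s2 + 2" by (simp add: n_def tick_def set_var_def)
    ultimately show ?thesis
      using Suc.hyps(1)[of "Suc k" "n s2"] stab[OF that(2) a] Suc.hyps(2) km by simp
  qed
  have L: "loop s = bind_spmf (exec w A B c s1) (\<lambda>s2. loop (n s2))"
    unfolding n_def using fr exec_frame by (intro loop) blast
  have w1: "wp (exec w A B c s1) (\<lambda>s2. time s2 \<le> time s1 + T k \<and> I (Suc k) s2 \<and> frame c s1 s2)"
    using trip unfolding triple_def by (auto elim: wp_frame)
  have sum: "(\<Sum>j = k..<m. T j + 3) = T k + 3 + (\<Sum>j = Suc k..<m. T j + 3)"
    using km by (simp add: sum.atLeast_Suc_lessThan)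
  have "wp (loop s) (\<lambda>s'. time s' \<le> time s + (\<Sum>j = k..<m. T j + 3) \<and> I m s')"
    unfolding L wp_bind using w1
  proof (rule wp_mono)
    fix s2 assume "time s2 \<le> time s1 + T k \<and> I (Suc k) s2 \<and> frame c s1 s2"
    with step[of s2] show "wp (loop (n s2)) (\<lambda>s'. time s' \<le> time s + (\<Sum>j = k..<m. T j + 3) \<and> I m s')"
      unfolding sum by (auto elim!: wp_mono simp: s1_def tick_def)
  qed
  moreover have "expect (loop s) (V m) \<le> V k s"
  proof -
    have "expect (loop s) (V m) \<le> expect (exec w A B c s1) (V (Suc k))"
      unfolding L expect_bind using w1 by (intro expect_mono) (erule wp_mono, use step in blast)
    also have "\<dots> \<le> V k s" using trip by (simp add: triple_def)
    finally show ?thesis .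
  qed
  ultimately show ?case ..
qed

text \<open>\<open>T\<close> may depend on the iteration, because the rows of a sparse matrix cost
  different amounts.\<close>

lemma triple_For:
  assumes w: "0 < w" and m: "m < 2 ^ w"
    and N: "vars s0 N = m" and one: "vars s0 v_one = 1"
    and ne: "i \<noteq> N" "i \<noteq> v_one" "i \<noteq> v_cond" "N \<noteq> v_cond"
    and nm: "i \<notin> modified c" "N \<notin> modified c" "v_one \<notin> modified c"
    and stab: "\<And>k s s'. I k s \<Longrightarrow> same_but {i, v_cond} s s' \<Longrightarrow> I k s' \<and> V k s' = V k s"
    and init: "I 0 s0"
    and body: "\<And>k s. k < m \<Longrightarrow> I k s \<Longrightarrow> vars s i = k \<Longrightarrow> frame (For i N c) s0 s \<Longrightarrow>
        triple w A B c s (T k) (I (Suc k)) (V (Suc k)) (V k s)"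
  shows "triple w A B (For i N c) s0 (3 + (\<Sum>k<m. T k + 3)) (I m) (V m) (V 0 s0)"
proof -
  define loop where "loop = while_spmf (\<lambda>s. vars s v_cond \<noteq> 0)
      (\<lambda>s. exec w A B (Seq c (Seq (Op i Add i v_one) (Op v_cond Less i N))) (tick s))"
  let ?s1 = "tick (set_var v_cond (of_bool (0 < m)) (tick (set_var i 0 s0)))"
  have b: "take_bit w (of_bool P) = (of_bool P :: nat)" for P
    using w by (cases P) (simp_all add: take_bit_nat_eq_self)
  have ex: "exec w A B (For i N c) s0 = map_spmf tick (loop ?s1)"
    using N ne by (simp add: For_def loop_def b) (simp add: set_var_def tick_def)
  have a: "same_but {i, v_cond} s0 ?s1"
    by (auto simp: same_but_def tick_def set_var_def)
  have fr: "frame (For i N c) s0 ?s1"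
    by (auto simp: frame_def tick_def set_var_def)
  have v: "vars ?s1 i = 0" "vars ?s1 v_cond = of_bool (0 < m)"
    using ne by (simp_all add: tick_def set_var_def)
  have I0: "I 0 ?s1" "V 0 ?s1 = V 0 s0" using stab[OF init a] by simp_all
  have main: "wp (loop ?s1) (\<lambda>s'. time s' \<le> time ?s1 + (\<Sum>j = 0..<m. T j + 3) \<and> I m s') \<and>
      expect (loop ?s1) (V m) \<le> V 0 ?s1"
    unfolding loop_def
    by (rule while_spmf_For[OF w m N one ne nm stab body _ I0(1) v fr]) auto
  have t: "same_but {i, v_cond} s (tick s)" for s
    by (simp add: same_but_def tick_def)
  have tI: "I m s \<Longrightarrow> I m (tick s) \<and> V m (tick s) = V m s" for s
    using stab[OF _ t] .
  have W: "wp (loop ?s1) (\<lambda>s'. time (tick s') \<le> time s0 + (3 + (\<Sum>k<m. T k + 3)) \<and> I m (tick s') \<and> V m (tick s') = V m s')"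
    using main tI by (auto elim!: wp_mono simp: tick_def set_var_def lessThan_atLeast0)
  have "expect (loop ?s1) (\<lambda>s. V m (tick s)) \<le> expect (loop ?s1) (V m)"
    by (intro expect_mono wp_mono[OF W]) simp
  then show ?thesis
    using W main I0 unfolding triple_def ex by (auto simp: wp_conj)
qed

lemma wp_For:
  assumes w: "0 < w" and m: "m < 2 ^ w"
    and N: "vars s0 N = m" and one: "vars s0 v_one = 1"
    and ne: "i \<noteq> N" "i \<noteq> v_one" "i \<noteq> v_cond" "N \<noteq> v_cond"
    and nm: "i \<notin> modified c" "N \<notin> modified c" "v_one \<notin> modified c"
    and stab: "\<And>k s s'. I k s \<Longrightarrow> same_but {i, v_cond} s s' \<Longrightarrow> I k s'"
    and init: "I 0 s0"
    and body: "\<And>k s. k < m \<Longrightarrow> I k s \<Longrightarrow> vars s i = k \<Longrightarrow> frame (For i N c) s0 s \<Longrightarrow>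
        wp (exec w A B c s) (\<lambda>s'. time s' \<le> time s + T \<and> I (Suc k) s')"
  shows "wp (exec w A B (For i N c) s0) (\<lambda>s'. time s' \<le> time s0 + (3 + m * (T + 3)) \<and> I m s')"
proof -
  have "triple w A B (For i N c) s0 (3 + (\<Sum>k<m. T + 3)) (I m) (\<lambda>_. 0) 0"
  proof (rule triple_For[where V = "\<lambda>_ _. 0" and T = "\<lambda>_. T" and I = I, OF w m N one ne nm _ init])
    show "triple w A B c s T (I (Suc k)) (\<lambda>_. 0) 0"
      if "k < m" "I k s" "vars s i = k" "frame (For i N c) s0 s" for k s
      using body[OF that] by (intro triple_det) simp
  qed (use stab in blast)
  then show ?thesis by (simp add: triple_def)
qed

section \<open>Quantum states\<close>

lemma bit_word_of [simp]: "bit (word_of w b r) t \<longleftrightarrow> t < w \<and> b (r, t)"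
  by (auto simp: word_of_def bit_horner_sum_bit_iff)

lemma word_of_eqI: "(\<And>t. bit v t \<longleftrightarrow> t < w \<and> b (r, t)) \<Longrightarrow> word_of w b r = v"
  by (rule bit_eqI) simp

text \<open>Only the lowest \<open>t\<close> bits are added, so that a register written bit by bit
  can be described after each step.\<close>

definition xor_reg :: "nat \<Rightarrow> nat \<Rightarrow> nat \<Rightarrow> basis \<Rightarrow> basis" where
  "xor_reg t r v b = (\<lambda>(r', u). b (r', u) \<noteq> (r' = r \<and> u < t \<and> bit v u))"

lemma xor_reg_apply: "xor_reg t r v b (r', u) \<longleftrightarrow> b (r', u) \<noteq> (r' = r \<and> u < t \<and> bit v u)"
  by (simp add: xor_reg_def)

lemma xor_reg_invol [simp]: "xor_reg t r v (xor_reg t r v b) = b"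
  by (auto simp: fun_eq_iff xor_reg_apply)

lemma xor_reg_commute: "xor_reg t r v (xor_reg t' r' v' b) = xor_reg t' r' v' (xor_reg t r v b)"
  by (auto simp: fun_eq_iff xor_reg_apply)

lemma xor_reg_0 [simp]: "xor_reg 0 r v b = b"
  by (auto simp: fun_eq_iff xor_reg_apply)

lemma flip_if_True_invol [simp]: "flip_if (\<lambda>_. True) q (flip_if (\<lambda>_. True) q b) = b"
  by (auto simp: flip_if_def)

lemma oracle_call_apply:
  "oracle_call w M ri rj q b x \<longleftrightarrow>
    b x \<noteq> (x = q \<and> fst q \<notin> {ri, rj} \<and> entry M (word_of w b ri) (word_of w b rj))"
  by (auto simp: oracle_call_def flip_if_def)

lemma word_of_cong: "(\<And>t. t < w \<Longrightarrow> b (r, t) = b' (r, t)) \<Longrightarrow> word_of w b r = word_of w b' r"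
  by (rule bit_eqI) auto

text \<open>A target outside the index registers leaves both indices as they are, so a second call
  adds the same entry again; with a target inside, the call is the identity.\<close>

lemma oracle_call_invol [simp]: "oracle_call w M ri rj q (oracle_call w M ri rj q b) = b"
proof (cases "fst q \<in> {ri, rj}")
  case True
  then show ?thesis by (auto simp: fun_eq_iff oracle_call_apply)
next
  case False
  have "word_of w (oracle_call w M ri rj q b) r = word_of w b r" if "r \<in> {ri, rj}" for r
    using that False by (intro word_of_cong) (auto simp: oracle_call_apply)
  then show ?thesis by (auto simp: fun_eq_iff oracle_call_apply)
qed

lemma qram_read_apply:
  "qram_read w m ra rd b (r, t) \<longleftrightarrow> b (r, t) \<noteq> (r = rd \<and> ra \<noteq> rd \<and> t < w \<and> bit (m (word_of w b ra)) t)"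
  by (simp add: qram_read_def)

lemma qram_read_invol [simp]: "qram_read w m ra rd (qram_read w m ra rd b) = b"
proof (cases "ra = rd")
  case True
  then show ?thesis by (auto simp: fun_eq_iff qram_read_apply)
next
  case False
  have "word_of w (qram_read w m ra rd b) ra = word_of w b ra"
    using False by (intro word_of_cong) (auto simp: qram_read_apply)
  then show ?thesis by (auto simp: fun_eq_iff qram_read_apply)
qed

section \<open>Hadamard transforms of the low address bits\<close>

definition had :: "qubit \<Rightarrow> qstate \<Rightarrow> qstate" where
  "had q \<psi> = (\<lambda>b. (\<psi> (b(q := False)) + (if b q then -1 else 1) * \<psi> (b(q := True))) / complex_of_real (sqrt 2))"

primrec hads :: "nat \<Rightarrow> qstate \<Rightarrow> qstate" where
  "hads 0 \<psi> = \<psi>"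
| "hads (Suc t) \<psi> = had (0, t) (hads t \<psi>)"

lemma sqrt2_sq: "complex_of_real (sqrt 2) * complex_of_real (sqrt 2) = 2"
  by (metis of_real_mult of_real_numeral real_sqrt_mult_self abs_numeral)

lemma had_had [simp]: "had q (had q \<psi>) = \<psi>"
proof
  fix b :: basis
  have *: "x / complex_of_real (sqrt 2) / complex_of_real (sqrt 2) = x / 2" for x
    using sqrt2_sq by (simp add: divide_divide_eq_left)
  have "had q (had q \<psi>) b = ((\<psi> (b(q := False)) + \<psi> (b(q := True))) / complex_of_real (sqrt 2) +
      (if b q then -1 else 1) * ((\<psi> (b(q := False)) - \<psi> (b(q := True))) / complex_of_real (sqrt 2))) / complex_of_real (sqrt 2)"
    by (simp add: had_def)
  also have "\<dots> = ((\<psi> (b(q := False)) + \<psi> (b(q := True))) +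
      (if b q then -1 else 1) * (\<psi> (b(q := False)) - \<psi> (b(q := True)))) / complex_of_real (sqrt 2) / complex_of_real (sqrt 2)"
    by (simp add: add_divide_distrib)
  also have "\<dots> = \<psi> b"
    unfolding * by (cases "b q") (auto simp: fun_upd_idem)
  finally show "had q (had q \<psi>) b = \<psi> b" .
qed

lemma had_commute: "p \<noteq> q \<Longrightarrow> had p (had q \<psi>) = had q (had p \<psi>)"
  by (auto simp: had_def fun_eq_iff fun_upd_twist[of p q] add_divide_distrib algebra_simps)

lemma had_hads_commute: "t \<le> u \<Longrightarrow> had (0, u) (hads t \<psi>) = hads t (had (0, u) \<psi>)"
  by (induction t) (auto simp: had_commute[of "(0, u)"])

lemma hads_hads [simp]: "hads t (hads t \<psi>) = \<psi>"
  by (induction t arbitrary: \<psi>) (auto simp flip: had_hads_commute)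

lemma hads_linear: "hads t (\<lambda>b. \<psi> b - k * \<phi> b) = (\<lambda>b. hads t \<psi> b - k * hads t \<phi> b)"
proof (induction t)
  case (Suc t)
  have "had q (\<lambda>b. f b - k * g b) = (\<lambda>b. had q f b - k * had q g b)" for q f g
    by (auto simp: had_def diff_divide_distrib add_divide_distrib algebra_simps)
  with Suc show ?case by simp
qed simp

definition free_low :: "nat \<Rightarrow> basis \<Rightarrow> basis set" where
  "free_low t c = {b. \<forall>r u. r \<noteq> 0 \<or> t \<le> u \<longrightarrow> b (r, u) = c (r, u)}"

lemma free_low_0 [simp]: "free_low 0 c = {c}"
  by (auto simp: free_low_def fun_eq_iff)

lemma free_low_Suc: "free_low (Suc t) c = free_low t (c((0, t) := False)) \<union> free_low t (c((0, t) := True))"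
  by (auto simp: free_low_def le_Suc_eq)

lemma free_low_disjoint: "free_low t (c((0, t) := False)) \<inter> free_low t (c((0, t) := True)) = {}"
  by (auto simp: free_low_def)

lemma finite_card_free_low: "finite (free_low t c) \<and> card (free_low t c) = 2 ^ t"
  by (induction t arbitrary: c) (simp_all add: free_low_Suc free_low_disjoint card_Un_disjoint)

lemmas finite_free_low [simp] = finite_card_free_low[THEN conjunct1]
lemmas card_free_low [simp] = finite_card_free_low[THEN conjunct2]

lemma self_in_free_low [simp]: "c \<in> free_low t c"
  by (simp add: free_low_def)

text \<open>At a basis state whose searched bits are all 0 every Hadamard sign is positive, so the
  amplitude is the inner product with the uniform superposition.\<close>

lemma hads_at_base:
  "\<forall>u<t. \<not> c (0, u) \<Longrightarrow> hads t \<psi> c = (\<Sum>b\<in>free_low t c. \<psi> b) / complex_of_real (sqrt 2) ^ t"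
proof (induction t arbitrary: c)
  case (Suc t)
  have IH: "hads t \<psi> (c((0, t) := v)) =
      (\<Sum>b\<in>free_low t (c((0, t) := v)). \<psi> b) / complex_of_real (sqrt 2) ^ t" for v
    using Suc.prems by (intro Suc.IH) auto
  have "hads (Suc t) \<psi> c = (hads t \<psi> (c((0, t) := False)) + hads t \<psi> (c((0, t) := True))) / complex_of_real (sqrt 2)"
    using Suc.prems by (simp add: had_def)
  also have "\<dots> = ((\<Sum>b\<in>free_low t (c((0, t) := False)). \<psi> b) / complex_of_real (sqrt 2) ^ t +
      (\<Sum>b\<in>free_low t (c((0, t) := True)). \<psi> b) / complex_of_real (sqrt 2) ^ t) / complex_of_real (sqrt 2)"
    by (simp only: IH)
  also have "\<dots> = (\<Sum>b\<in>free_low (Suc t) c. \<psi> b) / complex_of_real (sqrt 2) ^ Suc t"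
    unfolding free_low_Suc
    by (subst sum.union_disjoint) (auto simp: free_low_disjoint add_divide_distrib mult.commute)
  finally show ?case .
qed simp

lemma hads_support:
  assumes "\<And>b. b \<notin> free_low t c \<Longrightarrow> \<psi> b = 0" "u \<le> t" "b \<notin> free_low t c"
  shows "hads u \<psi> b = 0"
  using assms(2,3)
proof (induction u arbitrary: b)
  case (Suc u)
  have "b((0, u) := v) \<notin> free_low t c" for v
    using Suc.prems by (auto simp: free_low_def)
  then show ?case using Suc by (simp add: had_def)
qed (use assms(1) in simp)

lemma hads_ket:
  assumes "\<forall>u<t. \<not> c (0, u)"
  shows "hads t (\<lambda>b. if b = c then z else 0) =
    (\<lambda>b. if b \<in> free_low t c then z / complex_of_real (sqrt 2) ^ t else 0)"
  using assms
proof (induction t)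
  case (Suc t)
  have ct: "\<not> c (0, t)" using Suc.prems by simp
  have a: "b((0, t) := True) \<notin> free_low t c" for b
  proof
    assume "b((0, t) := True) \<in> free_low t c"
    then have "(b((0, t) := True)) (0, t) = c (0, t)" unfolding free_low_def by blast
    with ct show False by simp
  qed
  have b: "b((0, t) := False) \<in> free_low t c \<longleftrightarrow> b \<in> free_low (Suc t) c" for b
    using ct by (auto simp: free_low_def)
  show ?case using Suc a b by (auto simp: had_def fun_eq_iff)
qed auto

section \<open>Grover's rotation\<close>

text \<open>
  Every state of Grover's search has this form; \<open>\<alpha>\<close> and \<open>\<beta>\<close> are the coordinates in a plane that an
  iteration rotates by twice the angle below.
\<close>

definition two_level :: "(basis \<Rightarrow> bool) \<Rightarrow> basis set \<Rightarrow> complex \<Rightarrow> complex \<Rightarrow> qstate" where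
  "two_level g C \<alpha> \<beta> = (\<lambda>b. if b \<in> C then if g b then \<alpha> else \<beta> else 0)"

text \<open>\<open>f\<close> is the identity for the mean amplitude and the squared modulus for the
  norm.\<close>

lemma sum_two_level:
  assumes "finite C"
  shows "(\<Sum>b\<in>C. f (two_level g C \<alpha> \<beta> b)) =
    of_nat (card {b\<in>C. g b}) * f \<alpha> + of_nat (card {b\<in>C. \<not> g b}) * (f \<beta> :: 'a::comm_semiring_1)"
proof -
  have "(\<Sum>b\<in>C. f (two_level g C \<alpha> \<beta> b)) = (\<Sum>b\<in>C. if g b then f \<alpha> else f \<beta>)"
    by (intro sum.cong) (auto simp: two_level_def)
  then show ?thesis using assms by (simp add: sum.If_cases Int_def)
qed

lemma sqrt2_power_sq: "(complex_of_real (sqrt 2) ^ t) * (complex_of_real (sqrt 2) ^ t) = 2 ^ t"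
  using sqrt2_sq by (metis power_mult_distrib)

text \<open>Conjugating the sign flip at \<open>c\<close> by Hadamards gives the reflection
  \<open>1 - 2 |u><u|\<close> for the uniform superposition \<open>u\<close>. Since \<mu> is the
  mean amplitude after the phase flip, this is inversion about the mean up to the global sign
  -1.\<close>

lemma grover_step:
  fixes M M' :: nat and \<alpha> \<beta> :: complex
  assumes c: "\<forall>u<t. \<not> c (0, u)"
    and M: "M = card {b\<in>free_low t c. g b}" "M' = card {b\<in>free_low t c. \<not> g b}"
  defines "\<mu> \<equiv> (of_nat M' * \<beta> - of_nat M * \<alpha>) / 2 ^ t"
  shows "hads t (\<lambda>b. (if b = c then -1 else 1) *
      hads t (\<lambda>b. (if g b then -1 else 1) * two_level g (free_low t c) \<alpha> \<beta> b) b) =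
    two_level g (free_low t c) (- (\<alpha> + 2 * \<mu>)) (\<beta> - 2 * \<mu>)"
proof -
  let ?C = "free_low t c" and ?s = "complex_of_real (sqrt 2) ^ t"
  define \<psi> where "\<psi> = two_level g ?C (- \<alpha>) \<beta>"
  have 1: "(\<lambda>b. (if g b then -1 else 1) * two_level g ?C \<alpha> \<beta> b) = \<psi>"
    by (auto simp: \<psi>_def two_level_def)
  have "(\<Sum>b\<in>?C. \<psi> b) = of_nat M' * \<beta> - of_nat M * \<alpha>"
    unfolding \<psi>_def using sum_two_level[of ?C "\<lambda>x. x" g "- \<alpha>" \<beta>] by (simp add: M)
  then have 2: "hads t \<psi> c = 2 ^ t * \<mu> / ?s"
    using hads_at_base[OF c, of \<psi>] by (simp add: \<mu>_def)
  \<comment> \<open>A sign flip at one basis state subtracts twice the component there, and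
    linearity carries this through the Hadamards.\<close>
  have "(\<lambda>b. (if b = c then -1 else 1) * hads t \<psi> b) = (\<lambda>b. hads t \<psi> b - 2 * (if b = c then hads t \<psi> c else 0))"
    by auto
  then have "hads t (\<lambda>b. (if b = c then -1 else 1) * hads t \<psi> b) =
      (\<lambda>b. \<psi> b - 2 * (if b \<in> ?C then hads t \<psi> c / ?s else 0))"
    by (simp add: hads_linear hads_ket[OF c])
  also have "\<dots> = (\<lambda>b. \<psi> b - 2 * (if b \<in> ?C then \<mu> else 0))"
  proof -
    have "hads t \<psi> c / ?s = 2 ^ t * \<mu> / (?s * ?s)" by (simp add: 2)
    also have "\<dots> = \<mu>" unfolding sqrt2_power_sq by simp
    finally show ?thesis by (simp only:)
  qed
  also have "\<dots> = two_level g ?C (- (\<alpha> + 2 * \<mu>)) (\<beta> - 2 * \<mu>)"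
    by (auto simp: \<psi>_def two_level_def)
  finally show ?thesis by (simp add: 1)
qed

text \<open>Multiplying by the square roots instead of dividing keeps the equations meaningful when
  there are no good or no bad elements.\<close>

definition angle_amps :: "nat \<Rightarrow> nat \<Rightarrow> real \<Rightarrow> real \<Rightarrow> real \<Rightarrow> bool" where
  "angle_amps M M' x a b \<longleftrightarrow> sqrt M * a = sin x \<and> sqrt M' * b = cos x"

definition grover_angle :: "nat \<Rightarrow> nat \<Rightarrow> real" where
  "grover_angle M M' = arcsin (sqrt (M / (M + M')))"

lemma sin_cos_grover_angle:
  assumes "M + M' > 0"
  shows "sin (grover_angle M M') = sqrt (real M / real (M + M'))"
    and "cos (grover_angle M M') = sqrt (real M' / real (M + M'))"
proof -
  have *: "sqrt (M / (M + M')) \<le> 1" "0 \<le> sqrt (M / (M + M'))" using assms by auto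
  then have "-1 \<le> sqrt (M / (M + M'))" by linarith
  with * show s: "sin (grover_angle M M') = sqrt (M / (M + M'))"
    by (simp add: grover_angle_def)
  have "real M + real M' \<noteq> 0" using assms by linarith
  then have "1 - M / (M + M') = M' / (M + M')" by (simp add: field_simps)
  with * show "cos (grover_angle M M') = sqrt (M' / (M + M'))"
    using \<open>-1 \<le> _\<close> by (simp add: grover_angle_def cos_arcsin)
qed

lemma angle_amps_init:
  assumes "M + M' > 0"
  shows "angle_amps M M' (grover_angle M M') (1 / sqrt (M + M')) (1 / sqrt (M + M'))"
  using sin_cos_grover_angle[OF assms] by (simp add: angle_amps_def real_sqrt_divide)

text \<open>With \<open>t\<close> for the Grover angle and \<open>n = sqrt (M + M')\<close>, \<mu>
  equals \<open>cos (x + t) / n\<close>, and the addition theorems give the rotation by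
  \<open>2 * t\<close>. The new pair is that of \<open>grover_step\<close> with the sign -1 taken
  out.\<close>

lemma angle_amps_step:
  assumes "M + M' > 0" "angle_amps M M' x a b"
  defines "\<mu> \<equiv> (M' * b - M * a) / (M + M')"
  shows "angle_amps M M' (x + 2 * grover_angle M M') (a + 2 * \<mu>) (2 * \<mu> - b)"
proof -
  let ?t = "grover_angle M M'" and ?m = "sqrt M" and ?k = "sqrt M'" and ?n = "sqrt (real M + real M')"
  have n: "?n > 0" "?n * ?n = real M + real M'" using assms(1) by auto
  have mm: "?m * ?m = M" "?k * ?k = M'" by auto
  have sc: "sin ?t = ?m / ?n" "cos ?t = ?k / ?n"
    using sin_cos_grover_angle[OF assms(1)] by (simp_all add: real_sqrt_divide)
  have x: "?m * a = sin x" "?k * b = cos x" using assms(2) by (auto simp: angle_amps_def)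
  have mu: "\<mu> = (cos ?t * cos x - sin ?t * sin x) / ?n"
  proof -
    have "M' * b - M * a = ?k * (?k * b) - ?m * (?m * a)" using mm by (simp flip: mult.assoc)
    then have "\<mu> = (?k * cos x - ?m * sin x) / (?n * ?n)" unfolding \<mu>_def n x by simp
    then show ?thesis using n(1) by (simp add: sc diff_divide_distrib)
  qed
  have "?m * (a + 2 * \<mu>) = sin x + 2 * sin ?t * (cos ?t * cos x - sin ?t * sin x)"
  proof -
    have "?m * (2 * \<mu>) = 2 * (?m / ?n) * (cos ?t * cos x - sin ?t * sin x)" by (simp add: mu)
    also have "\<dots> = 2 * sin ?t * (cos ?t * cos x - sin ?t * sin x)" unfolding sc(1) ..
    finally show ?thesis using x(1) by (simp add: distrib_left)
  qed
  also have "\<dots> = sin x * (1 - 2 * (sin ?t)\<^sup>2) + cos x * (2 * sin ?t * cos ?t)"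
    by (simp add: algebra_simps power2_eq_square)
  also have "\<dots> = sin (x + 2 * ?t)"
    by (simp add: sin_add cos_double_sin sin_double)
  finally have A: "?m * (a + 2 * \<mu>) = sin (x + 2 * ?t)" .
  have "?k * (2 * \<mu> - b) = 2 * cos ?t * (cos ?t * cos x - sin ?t * sin x) - cos x"
  proof -
    have "?k * (2 * \<mu>) = 2 * (?k / ?n) * (cos ?t * cos x - sin ?t * sin x)" by (simp add: mu)
    also have "\<dots> = 2 * cos ?t * (cos ?t * cos x - sin ?t * sin x)" unfolding sc(2) ..
    finally show ?thesis using x(2) by (simp add: right_diff_distrib)
  qed
  also have "\<dots> = cos x * (2 * (cos ?t)\<^sup>2 - 1) - sin x * (2 * sin ?t * cos ?t)"
    by (simp add: algebra_simps power2_eq_square)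
  also have "\<dots> = cos (x + 2 * ?t)"
    by (simp add: cos_add cos_double_cos sin_double)
  finally show ?thesis using A by (simp add: angle_amps_def)
qed

text \<open>
  The first multiple by a power of 3 that reaches \<open>\<pi>/4\<close> is still at most \<open>3\<pi>/4\<close>.  Hence the number of
  good elements need not be known: one of the iteration counts \<open>(3\<^sup>s - 1) / 2\<close> succeeds with
  probability at least 1/2.
\<close>

lemma ex_good_power:
  assumes "M > 0"
  shows "\<exists>s. (sin (3 ^ s * grover_angle M M'))\<^sup>2 \<ge> 1 / 2 \<and> (3 ^ s)\<^sup>2 \<le> 9 * (M + M')"
proof -
  let ?t = "grover_angle M M'" and ?n = "sqrt (real M + real M')"
  have pos: "M + M' > 0" using assms by simp
  have n: "?n > 0" "?n * ?n = real M + real M'" using assms by auto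
  have range: "0 \<le> ?t" "?t \<le> pi / 2"
  proof -
    have *: "sqrt (M / (M + M')) \<le> 1" "0 \<le> sqrt (M / (M + M'))" using assms by auto
    then have "-1 \<le> sqrt (M / (M + M'))" by linarith
    with * show "?t \<le> pi / 2" unfolding grover_angle_def by (intro arcsin_ubound) auto
    show "0 \<le> ?t" using arcsin_le_arcsin[of 0 "sqrt (M / (M + M'))"] * by (simp add: grover_angle_def)
  qed
  \<comment> \<open>One good element already forces an angle of at least \<open>1 / ?n\<close>,
    which limits the power of 3 below.\<close>
  have "1 / ?n \<le> sin ?t"
    unfolding sin_cos_grover_angle[OF pos] using assms by (simp add: real_sqrt_divide divide_right_mono)
  also have "\<dots> \<le> ?t" using range(1) by (rule sin_x_le_x)
  finally have t: "1 / ?n \<le> ?t" .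
  then have t0: "0 < ?t" using n(1) by (smt (verit) divide_pos_pos)
  define P where "P = (\<lambda>s. pi / 4 \<le> 3 ^ s * ?t)"
  obtain s0 :: nat where "pi / 4 / ?t < 3 ^ s0"
    using real_arch_pow[of 3 "pi / 4 / ?t"] by auto
  then have "P s0" using t0 by (simp add: P_def field_simps)
  define s where "s = (LEAST s. P s)"
  have Ps: "P s" using \<open>P s0\<close> unfolding s_def by (rule LeastI)
  have hi: "3 ^ s * ?t \<le> 3 * pi / 4"
  proof (cases s)
    case 0
    then show ?thesis using range by simp
  next
    case (Suc s')
    then have "\<not> P s'" using not_less_Least[of s' P] by (simp add: s_def)
    then show ?thesis using Suc by (simp add: P_def mult.commute)
  qed
  let ?x = "3 ^ s * ?t"
  \<comment> \<open>\<open>2 * ?x\<close> lies between \<pi>/2 and 3\<pi>/2; the squared sine of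
    \<open>?x\<close> is \<open>(1 - cos (2 * ?x)) / 2\<close>.\<close>
  have "cos (2 * ?x) \<le> 0"
  proof -
    have "cos (2 * ?x) = - cos (2 * ?x - pi)" by (simp add: cos_diff)
    moreover have "0 \<le> cos (2 * ?x - pi)"
      using Ps hi by (intro cos_ge_zero) (auto simp: P_def)
    ultimately show ?thesis by simp
  qed
  then have A: "(sin ?x)\<^sup>2 \<ge> 1 / 2" using cos_double_sin[of ?x] by simp
  have "3 ^ s * (1 / ?n) \<le> 3 ^ s * ?t" using t by (intro mult_left_mono) auto
  also have "\<dots> \<le> 3" using hi pi_less_4 by simp
  finally have "3 ^ s \<le> 3 * ?n" using n(1) by (simp add: field_simps)
  then have "(3 ^ s) * (3 ^ s) \<le> (3 * ?n) * (3 * ?n)" by (intro mult_mono) auto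
  also have "\<dots> = 9 * (real M + real M')" using n(2) by simp
  finally have "real ((3 ^ s)\<^sup>2) \<le> real (9 * (M + M'))" by (simp add: power2_eq_square)
  then have "(3 ^ s)\<^sup>2 \<le> 9 * (M + M')" by (rule of_nat_le_iff[THEN iffD1])
  with A show ?thesis by blast
qed

section \<open>Unit vectors, measurement and collapse\<close>

definition unit_on :: "basis set \<Rightarrow> qstate \<Rightarrow> bool" where
  "unit_on S \<psi> \<longleftrightarrow> finite S \<and> (\<forall>b. b \<notin> S \<longrightarrow> \<psi> b = 0) \<and> (\<Sum>b\<in>S. (cmod (\<psi> b))\<^sup>2) = 1"

text \<open>The zero state up to a global phase: what phase the iterations and measurements leave
  behind is unknown, but harmless.\<close>

abbreviation blank :: "qstate \<Rightarrow> bool" where "blank \<equiv> unit_on {\<lambda>_. False}"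

lemma unit_on_zero_state [simp]: "blank zero_state"
  by (simp add: unit_on_def zero_state_def)

lemma unit_on_singleton:
  assumes "unit_on {c} \<psi>"
  obtains z where "cmod z = 1" "\<psi> = (\<lambda>b. if b = c then z else 0)"
proof (rule that)
  show "cmod (\<psi> c) = 1" using assms by (simp add: unit_on_def power2_eq_1_iff) (smt (verit) norm_ge_zero)
  show "\<psi> = (\<lambda>b. if b = c then \<psi> c else 0)" using assms by (auto simp: unit_on_def)
qed

text \<open>Only a set containing the support is tracked, so it may be replaced by a more convenient
  larger one.\<close>

lemma unit_on_mono:
  assumes "unit_on S \<psi>" "S \<subseteq> S'" "finite S'"
  shows "unit_on S' \<psi>"
proof -
  have "(\<Sum>b\<in>S'. (cmod (\<psi> b))\<^sup>2) = (\<Sum>b\<in>S. (cmod (\<psi> b))\<^sup>2)"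
    using assms by (intro sum.mono_neutral_right) (auto simp: unit_on_def)
  then show ?thesis using assms by (auto simp: unit_on_def)
qed

lemma unit_on_bij:
  assumes "unit_on S \<psi>" "\<And>b. g (f b) = b" "\<And>b. f (g b) = b"
  shows "unit_on (f ` S) (\<psi> \<circ> g)"
proof -
  have inj: "inj_on f S" by (metis assms(2) inj_onI)
  have "b \<in> f ` S \<longleftrightarrow> g b \<in> S" for b
    by (metis assms(2,3) image_iff)
  then show ?thesis
    using assms by (auto simp: unit_on_def sum.reindex[OF inj])
qed

lemmas unit_on_permute = unit_on_bij[where f = \<pi> and g = \<pi> for \<pi>]

lemma outcome_prob_unit_on:
  assumes "unit_on S \<psi>"
  shows "outcome_prob \<psi> q v = (\<Sum>b | b \<in> S \<and> b q = v. (cmod (\<psi> b))\<^sup>2)"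
  unfolding outcome_prob_def using assms
  by (intro sum.mono_neutral_left) (auto simp: unit_on_def)

text \<open>Transports a measurement back through a reversible computation, so that its distribution
  can be read off the original state.\<close>

lemma outcome_prob_bij:
  assumes "unit_on S \<psi>" "\<And>b. g (f b) = b" "\<And>b. f (g b) = b"
  shows "outcome_prob (\<psi> \<circ> g) q v = (\<Sum>b | b \<in> S \<and> f b q = v. (cmod (\<psi> b))\<^sup>2)"
proof -
  have inj: "inj_on f {b \<in> S. f b q = v}" by (metis assms(2) inj_onI)
  have "outcome_prob (\<psi> \<circ> g) q v = (\<Sum>b \<in> f ` {b \<in> S. f b q = v}. (cmod ((\<psi> \<circ> g) b))\<^sup>2)"
    unfolding outcome_prob_unit_on[OF unit_on_bij[OF assms]] by (rule sum.cong) auto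
  then show ?thesis by (simp add: sum.reindex[OF inj] assms(2))
qed

lemma unit_on_two_level:
  assumes "finite C" "angle_amps (card {b\<in>C. g b}) (card {b\<in>C. \<not> g b}) x a b" "cmod z = 1"
  shows "unit_on C (two_level g C (z * of_real a) (z * of_real b))"
    and "(\<Sum>c | c \<in> C \<and> g c. (cmod (two_level g C (z * of_real a) (z * of_real b) c))\<^sup>2) = (sin x)\<^sup>2"
proof -
  have sq: "real (card {b\<in>C. g b}) * a\<^sup>2 = (sin x)\<^sup>2" "real (card {b\<in>C. \<not> g b}) * b\<^sup>2 = (cos x)\<^sup>2"
    using assms(2) by (auto simp: angle_amps_def power_mult_distrib dest!: sym[of _ "sin x"] sym[of _ "cos x"])
  have "(\<Sum>c\<in>C. (cmod (two_level g C (z * of_real a) (z * of_real b) c))\<^sup>2) = 1"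
    using assms(1,3) sum_two_level[OF assms(1), of "\<lambda>y. (cmod y)\<^sup>2" g "z * of_real a" "z * of_real b"] sq
    by (simp add: norm_mult)
  then show "unit_on C (two_level g C (z * of_real a) (z * of_real b))"
    using assms(1) by (auto simp: unit_on_def two_level_def)
  have "(\<Sum>c | c \<in> C \<and> g c. (cmod (two_level g C (z * of_real a) (z * of_real b) c))\<^sup>2) =
      (\<Sum>c | c \<in> C \<and> g c. a\<^sup>2)"
    using assms(3) by (intro sum.cong) (auto simp: two_level_def norm_mult)
  then show "(\<Sum>c | c \<in> C \<and> g c. (cmod (two_level g C (z * of_real a) (z * of_real b) c))\<^sup>2) = (sin x)\<^sup>2"
    using sq by simp
qed

lemma outcome_prob_False:
  assumes "unit_on S \<psi>"
  shows "outcome_prob \<psi> q False = 1 - outcome_prob \<psi> q True"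
proof -
  have "finite S" using assms by (simp add: unit_on_def)
  then have "(\<Sum>b | b \<in> S \<and> b q. (cmod (\<psi> b))\<^sup>2) + (\<Sum>b | b \<in> S \<and> \<not> b q. (cmod (\<psi> b))\<^sup>2) =
      (\<Sum>b\<in>{b\<in>S. b q} \<union> {b\<in>S. \<not> b q}. (cmod (\<psi> b))\<^sup>2)"
    by (intro sum.union_disjoint[symmetric]) auto
  also have "{b\<in>S. b q} \<union> {b\<in>S. \<not> b q} = S" by auto
  finally show ?thesis using assms by (simp add: outcome_prob_unit_on[OF assms] unit_on_def)
qed

lemma outcome_prob_nonneg: "0 \<le> outcome_prob \<psi> q v"
  unfolding outcome_prob_def by (intro sum_nonneg) auto

lemma outcome_prob_le_1: "unit_on S \<psi> \<Longrightarrow> outcome_prob \<psi> q True \<le> 1"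
  using outcome_prob_False[of S \<psi> q] outcome_prob_nonneg[of \<psi> q False] by linarith

lemma unit_on_collapse:
  assumes "unit_on S \<psi>" "outcome_prob \<psi> q v > 0"
  shows "unit_on {b\<in>S. b q = v} (collapse \<psi> q v)"
proof -
  let ?p = "outcome_prob \<psi> q v"
  have "(\<Sum>b | b \<in> S \<and> b q = v. (cmod (collapse \<psi> q v b))\<^sup>2) = (\<Sum>b | b \<in> S \<and> b q = v. (cmod (\<psi> b))\<^sup>2 / ?p)"
    using assms(2) by (intro sum.cong) (auto simp: collapse_def norm_divide power_divide)
  also have "\<dots> = 1"
    using assms(2) by (simp add: outcome_prob_unit_on[OF assms(1)] flip: sum_divide_distrib)
  finally show ?thesis using assms(1) by (auto simp: unit_on_def collapse_def)
qed

lemma set_bernoulli: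
  assumes "0 \<le> p" "p \<le> 1" "v \<in> set_pmf (bernoulli_pmf p)"
  shows "if v then p > 0 else p < 1"
  using assms by (cases v) (auto simp: set_pmf_iff)

text \<open>An outcome of probability 0 is not in the support of the Bernoulli distribution, so
  \<open>collapse\<close> never divides by 0 where \<open>Q\<close> has to be shown.\<close>

lemma wp_measure_qubit:
  assumes "unit_on S (qst s)"
    and "\<And>v. outcome_prob (qst s) q v > 0 \<Longrightarrow> unit_on {b\<in>S. b q = v} (collapse (qst s) q v) \<Longrightarrow>
      Q (set_var x (of_bool v) (s\<lparr>qst := collapse (qst s) q v\<rparr>))"
  shows "wp (measure_qubit x q s) Q"
proof -
  let ?p = "outcome_prob (qst s) q True"
  have p: "0 \<le> ?p" "?p \<le> 1"
    using outcome_prob_nonneg outcome_prob_le_1[OF assms(1)] by auto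
  have "outcome_prob (qst s) q v > 0" if "v \<in> set_pmf (bernoulli_pmf ?p)" for v
    using set_bernoulli[OF p that] outcome_prob_False[OF assms(1), of q] by (cases v) auto
  then show ?thesis
    using assms(2) unit_on_collapse[OF assms(1)] by (auto simp: wp_def measure_qubit_def)
qed

lemma expect_measure_qubit:
  assumes "unit_on S (qst s)"
  shows "expect (measure_qubit x q s) (\<lambda>s'. if vars s' x \<noteq> 0 then 0 else 1) = 1 - outcome_prob (qst s) q True"
proof -
  let ?p = "outcome_prob (qst s) q True"
  have p: "0 \<le> ?p" "?p \<le> 1"
    using outcome_prob_nonneg outcome_prob_le_1[OF assms(1)] by auto
  show ?thesis
    using p by (simp add: measure_qubit_def expect_def o_def nn_integral_bernoulli_pmf set_var_def)
qed

section \<open>Grover search on the machine\<close>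

text \<open>
  Register 0 is the address, register 1 receives the content of the memory at this address,
  register 2 holds the fixed index of the second matrix, and bit 0 of register 3 is the flag of
  marked elements.
\<close>

abbreviation (input) v_two :: vname where "v_two \<equiv> 4"
abbreviation (input) v_three :: vname where "v_three \<equiv> 5"
abbreviation (input) v_w :: vname where "v_w \<equiv> 6"
abbreviation (input) v_len :: vname where "v_len \<equiv> 7"
abbreviation (input) v_tab :: vname where "v_tab \<equiv> 8"
abbreviation (input) v_ptab :: vname where "v_ptab \<equiv> 9"
abbreviation (input) v_reps :: vname where "v_reps \<equiv> 10"
abbreviation (input) v_rounds :: vname where "v_rounds \<equiv> 11"
abbreviation (input) v_x1 :: vname where "v_x1 \<equiv> 20"
abbreviation (input) v_x2 :: vname where "v_x2 \<equiv> 21"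
abbreviation (input) v_x3 :: vname where "v_x3 \<equiv> 22"
abbreviation (input) v_h :: vname where "v_h \<equiv> 23"
abbreviation (input) v_cand :: vname where "v_cand \<equiv> 40"
abbreviation (input) v_powcand :: vname where "v_powcand \<equiv> 41"
abbreviation (input) v_bits :: vname where "v_bits \<equiv> 42"
abbreviation (input) v_iters :: vname where "v_iters \<equiv> 43"
abbreviation (input) v_g :: vname where "v_g \<equiv> 44"
abbreviation (input) v_flag :: vname where "v_flag \<equiv> 45"
abbreviation (input) v_meas :: vname where "v_meas \<equiv> 46"
abbreviation (input) v_clean :: vname where "v_clean \<equiv> 47"
abbreviation (input) v_j :: vname where "v_j \<equiv> 48"

text \<open>Classically controlled X gates, one per binary digit; the digits are produced by
  repeated halving. A second run with the same value restores the register.\<close>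

definition xor_register :: "vname \<Rightarrow> vname \<Rightarrow> com" where
  "xor_register r v = Seq (Op v_x1 Add v v_zero)
     (For v_x2 v_w (Seq (Op v_x3 Mod v_x1 v_two)
       (Seq (If v_x3 (Gate (X_gate (r, v_x2))) Skip) (Op v_x1 Div v_x1 v_two))))"

definition hadamards :: com where
  "hadamards = For v_h v_bits (Gate (Hadamard (v_zero, v_h)))"

text \<open>The fourth power of the phase \<pi>/4 is the sign -1, so this is the Pauli Z
  gate.\<close>

definition z_gate :: "vname \<times> vname \<Rightarrow> com" where
  "z_gate q = Seq (Gate (T_gate q)) (Seq (Gate (T_gate q)) (Seq (Gate (T_gate q)) (Gate (T_gate q))))"

text \<open>
  The parameter \<open>sw\<close> exchanges the roles of the matrices: the first factor is \<open>A\<close>, or \<open>B\<^sup>T\<close> if \<open>sw\<close>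
  holds, and \<open>\<not> sw\<close> gives the transpose of the second factor.
\<close>

definition matrix_gate :: "bool \<Rightarrow> 'a \<Rightarrow> 'a \<Rightarrow> 'a \<times> 'a \<Rightarrow> 'a gate" where
  "matrix_gate sw ri rj q = (if sw then Oracle_B rj ri q else Oracle_A ri rj q)"

text \<open>Entries are accessible only through quantum oracles. Both indices are basis states here,
  so measuring the flag is deterministic; the remaining instructions uncompute flag and
  registers.\<close>

definition query :: "bool \<Rightarrow> vname \<Rightarrow> vname \<Rightarrow> vname \<Rightarrow> com" where
  "query sw x i j =
     Seq (xor_register v_zero i) (Seq (xor_register v_one j)
       (Seq (Gate (matrix_gate sw v_zero v_one (v_three, v_zero)))
         (Seq (Measure x (v_three, v_zero))
           (Seq (If x (Gate (X_gate (v_three, v_zero))) Skip)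
             (Seq (xor_register v_zero i) (xor_register v_one j))))))"

text \<open>Memory cell and matrix entry are computed into clear qubits, the flag becomes a sign,
  and both are uncomputed, since leftover values would destroy the interference.\<close>

definition phase_oracle :: "bool \<Rightarrow> com" where
  "phase_oracle sw =
     Seq (Gate (QRAM v_zero v_one)) (Seq (Gate (matrix_gate (\<not> sw) v_two v_one (v_three, v_zero)))
       (Seq (z_gate (v_three, v_zero))
         (Seq (Gate (matrix_gate (\<not> sw) v_two v_one (v_three, v_zero))) (Gate (QRAM v_zero v_one)))))"

text \<open>
  Instead of a multiply controlled gate, the reflection reads a table that marks the powers of two:
  exchanging the fixed high bits of the address makes it \<open>2\<^sup>b + x\<close> for the searched bits \<open>x\<close>, which is a
  power of two only for \<open>x = 0\<close>.
\<close>

definition zero_reflection :: com where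
  "zero_reflection =
     Seq (xor_register v_zero v_cand) (Seq (xor_register v_zero v_powcand)
       (Seq (Gate (QRAM v_zero v_one)) (Seq (z_gate (v_one, v_zero)) (Seq (Gate (QRAM v_zero v_one))
         (Seq (xor_register v_zero v_powcand) (xor_register v_zero v_cand))))))"

definition grover_iteration :: "bool \<Rightarrow> com" where
  "grover_iteration sw = Seq (phase_oracle sw) (Seq hadamards (Seq zero_reflection hadamards))"

lemma modified_xor_register [simp]: "modified (xor_register r v) = {v_cond, v_x1, v_x2, v_x3}"
  and storefree_xor_register [simp]: "storefree (xor_register r v)"
  by (auto simp: xor_register_def)

lemma modified_hadamards [simp]: "modified hadamards = {v_cond, v_h}"
  and storefree_hadamards [simp]: "storefree hadamards"
  by (auto simp: hadamards_def)

lemma modified_z_gate [simp]: "modified (z_gate q) = {}"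
  and storefree_z_gate [simp]: "storefree (z_gate q)"
  by (auto simp: z_gate_def)

lemma modified_query [simp]: "modified (query sw x i j) = {x, v_cond, v_x1, v_x2, v_x3}"
  and storefree_query [simp]: "storefree (query sw x i j)"
  by (auto simp: query_def)

lemma modified_phase_oracle [simp]: "modified (phase_oracle sw) = {}"
  and storefree_phase_oracle [simp]: "storefree (phase_oracle sw)"
  by (auto simp: phase_oracle_def)

lemma modified_zero_reflection [simp]: "modified zero_reflection = {v_cond, v_x1, v_x2, v_x3}"
  and storefree_zero_reflection [simp]: "storefree zero_reflection"
  by (auto simp: zero_reflection_def)

lemma modified_grover_iteration [simp]: "modified (grover_iteration sw) = {v_cond, v_x1, v_x2, v_x3, v_h}"
  and storefree_grover_iteration [simp]: "storefree (grover_iteration sw)"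
  by (auto simp: grover_iteration_def)

section \<open>Gate sequences as operators, for a fixed input\<close>

locale mw_input =
  fixes n :: nat and A B :: "bool mat"
  assumes n_pos: "n \<ge> 1" and A: "A \<in> carrier_mat n n" and B: "B \<in> carrier_mat n n"
begin

text \<open>
  The output lies below \<open>tab\<close>, the list of the current row at \<open>tab\<close>, and the table of the powers of two
  at \<open>ptab\<close>.
\<close>

definition len :: nat where "len = bit_length n"

text \<open>The factor 20 leaves room for addresses up to \<open>2 ^ (2 * len + 2)\<close> and for
  squares of powers of 3 up to \<open>9 ^ (len + 1)\<close>; moreover \<open>20 \<le> w\<close>
  absorbs small constants in the cost estimates.\<close>

definition w :: nat where "w = 20 * len"
definition tab :: nat where "tab = 2 ^ (2 * len)"
definition ptab :: nat where "ptab = 2 * tab"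

lemma len_pos: "len \<ge> 1"
  by (simp add: len_def bit_length_def)

lemma n_less: "n < 2 ^ len"
  using n_pos floor_log_exp2_gt[of n] by (simp add: len_def bit_length_def)

lemma w_pos: "0 < w"
  using len_pos by (simp add: w_def)

text \<open>All operands of the machine are variables, even register names and bit positions, so the
  constants have to be kept in variables throughout.\<close>

definition env :: "config \<Rightarrow> bool" where
  "env s \<longleftrightarrow> vars s v_n = n \<and> vars s v_zero = 0 \<and> vars s v_one = 1 \<and> vars s v_two = 2 \<and>
     vars s v_three = 3 \<and> vars s v_w = w \<and> vars s v_len = len \<and> vars s v_tab = tab \<and>
     vars s v_ptab = ptab \<and> vars s v_reps = 4 * len \<and> vars s v_rounds = len + 2"

lemma env_vars [simp]:
  assumes "env s"
  shows "vars s v_n = n" "vars s v_zero = 0" "vars s v_one = 1" "vars s v_two = 2"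
    "vars s v_three = 3" "vars s v_w = w" "vars s v_len = len" "vars s v_tab = tab"
    "vars s v_ptab = ptab" "vars s v_reps = 4 * len" "vars s v_rounds = len + 2"
  using assms by (simp_all add: env_def)

lemma env_update [simp]:
  "env (time_update f s) = env s" "env (qst_update g s) = env s" "env (mem_update h s) = env s" "env (tick s) = env s"
  "x \<notin> insert v_n {v_zero..v_rounds} \<Longrightarrow> env (set_var x v s) = env s"
proof -
  assume "x \<notin> insert v_n {v_zero..v_rounds}"
  then have "x \<noteq> 0" "x \<noteq> 2" "x \<noteq> 3" "x \<noteq> 4" "x \<noteq> 5" "x \<noteq> 6" "x \<noteq> 7" "x \<noteq> 8" "x \<noteq> 9" "x \<noteq> 10" "x \<noteq> 11"
    by auto
  then show "env (set_var x v s) = env s"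
    unfolding env_def by (simp add: set_var_def del: env_vars)
qed (simp_all add: env_def tick_def del: env_vars)

definition ent :: "bool \<Rightarrow> nat \<Rightarrow> nat \<Rightarrow> bool" where
  "ent sw i j = (if sw then entry B j i else entry A i j)"

definition ent_call :: "bool \<Rightarrow> nat \<Rightarrow> nat \<Rightarrow> qubit \<Rightarrow> basis \<Rightarrow> basis" where
  "ent_call sw ri rj q = (if sw then oracle_call w B rj ri q else oracle_call w A ri rj q)"

lemma ent_call_apply:
  "ent_call sw ri rj q b x \<longleftrightarrow> b x \<noteq> (x = q \<and> fst q \<notin> {ri, rj} \<and> ent sw (word_of w b ri) (word_of w b rj))"
  by (auto simp: ent_call_def oracle_call_apply ent_def)

lemma ent_call_invol [simp]: "ent_call sw ri rj q (ent_call sw ri rj q b) = b"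
  by (simp add: ent_call_def)

lemma apply_matrix_gate [simp]:
  "apply_gate w A B m (matrix_gate sw ri rj q) \<psi> = \<psi> \<circ> ent_call sw ri rj q"
  by (simp add: matrix_gate_def ent_call_def)

lemma map_matrix_gate [simp]:
  "map_gate f (matrix_gate sw ri rj q) = matrix_gate sw (f ri) (f rj) (map_prod f f q)"
  by (simp add: matrix_gate_def)

lemma
  shows w_less: "w < 2 ^ w" and n_less_w: "n < 2 ^ w" and len_less_w: "len + 2 < 2 ^ w"
    and reps_less_w: "4 * len < 2 ^ w" and two_less_w: "2 < (2::nat) ^ w" and three_less_w: "3 < (2::nat) ^ w"
proof -
  show "w < 2 ^ w" by simp
  have "len \<le> w" by (simp add: w_def)
  then have "(2::nat) ^ len \<le> 2 ^ w" by simp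
  then show "n < 2 ^ w" using n_less by linarith
  have "20 \<le> w" using len_pos by (simp add: w_def)
  then show "2 < (2::nat) ^ w" "3 < (2::nat) ^ w" using \<open>w < 2 ^ w\<close> by linarith+
  show "len + 2 < 2 ^ w" "4 * len < 2 ^ w" using \<open>w < 2 ^ w\<close> len_pos unfolding w_def by linarith+
qed

lemma take_bit_self: "x < 2 ^ w \<Longrightarrow> take_bit w x = (x::nat)"
  by (simp add: take_bit_nat_eq_self)

lemma take_bit_bool [simp]: "take_bit w (of_bool P) = (of_bool P :: nat)" "take_bit w (Suc 0) = Suc 0"
  using w_pos by (cases P; simp add: take_bit_nat_eq_self)+

lemma xor_register_wp:
  assumes "env s" "r \<notin> {v_cond, v_x1, v_x2, v_x3}" "vars s v < 2 ^ w"
  shows "wp (exec w A B (xor_register r v) s)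
    (\<lambda>s'. time s' \<le> time s + 13 * w \<and> qst s' = qst s \<circ> xor_reg w (vars s r) (vars s v))"
proof -
  let ?v = "vars s v" and ?r = "vars s r"
  let ?c = "Seq (Op v_x3 Mod v_x1 v_two) (Seq (If v_x3 (Gate (X_gate (r, v_x2))) Skip) (Op v_x1 Div v_x1 v_two))"
  define s1 where "s1 = tick (set_var v_x1 ?v s)"
  have s1: "vars s1 v_w = w" "vars s1 v_one = 1" "vars s1 v_two = 2" "vars s1 v_x1 = ?v" "vars s1 r = ?r"
      "qst s1 = qst s" "time s1 = time s + 1"
    using assms by (auto simp: s1_def tick_def set_var_def)
  have "wp (exec w A B (For v_x2 v_w ?c) s1) (\<lambda>s'. time s' \<le> time s1 + (3 + w * (4 + 3)) \<and>
      vars s' v_x1 = ?v div 2 ^ w \<and> qst s' = qst s \<circ> xor_reg w ?r ?v)"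
  proof (rule wp_For[where I = "\<lambda>k s'. vars s' v_x1 = ?v div 2 ^ k \<and> qst s' = qst s \<circ> xor_reg k ?r ?v", OF w_pos w_less])
    fix k s' assume k: "k < w" and I: "vars s' v_x1 = ?v div 2 ^ k \<and> qst s' = qst s \<circ> xor_reg k ?r ?v"
      and x2: "vars s' v_x2 = k" and fr: "frame (For v_x2 v_w ?c) s1 s'"
    have v: "vars s' v_two = 2" "vars s' r = ?r"
      using fr s1 assms(2) by (auto simp: frame_def)
    have 1: "take_bit w (?v div 2 ^ k mod 2) = ?v div 2 ^ k mod 2"
      using two_less_w by (intro take_bit_self) (meson less_trans mod_less_divisor pos2)
    have 2: "take_bit w (?v div 2 ^ k div 2) = ?v div 2 ^ Suc k"
    proof (subst take_bit_self)
      show "?v div 2 ^ k div 2 < 2 ^ w"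
        using assms(3) by (meson div_le_dividend le_less_trans)
      show "?v div 2 ^ k div 2 = ?v div 2 ^ Suc k"
        by (simp only: power_Suc2 div_mult2_eq)
    qed
    have 3: "(?v div 2 ^ k mod 2 \<noteq> 0) = bit ?v k"
      by (simp add: bit_iff_odd odd_iff_mod_2_eq_one)
    have X: "xor_reg k ?r ?v \<circ> flip_if (\<lambda>_. True) (?r, k) = xor_reg (Suc k) ?r ?v" if "bit ?v k"
      using that by (auto simp: fun_eq_iff xor_reg_apply flip_if_def less_Suc_eq)
    have Y: "xor_reg k ?r ?v = xor_reg (Suc k) ?r ?v" if "\<not> bit ?v k"
      using that by (auto simp: fun_eq_iff xor_reg_apply less_Suc_eq)
    show "wp (exec w A B ?c s') (\<lambda>s''. time s'' \<le> time s' + 4 \<and>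
        vars s'' v_x1 = ?v div 2 ^ Suc k \<and> qst s'' = qst s \<circ> xor_reg (Suc k) ?r ?v)"
      using assms(2) I v x2 1 2 3 X Y by (auto simp: tick_def set_var_def comp_assoc)
  qed (use s1 assms(2) in \<open>auto simp: same_but_def comp_def\<close>)
  then show ?thesis
    using assms s1 w_pos by (auto simp: xor_register_def take_bit_self s1_def elim!: wp_mono)
qed

lemma env_frame: "env s \<Longrightarrow> frame c s s' \<Longrightarrow> modified c \<inter> ({v_n} \<union> {v_zero..v_rounds}) = {} \<Longrightarrow> env s'"
proof -
  assume s: "env s" and f: "frame c s s'" and d: "modified c \<inter> ({v_n} \<union> {v_zero..v_rounds}) = {}"
  have "vars s' x = vars s x" if "x \<in> {v_n} \<union> {v_zero..v_rounds}" for x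
    using f d that unfolding frame_def by blast
  with s show "env s'" unfolding env_def by (simp del: env_vars)
qed

lemma env_step:
  assumes "frame c s s'" "env s" "modified c \<inter> ({v_n} \<union> {v_zero..v_rounds}) = {}"
  shows "env s'" "\<And>x. x \<notin> modified c \<Longrightarrow> vars s' x = vars s x" "storefree c \<Longrightarrow> mem s' = mem s"
  using env_frame[OF assms(2,1,3)] assms(1) by (auto simp: frame_def)

lemma hadamards_wp:
  assumes "env s" "vars s v_bits < 2 ^ w"
  shows "wp (exec w A B hadamards s)
    (\<lambda>s'. time s' \<le> time s + (3 + 4 * vars s v_bits) \<and> qst s' = hads (vars s v_bits) (qst s))"
proof -
  have *: "4 * vars s v_bits = vars s v_bits * (1 + 3)" by simp
  show ?thesis
    unfolding hadamards_def *
  proof (rule wp_For[where I = "\<lambda>k s'. qst s' = hads k (qst s)", OF w_pos assms(2)])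
    fix k s' assume "qst s' = hads k (qst s)" "vars s' v_h = k" "frame (For v_h v_bits (Gate (Hadamard (v_zero, v_h)))) s s'"
    moreover from this have "vars s' v_zero = 0"
      using assms(1) by (auto simp: frame_def)
    ultimately show "wp (exec w A B (Gate (Hadamard (v_zero, v_h))) s')
        (\<lambda>s''. time s'' \<le> time s' + 1 \<and> qst s'' = hads (Suc k) (qst s))"
      by (simp add: tick_def had_def)
  qed (use assms in \<open>auto simp: same_but_def\<close>)
qed

lemma T_gate_fourth:
  "(if P then cis (pi / 4) else 1) * ((if P then cis (pi / 4) else 1) * ((if P then cis (pi / 4) else 1) *
    ((if P then cis (pi / 4) else 1) * x))) = (if P then -1 else 1) * x"
proof -
  have "cis (pi / 4) * cis (pi / 4) = \<i>" by (simp add: cis_mult)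
  then have "cis (pi / 4) * (cis (pi / 4) * y) = \<i> * y" for y by (metis mult.assoc)
  note * = this
  show ?thesis by (cases P) (simp_all only: if_True if_False *, simp_all)
qed

text \<open>The second half undoes the first because both maps are involutions; the sign between
  them is diagonal.\<close>

lemma phase_oracle_wp:
  assumes "env s"
  shows "wp (exec w A B (phase_oracle sw) s) (\<lambda>s'. time s' \<le> time s + 8 \<and>
     qst s' = (\<lambda>b. (if ent_call (\<not> sw) 2 1 (3, 0) (qram_read w (mem s) 0 1 b) (3, 0) then -1 else 1) * qst s b))"
  using assms by (simp add: phase_oracle_def z_gate_def tick_def o_def T_gate_fourth)

text \<open>Stated for an arbitrary continuation \<open>c\<close>, so that it rewrites the middle of
  a longer sequence.\<close>

lemma read_phase_wp:
  assumes "env s"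
  shows "wp (exec w A B (Seq (Gate (QRAM v_zero v_one)) (Seq (z_gate (v_one, v_zero)) (Seq (Gate (QRAM v_zero v_one)) c))) s)
    Q \<longleftrightarrow> wp (exec w A B c (s\<lparr>qst := (\<lambda>b. (if qram_read w (mem s) 0 1 b (1, 0) then -1 else 1) * qst s b), time := time s + 6\<rparr>)) Q"
proof -
  have six: "t + 6 = Suc (Suc (Suc (Suc (Suc (Suc t)))))" for t by simp
  show ?thesis using assms by (simp add: z_gate_def tick_def o_def T_gate_fourth six del: add_numeral_special)
qed

text \<open>The two exclusive ors are undone in reverse order after the sign, so only the sign,
  evaluated at the shifted address, remains.\<close>

lemma zero_reflection_wp:
  assumes "env s" "vars s v_cand < 2 ^ w" "vars s v_powcand < 2 ^ w"
  shows "wp (exec w A B zero_reflection s) (\<lambda>s'. time s' \<le> time s + (52 * w + 6) \<and>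
     qst s' = (\<lambda>b. (if qram_read w (mem s) 0 1 (xor_reg w 0 (vars s v_powcand) (xor_reg w 0 (vars s v_cand) b)) (1, 0)
       then -1 else 1) * qst s b))"
  unfolding zero_reflection_def
  apply (rule wp_seqI[OF xor_register_wp])
     apply (use assms in simp_all)[3]
  subgoal premises p1 for s1
  proof -
    note e1 = env_step[OF p1(1) assms(1)]
    have s1: "env s1" "vars s1 v_cand = vars s v_cand" "vars s1 v_powcand = vars s v_powcand" "mem s1 = mem s"
      using e1 by simp_all
    show ?thesis
      apply (rule wp_seqI[OF xor_register_wp])
         apply (use assms s1 in simp_all)[3]
      subgoal premises p2 for s2
      proof -
        note e2 = env_step[OF p2(1) s1(1)]
        have s2: "env s2" "vars s2 v_cand = vars s v_cand" "vars s2 v_powcand = vars s v_powcand" "mem s2 = mem s"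
          using e2 s1 by simp_all
        let ?s3 = "s2\<lparr>qst := (\<lambda>b. (if qram_read w (mem s2) 0 1 b (1, 0) then -1 else 1) * qst s2 b), time := time s2 + 6\<rparr>"
        have s3: "env ?s3" using s2(1) by simp
        show ?thesis
          unfolding read_phase_wp[OF s2(1)]
          apply (rule wp_seqI[OF xor_register_wp])
             apply (use s3 s2 assms in simp_all)[3]
          subgoal premises p3 for s4
          proof -
            note e4 = env_step[OF p3(1) s3]
            have s4: "env s4" "vars s4 v_cand = vars s v_cand"
              using e4 s2 by simp_all
            show ?thesis
              apply (rule wp_lastI[OF xor_register_wp])
                 apply (use s4 assms in simp_all)[3]
              subgoal premises p4 for s5
              proof -
                have "time s5 \<le> time s + (52 * w + 6)"
                  using p1(2) p2(2) p3(2) p4(2) by simp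
                moreover have "vars s4 v_zero = 0" "vars s2 v_zero = 0" "vars s1 v_zero = 0" "vars s v_zero = 0"
                  using s4(1) s2(1) s1(1) assms(1) by (simp_all only: env_vars)
                ultimately show ?thesis
                  unfolding p4(3) p3(3) p2(3) p1(3) by (simp add: o_def s1(2-4) s2(2-4) s4(2))
              qed
              done
          qed
          done
      qed
      done
  qed
  done

end

text \<open>Alignment of \<open>v\<close> means that its low \<open>b\<close> bits are 0, so a word
  with the same high bits is \<open>v + x\<close> for its low part \<open>x\<close>. This identifies
  a range of addresses with a set of free qubits.\<close>

lemma high_bits_eqE:
  fixes v y :: nat
  assumes "\<And>t. b \<le> t \<Longrightarrow> bit y t = bit v t" "2 ^ b dvd v"
  obtains x where "x < 2 ^ b" "y = v + x" "\<And>t. t < b \<Longrightarrow> bit x t = bit y t"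
proof
  have "drop_bit b y = drop_bit b v"
    using assms(1) by (intro bit_eqI) (simp add: bit_drop_bit_eq)
  moreover have "y = 2 ^ b * drop_bit b y + take_bit b y" for y :: nat
    by (simp add: drop_bit_eq_div take_bit_eq_mod)
  moreover have "take_bit b v = 0" using assms(2) by (simp add: take_bit_eq_mod mod_eq_0_iff_dvd)
  ultimately show "y = v + take_bit b y" by (metis add_0_right)
  show "take_bit b y < 2 ^ b" by simp
  show "bit (take_bit b y) t = bit y t" if "t < b" for t using that by (simp add: bit_take_bit_iff)
qed

lemma bit_nat_less: "(x::nat) < 2 ^ k \<Longrightarrow> bit x t \<Longrightarrow> t < k"
  by (metis bit_take_bit_iff take_bit_nat_eq_self)

lemma not_bit_low:
  fixes v :: nat
  assumes "2 ^ b dvd v" "t < b"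
  shows "\<not> bit v t"
proof -
  have "take_bit b v = 0" using assms(1) by (simp add: take_bit_eq_mod mod_eq_0_iff_dvd)
  then show ?thesis using assms(2) by (metis bit_0_eq bit_take_bit_iff bot_apply bot_bool_def)
qed

section \<open>The search space of an aligned range, and one iteration on it\<close>

context mw_input
begin

definition start_basis :: "nat \<Rightarrow> nat \<Rightarrow> basis" where
  "start_basis v j = xor_reg w 0 v (xor_reg w 2 j (\<lambda>_. False))"

lemma start_basis_apply:
  "start_basis v j (r, t) \<longleftrightarrow> t < w \<and> (r = 0 \<and> bit v t \<or> r = 2 \<and> bit j t)"
  by (auto simp: start_basis_def xor_reg_apply)

text \<open>\<open>take_bit\<close> mirrors the QRAM, which delivers only \<open>w\<close> bits of a
  cell.\<close>

definition good :: "bool \<Rightarrow> (nat \<Rightarrow> nat) \<Rightarrow> nat \<Rightarrow> basis \<Rightarrow> bool" where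
  "good sw m j b \<longleftrightarrow> ent (\<not> sw) j (take_bit w (m (word_of w b 0)))"

lemma free_low_start_basisD:
  assumes "c \<in> free_low b (start_basis v j)"
  shows "r \<noteq> 0 \<or> b \<le> t \<Longrightarrow> c (r, t) \<longleftrightarrow> t < w \<and> (r = 0 \<and> bit v t \<or> r = 2 \<and> bit j t)"
  using assms by (auto simp: free_low_def start_basis_apply)

lemma word_of_free_low:
  assumes "c \<in> free_low b (start_basis v j)" "2 ^ b dvd v" "v < 2 ^ w" "b \<le> w"
  obtains x where "x < 2 ^ b" "word_of w c 0 = v + x"
proof (rule high_bits_eqE[of b "word_of w c 0" v])
  show "bit (word_of w c 0) t = bit v t" if "b \<le> t" for t
    using free_low_start_basisD[OF assms(1), of 0 t] that bit_nat_less[OF assms(3)] by auto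
qed (use assms that in auto)

lemma ex_free_low_word:
  assumes "x < 2 ^ b" "2 ^ b dvd v" "v < 2 ^ w" "b \<le> w"
  shows "\<exists>c\<in>free_low b (start_basis v j). word_of w c 0 = v + x"
proof
  let ?c = "xor_reg b 0 x (start_basis v j)"
  show "?c \<in> free_low b (start_basis v j)"
    by (auto simp: free_low_def xor_reg_apply)
  show "word_of w ?c 0 = v + x"
  proof (rule high_bits_eqE[of b "word_of w ?c 0" v])
    show "bit (word_of w ?c 0) t = bit v t" if "b \<le> t" for t
      using that bit_nat_less[OF assms(3)] by (auto simp: xor_reg_apply start_basis_apply)
    fix x' assume x': "x' < 2 ^ b" "word_of w ?c 0 = v + x'" "\<And>t. t < b \<Longrightarrow> bit x' t = bit (word_of w ?c 0) t"
    have "x' = x"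
    proof (rule bit_eqI)
      fix t
      show "bit x' t = bit x t"
      proof (cases "t < b")
        case True
        then show ?thesis
          using x'(3)[OF True] not_bit_low[OF assms(2) True] assms(4)
          by (simp add: xor_reg_apply start_basis_apply)
      next
        case False
        then show ?thesis using bit_nat_less assms(1) x'(1) by blast
      qed
    qed
    with x'(2) show ?thesis by simp
  qed (use assms in auto)
qed

text \<open>Registers 1 and 3 are clear throughout the search space, so adding the cell and the
  entry to them writes the values themselves.\<close>

lemma oracle_flag:
  assumes "c \<in> free_low b (start_basis v j)" "j < 2 ^ w"
  shows "ent_call (\<not> sw) 2 1 (3, 0) (qram_read w m 0 1 c) (3, 0) = good sw m j c"
proof -
  note c = free_low_start_basisD[OF assms(1)]
  have "word_of w (qram_read w m 0 1 c) 2 = j"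
    using c[of 2] bit_nat_less[OF assms(2)] by (intro word_of_eqI) (auto simp: qram_read_apply)
  moreover have "word_of w (qram_read w m 0 1 c) 1 = take_bit w (m (word_of w c 0))"
    using c[of 1] by (intro word_of_eqI) (auto simp: qram_read_apply bit_take_bit_iff)
  ultimately show ?thesis
    using c[of 3 0] by (simp add: ent_call_apply qram_read_apply good_def)
qed

text \<open>\<open>v\<close> and \<open>d\<close> have no low bits, so the two exclusive ors keep
  the searched bits and move the address from \<open>v + x\<close> to \<open>d + x\<close>, where
  the table is odd only for \<open>x = 0\<close>.\<close>

lemma zero_flag:
  assumes "c \<in> free_low b (start_basis v j)" "2 ^ b dvd v" "2 ^ b dvd d" "d < 2 ^ w" "b \<le> w" "v < 2 ^ w"
    and m: "\<And>x. x < 2 ^ b \<Longrightarrow> odd (m (d + x)) \<longleftrightarrow> x = 0"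
  shows "qram_read w m 0 1 (xor_reg w 0 d (xor_reg w 0 v c)) (1, 0) \<longleftrightarrow> c = start_basis v j"
proof -
  note c = free_low_start_basisD[OF assms(1)]
  let ?y = "xor_reg w 0 d (xor_reg w 0 v c)"
  obtain x where x: "x < 2 ^ b" "word_of w ?y 0 = d + x" "\<And>t. t < b \<Longrightarrow> bit x t = bit (word_of w ?y 0) t"
  proof (rule high_bits_eqE[of b "word_of w ?y 0" d])
    show "bit (word_of w ?y 0) t = bit d t" if "b \<le> t" for t
      using that c[of 0 t] bit_nat_less[OF assms(4)] by (auto simp: xor_reg_apply)
  qed (use assms(3) in auto)
  have xc: "bit x t = c (0, t)" if "t < b" for t
    using x(3)[OF that] that not_bit_low[OF assms(2) that] not_bit_low[OF assms(3) that] assms(5)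
    by (simp add: xor_reg_apply)
  have "qram_read w m 0 1 ?y (1, 0) \<longleftrightarrow> odd (m (d + x))"
    using c[of 1 0] w_pos by (simp add: qram_read_apply xor_reg_apply x(2) bit_0)
  also have "\<dots> \<longleftrightarrow> x = 0" using m x(1) by simp
  also have "\<dots> \<longleftrightarrow> (\<forall>t<b. \<not> c (0, t))"
    using xc x(1) by (auto simp: bit_eq_iff[of x 0] dest: bit_nat_less)
  also have "\<dots> \<longleftrightarrow> c = start_basis v j"
  proof
    assume z: "\<forall>t<b. \<not> c (0, t)"
    have "c (r, t) = start_basis v j (r, t)" for r t
      using c[of r t] z not_bit_low[OF assms(2), of t] by (cases "r \<noteq> 0 \<or> b \<le> t") (auto simp: start_basis_apply)
    then show "c = start_basis v j" by auto
  next
    assume "c = start_basis v j"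
    then show "\<forall>t<b. \<not> c (0, t)" using not_bit_low[OF assms(2)] by (auto simp: start_basis_apply)
  qed
  finally show ?thesis .
qed

text \<open>The precondition shared by all search programs. Its last clause says that the power
  table is in place for the current range size.\<close>

definition search_ready :: "config \<Rightarrow> bool" where
  "search_ready s \<longleftrightarrow> env s \<and> vars s v_bits \<le> len \<and> 2 ^ vars s v_bits dvd vars s v_cand \<and>
     vars s v_cand < 2 ^ w \<and> vars s v_powcand = ptab + 2 ^ vars s v_bits \<and> vars s v_j < 2 ^ w \<and>
     (\<forall>x<2 ^ vars s v_bits. odd (mem s (vars s v_powcand + x)) \<longleftrightarrow> x = 0)"

definition space_of :: "config \<Rightarrow> basis set" where
  "space_of s = free_low (vars s v_bits) (start_basis (vars s v_cand) (vars s v_j))"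

definition goods_of :: "bool \<Rightarrow> config \<Rightarrow> nat" where
  "goods_of sw s = card {b\<in>space_of s. good sw (mem s) (vars s v_j) b}"

definition bads_of :: "bool \<Rightarrow> config \<Rightarrow> nat" where
  "bads_of sw s = card {b\<in>space_of s. \<not> good sw (mem s) (vars s v_j) b}"

lemma ptab_eq: "ptab = 2 ^ (2 * len + 1)"
  by (simp add: ptab_def tab_def)

lemma pow_bounds:
  assumes "b \<le> len"
  shows "2 ^ b dvd ptab + 2 ^ b" "ptab + 2 ^ b < 2 ^ w" "b \<le> w"
proof -
  show "2 ^ b dvd ptab + 2 ^ b"
    using assms by (simp add: ptab_eq le_imp_power_dvd)
  have "(2::nat) ^ b \<le> 2 ^ (2 * len + 1)" using assms by (intro power_increasing) auto
  then have "ptab + 2 ^ b \<le> 2 ^ (2 * len + 2)" by (simp add: ptab_eq)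
  also have "(2::nat) ^ (2 * len + 2) < 2 ^ w" using len_pos by (intro power_strict_increasing) (auto simp: w_def)
  finally show "ptab + 2 ^ b < 2 ^ w" .
  show "b \<le> w" using assms by (simp add: w_def)
qed

lemma start_basis_low:
  "2 ^ b dvd v \<Longrightarrow> \<forall>u<b. \<not> start_basis v j (0, u)"
  using not_bit_low by (auto simp: start_basis_apply)

lemma grover_iteration_wp:
  fixes \<alpha> \<beta> :: complex
  assumes r: "search_ready s"
    and q: "qst s = two_level (good sw (mem s) (vars s v_j)) (space_of s) \<alpha> \<beta>"
  defines "\<mu> \<equiv> (of_nat (bads_of sw s) * \<beta> - of_nat (goods_of sw s) * \<alpha>) / 2 ^ vars s v_bits"
  shows "wp (exec w A B (grover_iteration sw) s) (\<lambda>s'. time s' \<le> time s + 80 * w \<and>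
     qst s' = two_level (good sw (mem s) (vars s v_j)) (space_of s) (- (\<alpha> + 2 * \<mu>)) (\<beta> - 2 * \<mu>))"
proof -
  let ?b = "vars s v_bits" and ?v = "vars s v_cand" and ?j = "vars s v_j" and ?d = "vars s v_powcand"
  let ?g = "good sw (mem s) ?j" and ?C = "space_of s"
  have env: "env s" and b: "?b \<le> len" and v: "2 ^ ?b dvd ?v" "?v < 2 ^ w" and j: "?j < 2 ^ w"
    and d: "?d = ptab + 2 ^ ?b" and m: "\<And>x. x < 2 ^ ?b \<Longrightarrow> odd (mem s (?d + x)) \<longleftrightarrow> x = 0"
    using r by (auto simp: search_ready_def)
  note pb = pow_bounds[OF b]
  have d': "2 ^ ?b dvd ?d" "?d < 2 ^ w" using pb by (auto simp: d)
  define \<psi>1 where "\<psi>1 = (\<lambda>b. (if ?g b then -1 else 1) * two_level ?g ?C \<alpha> \<beta> b)"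
  have supp: "\<psi>1 b = 0" if "b \<notin> ?C" for b using that by (simp add: \<psi>1_def two_level_def)
  \<comment> \<open>The circuit is known to flag correctly only on the search space; elsewhere both
    sides are 0 because the amplitude is.\<close>
  have o1: "(\<lambda>b. (if ent_call (\<not> sw) 2 1 (3, 0) (qram_read w (mem s) 0 1 b) (3, 0) then -1 else 1) * qst s b) = \<psi>1"
  proof
    fix b
    show "(if ent_call (\<not> sw) 2 1 (3, 0) (qram_read w (mem s) 0 1 b) (3, 0) then -1 else 1) * qst s b = \<psi>1 b"
    proof (cases "b \<in> ?C")
      case True
      then show ?thesis using oracle_flag[of b ?b ?v ?j] j by (simp add: space_of_def q \<psi>1_def)
    next
      case False
      then show ?thesis by (simp add: q \<psi>1_def two_level_def)
    qed
  qed
  \<comment> \<open>The same argument once more; here it rests on the Hadamards keeping the state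
    inside the search space.\<close>
  have o2: "(\<lambda>b. (if qram_read w (mem s) 0 1 (xor_reg w 0 ?d (xor_reg w 0 ?v b)) (1, 0) then -1 else 1) * hads ?b \<psi>1 b) =
      (\<lambda>b. (if b = start_basis ?v ?j then -1 else 1) * hads ?b \<psi>1 b)"
  proof
    fix b
    show "(if qram_read w (mem s) 0 1 (xor_reg w 0 ?d (xor_reg w 0 ?v b)) (1, 0) then -1 else 1) * hads ?b \<psi>1 b =
        (if b = start_basis ?v ?j then -1 else 1) * hads ?b \<psi>1 b"
    proof (cases "b \<in> ?C")
      case True
      then show ?thesis
        using zero_flag[of b ?b ?v ?j ?d "mem s", OF _ v(1) d' pb(3) v(2) m] by (simp add: space_of_def)
    next
      case False
      then have "hads ?b \<psi>1 b = 0" using hads_support[of ?b "start_basis ?v ?j" \<psi>1 ?b b] supp by (simp add: space_of_def)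
      then show ?thesis by simp
    qed
  qed
  have fin: "hads ?b (\<lambda>b. (if b = start_basis ?v ?j then -1 else 1) * hads ?b \<psi>1 b) =
      two_level ?g ?C (- (\<alpha> + 2 * \<mu>)) (\<beta> - 2 * \<mu>)"
    unfolding \<psi>1_def space_of_def \<mu>_def
    by (rule grover_step[OF start_basis_low[OF v(1)]]) (simp_all add: goods_of_def bads_of_def space_of_def)
  have bw: "?b < 2 ^ w" using pb(3) w_less by linarith
  show ?thesis
    unfolding grover_iteration_def
    apply (rule wp_seqI[OF phase_oracle_wp[OF env]])
    subgoal premises p1 for s1
    proof -
      note e1 = env_step[OF p1(1) env]
      have s1: "env s1" "vars s1 = vars s" "mem s1 = mem s" "qst s1 = \<psi>1"
        using e1 p1(3) unfolding o1 by auto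
      show ?thesis
        apply (rule wp_seqI[OF hadamards_wp[OF s1(1)]])
         apply (use bw s1 in simp)
        subgoal premises p2 for s2
        proof -
          note e2 = env_step[OF p2(1) s1(1)]
          have s2: "env s2" "vars s2 v_cand = ?v" "vars s2 v_powcand = ?d" "vars s2 v_bits = ?b" "mem s2 = mem s"
              "qst s2 = hads ?b \<psi>1"
            using e2 s1 p2(3) by simp_all
          show ?thesis
            apply (rule wp_seqI[OF zero_reflection_wp[OF s2(1)]])
              apply (use v d' s2 in simp_all)[2]
            subgoal premises p3 for s3
            proof -
              note e3 = env_step[OF p3(1) s2(1)]
              have s3: "env s3" "vars s3 v_bits = ?b" using e3 s2 by simp_all
              have q3: "qst s3 = (\<lambda>b. (if b = start_basis ?v ?j then -1 else 1) * hads ?b \<psi>1 b)"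
                using p3(3) unfolding s2 o2 .
              show ?thesis
                apply (rule wp_lastI[OF hadamards_wp[OF s3(1)]])
                 apply (use bw s3 in simp)
                using p1(2) p2(2) p3(2) b len_pos by (simp add: s1 s3 q3 fin) (simp add: w_def)
            qed
            done
        qed
        done
    qed
    done
qed

end

section \<open>One complete Grover search, from the clear memory back to it\<close>

definition prepare :: "bool \<Rightarrow> com" where
  "prepare sw =
     Seq (xor_register v_zero v_cand) (Seq (xor_register v_two v_j)
       (Seq hadamards (Seq (For v_g v_iters (grover_iteration sw))
         (Seq (Gate (QRAM v_zero v_one)) (Gate (matrix_gate (\<not> sw) v_two v_one (v_three, v_zero)))))))"

text \<open>
  The only outcome used is that of the flag; the searched bits are measured afterwards merely in
  order to reset them.
\<close>

definition clean_up :: com where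
  "clean_up =
     Seq (If v_flag (Gate (X_gate (v_three, v_zero))) Skip)
       (Seq (Gate (QRAM v_zero v_one)) (Seq (xor_register v_zero v_cand) (Seq (xor_register v_two v_j)
         (For v_clean v_bits (Seq (Measure v_meas (v_zero, v_clean))
           (If v_meas (Gate (X_gate (v_zero, v_clean))) Skip))))))"

definition grover_search :: "bool \<Rightarrow> com" where
  "grover_search sw = Seq (prepare sw) (Seq (Measure v_flag (v_three, v_zero)) clean_up)"

lemma modified_prepare [simp]: "modified (prepare sw) = {v_cond, v_x1, v_x2, v_x3, v_h, v_g}"
  and storefree_prepare [simp]: "storefree (prepare sw)"
  by (auto simp: prepare_def)

lemma modified_clean_up [simp]: "modified clean_up = {v_cond, v_x1, v_x2, v_x3, v_meas, v_clean}"
  and storefree_clean_up [simp]: "storefree clean_up"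
  by (auto simp: clean_up_def)

lemma modified_grover_search [simp]:
    "modified (grover_search sw) = {v_cond, v_x1, v_x2, v_x3, v_h, v_g, v_flag, v_meas, v_clean}"
  and storefree_grover_search [simp]: "storefree (grover_search sw)"
  by (auto simp: grover_search_def prepare_def)

context mw_input
begin

text \<open>The search depends only on a few variables and the memory, so the bookkeeping of loops
  and gates does not disturb it.\<close>

lemma search_ready_step:
  assumes "search_ready s" "env s'" "vars s' v_bits = vars s v_bits" "vars s' v_cand = vars s v_cand"
    "vars s' v_powcand = vars s v_powcand" "vars s' v_j = vars s v_j" "mem s' = mem s"
  shows "search_ready s'" "space_of s' = space_of s" "goods_of sw s' = goods_of sw s" "bads_of sw s' = bads_of sw s"
proof -
  show sp: "space_of s' = space_of s" using assms by (simp add: space_of_def)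
  show "goods_of sw s' = goods_of sw s" "bads_of sw s' = bads_of sw s"
    using assms sp by (simp_all add: goods_of_def bads_of_def)
  show "search_ready s'" using assms unfolding search_ready_def by metis
qed

lemma goods_bads: "goods_of sw s + bads_of sw s = 2 ^ vars s v_bits"
proof -
  let ?C = "space_of s" and ?g = "good sw (mem s) (vars s v_j)"
  have "goods_of sw s + bads_of sw s = card ({b\<in>?C. ?g b} \<union> {b\<in>?C. \<not> ?g b})"
    unfolding goods_of_def bads_of_def
    by (rule card_Un_disjoint[symmetric]) (auto simp: space_of_def)
  also have "{b\<in>?C. ?g b} \<union> {b\<in>?C. \<not> ?g b} = ?C" by auto
  finally show ?thesis by (simp add: space_of_def)
qed

abbreviation "angle_of sw s \<equiv> grover_angle (goods_of sw s) (bads_of sw s)"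

text \<open>After \<open>k\<close> iterations the angle is \<open>2 * k + 1\<close> times the
  initial one; \<open>z\<close> collects the sign -1 of each iteration and the unknown phase of the
  initial state.\<close>

definition grover_state :: "bool \<Rightarrow> config \<Rightarrow> nat \<Rightarrow> qstate \<Rightarrow> bool" where
  "grover_state sw s k \<psi> \<longleftrightarrow> (\<exists>z a b. cmod z = 1 \<and>
     angle_amps (goods_of sw s) (bads_of sw s) ((2 * real k + 1) * angle_of sw s) a b \<and>
     \<psi> = two_level (good sw (mem s) (vars s v_j)) (space_of s) (z * of_real a) (z * of_real b))"

text \<open>Equal amplitudes on the whole search space correspond to the angle
  \<open>angle_of\<close> itself, whose squared sine is the share of good elements.\<close>

lemma grover_state_init:
  assumes "cmod z = 1"
  shows "grover_state sw s 0 (two_level (good sw (mem s) (vars s v_j)) (space_of s)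
    (z / complex_of_real (sqrt 2) ^ vars s v_bits) (z / complex_of_real (sqrt 2) ^ vars s v_bits))"
proof -
  have pos: "goods_of sw s + bads_of sw s > 0" by (simp add: goods_bads)
  have "real (goods_of sw s) + real (bads_of sw s) = 2 ^ vars s v_bits"
    using arg_cong[OF goods_bads[of sw s], of real] by simp
  then have "z / complex_of_real (sqrt 2) ^ vars s v_bits =
      z * of_real (1 / sqrt (real (goods_of sw s + bads_of sw s)))"
    by (simp add: real_sqrt_power flip: of_real_power)
  then show ?thesis
    unfolding grover_state_def using angle_amps_init[OF pos] assms by (intro exI[of _ z]) force
qed

lemma grover_state_step:
  fixes \<alpha> \<beta> :: complex
  assumes r: "search_ready s'" and st: "grover_state sw s k (qst s')"
    and same: "vars s' v_bits = vars s v_bits" "mem s' = mem s" "vars s' v_j = vars s v_j" "space_of s' = space_of s"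
       "goods_of sw s' = goods_of sw s" "bads_of sw s' = bads_of sw s"
  shows "wp (exec w A B (grover_iteration sw) s') (\<lambda>s''. time s'' \<le> time s' + 80 * w \<and> grover_state sw s (Suc k) (qst s''))"
proof -
  let ?M = "goods_of sw s" and ?M' = "bads_of sw s"
  obtain z a b where z: "cmod z = 1"
    and amps: "angle_amps ?M ?M' ((2 * real k + 1) * angle_of sw s) a b"
    and q: "qst s' = two_level (good sw (mem s) (vars s v_j)) (space_of s) (z * of_real a) (z * of_real b)"
    using st unfolding grover_state_def by blast
  define \<mu> where "\<mu> = (real ?M' * b - real ?M * a) / (real ?M + real ?M')"
  have pos: "?M + ?M' > 0" by (simp add: goods_bads)
  have N: "real ?M + real ?M' = 2 ^ vars s v_bits"
    using arg_cong[OF goods_bads[of sw s], of real] by simp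
  have N': "(2 ^ vars s v_bits :: complex) = of_real (2 ^ vars s v_bits)" by simp
  have m: "(of_nat ?M' * (z * of_real b) - of_nat ?M * (z * of_real a)) / (2 ^ vars s v_bits :: complex) = z * of_real \<mu>"
    unfolding \<mu>_def N N' by (simp add: algebra_simps diff_divide_distrib)
  have "angle_amps ?M ?M' ((2 * real k + 1) * angle_of sw s + 2 * angle_of sw s) (a + 2 * \<mu>) (2 * \<mu> - b)"
    using angle_amps_step[OF pos amps] unfolding \<mu>_def of_nat_add .
  moreover have "(2 * real k + 1) * angle_of sw s + 2 * angle_of sw s = (2 * real (Suc k) + 1) * angle_of sw s"
    by (simp add: algebra_simps)
  ultimately have amps': "angle_amps ?M ?M' ((2 * real (Suc k) + 1) * angle_of sw s) (a + 2 * \<mu>) (2 * \<mu> - b)"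
    by (simp only:)
  \<comment> \<open>The global sign of the iteration is moved into the phase.\<close>
  have e: "- (z * of_real a + 2 * (z * of_real \<mu>)) = - z * of_real (a + 2 * \<mu>)"
      "z * of_real b - 2 * (z * of_real \<mu>) = - z * of_real (2 * \<mu> - b)"
    by (simp_all add: algebra_simps)
  have "wp (exec w A B (grover_iteration sw) s') (\<lambda>s''. time s'' \<le> time s' + 80 * w \<and>
      qst s'' = two_level (good sw (mem s) (vars s v_j)) (space_of s) (- z * of_real (a + 2 * \<mu>)) (- z * of_real (2 * \<mu> - b)))"
    using grover_iteration_wp[OF r, of sw "z * of_real a" "z * of_real b"] q unfolding same m e by simp
  then show ?thesis
  proof (rule wp_mono)
    fix s'' assume "time s'' \<le> time s' + 80 * w \<and>
      qst s'' = two_level (good sw (mem s) (vars s v_j)) (space_of s) (- z * of_real (a + 2 * \<mu>)) (- z * of_real (2 * \<mu> - b))"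
    moreover have "cmod (- z) = 1" using z by simp
    ultimately show "time s'' \<le> time s' + 80 * w \<and> grover_state sw s (Suc k) (qst s'')"
      unfolding grover_state_def using amps' by blast
  qed
qed

text \<open>Cell and flag are computed once more and left in place, entangled with the address, as
  the flag is about to be measured. Gates act by precomposition, hence the order of the
  factors.\<close>

lemma prepare_wp:
  assumes r: "search_ready s" and q: "blank (qst s)" and it: "vars s v_iters < 2 ^ w"
  shows "wp (exec w A B (prepare sw) s) (\<lambda>s'. time s' \<le> time s + 40 * w + 83 * w * vars s v_iters \<and>
    (\<exists>\<psi>. grover_state sw s (vars s v_iters) \<psi> \<and> qst s' = \<psi> \<circ> qram_read w (mem s) 0 1 \<circ> ent_call (\<not> sw) 2 1 (3, 0)))"
proof -
  let ?b = "vars s v_bits" and ?v = "vars s v_cand" and ?j = "vars s v_j" and ?r = "vars s v_iters"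
  let ?g = "good sw (mem s) ?j"
  have env: "env s" and b: "?b \<le> len" and v: "2 ^ ?b dvd ?v" "?v < 2 ^ w" and j: "?j < 2 ^ w"
    using r by (auto simp: search_ready_def)
  have bw: "?b \<le> w" using b by (simp add: w_def)
  then have bw2: "?b < 2 ^ w" using w_less by (rule le_less_trans)
  obtain z where z: "cmod z = 1" "qst s = (\<lambda>b. if b = (\<lambda>_. False) then z else 0)"
    by (rule unit_on_singleton[OF q])
  have ket: "qst s \<circ> xor_reg w 0 ?v \<circ> xor_reg w 2 ?j = (\<lambda>b. if b = start_basis ?v ?j then z else 0)"
  proof -
    have "xor_reg w 0 ?v (xor_reg w 2 ?j b) = (\<lambda>_. False) \<longleftrightarrow> b = start_basis ?v ?j" for b
    proof
      assume "xor_reg w 0 ?v (xor_reg w 2 ?j b) = (\<lambda>_. False)"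
      then have "xor_reg w 2 ?j (xor_reg w 0 ?v (xor_reg w 0 ?v (xor_reg w 2 ?j b))) =
          xor_reg w 2 ?j (xor_reg w 0 ?v (\<lambda>_. False))" by (rule arg_cong)
      then show "b = start_basis ?v ?j"
        unfolding start_basis_def xor_reg_invol xor_reg_commute[of w 2] .
    next
      assume "b = start_basis ?v ?j"
      then show "xor_reg w 0 ?v (xor_reg w 2 ?j b) = (\<lambda>_. False)"
        by (simp add: start_basis_def xor_reg_commute[of w 2 _ w 0])
    qed
    then show ?thesis unfolding z(2) o_def by (simp only:)
  qed
  have st0: "grover_state sw s 0 (hads ?b (\<lambda>b. if b = start_basis ?v ?j then z else 0))"
    using grover_state_init[OF z(1), of sw s]
    by (simp add: hads_ket[OF start_basis_low[OF v(1)]] two_level_def space_of_def cong: if_cong)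
  show ?thesis
    unfolding prepare_def
    apply (rule wp_seqI[OF xor_register_wp[OF env]])
      apply (use v in simp_all)[2]
    subgoal premises p1 for s1
    proof -
      note e1 = env_step[OF p1(1) env]
      have s1: "env s1" "vars s1 v_bits = ?b" "vars s1 v_j = ?j" "vars s1 v_cand = ?v" "vars s1 v_powcand = vars s v_powcand"
          "vars s1 v_iters = ?r" "mem s1 = mem s"
        using e1 by simp_all
      show ?thesis
        apply (rule wp_seqI[OF xor_register_wp[OF s1(1)]])
          apply (use j s1 in simp_all)[2]
        subgoal premises p2 for s2
        proof -
          note e2 = env_step[OF p2(1) s1(1)]
          have s2: "env s2" "vars s2 v_bits = ?b" "vars s2 v_j = ?j" "vars s2 v_cand = ?v" "vars s2 v_powcand = vars s v_powcand"
              "vars s2 v_iters = ?r" "mem s2 = mem s"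
            using e2 s1 by simp_all
          have q2: "qst s2 = (\<lambda>b. if b = start_basis ?v ?j then z else 0)"
            using p2(3) p1(3) env s1(1,3) ket by (simp only: env_vars)
          show ?thesis
            apply (rule wp_seqI[OF hadamards_wp[OF s2(1)]])
             apply (use bw2 s2 in simp)
            subgoal premises p3 for s3
            proof -
              note e3 = env_step[OF p3(1) s2(1)]
              have s3: "env s3" "vars s3 v_bits = ?b" "vars s3 v_j = ?j" "vars s3 v_cand = ?v" "vars s3 v_powcand = vars s v_powcand"
                  "vars s3 v_iters = ?r" "mem s3 = mem s"
                using e3 s2 by simp_all
              have q3: "grover_state sw s 0 (qst s3)"
                using p3(3) st0 unfolding q2 s2(2) by simp
              have loop: "wp (exec w A B (For v_g v_iters (grover_iteration sw)) s3)
                (\<lambda>s'. time s' \<le> time s3 + (3 + ?r * (80 * w + 3)) \<and> grover_state sw s ?r (qst s'))"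
              proof (rule wp_For[where I = "\<lambda>k s'. grover_state sw s k (qst s')", OF w_pos it])
                fix k s' assume k: "k < ?r" and st: "grover_state sw s k (qst s')"
                  and f: "frame (For v_g v_iters (grover_iteration sw)) s3 s'"
                have s': "env s'" "vars s' v_bits = ?b" "vars s' v_j = ?j" "vars s' v_cand = ?v" "vars s' v_powcand = vars s v_powcand"
                  "mem s' = mem s"
                  using env_step[OF f s3(1)] s3 by simp_all
                note rs = search_ready_step[OF r s'(1,2,4,5,3,6)]
                show "wp (exec w A B (grover_iteration sw) s') (\<lambda>s''. time s'' \<le> time s' + 80 * w \<and> grover_state sw s (Suc k) (qst s''))"
                  by (rule grover_state_step[OF rs(1) st s'(2,6,3) rs(2,3,4)])
              qed (use s3 q3 in \<open>auto simp: same_but_def\<close>)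
              show ?thesis
                apply (rule wp_seqI[OF loop])
                subgoal premises p4 for s4
                proof -
                  have s4: "env s4" "mem s4 = mem s"
                    using env_step[OF p4(1) s3(1)] s3 by simp_all
                  have t: "time s4 + 2 \<le> time s + 40 * w + 83 * w * ?r"
                  proof -
                    have "time s4 + 2 \<le> time s + 26 * w + 4 * ?b + 8 + ?r * (80 * w + 3)"
                      using p1(2) p2(2) p3(2) p4(2) s2(2) by simp
                    also have "\<dots> \<le> time s + 26 * w + 4 * w + 8 * w + ?r * (80 * w + 3 * w)"
                      using bw w_pos by (intro add_mono mult_left_mono) auto
                    also have "\<dots> \<le> time s + 40 * w + 83 * w * ?r" by (simp add: algebra_simps)
                    finally show ?thesis .
                  qed
                  have q4: "grover_state sw s ?r (qst s4)" using p4(3) .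
                  show ?thesis
                    using s4 t q4 by (auto simp: tick_def)
                qed
                done
            qed
            done
        qed
        done
    qed
    done
qed

text \<open>After \<open>k\<close> rounds the support lies in \<open>?D k\<close>, where the first
  \<open>k\<close> searched bits are 0. Whatever the outcomes, only the all-zero basis state is left
  in the end.\<close>

lemma reset_low_wp:
  assumes env: "env s" and bw: "vars s v_bits \<le> w"
    and q: "unit_on (free_low (vars s v_bits) (\<lambda>_. False)) (qst s)"
  shows "wp (exec w A B (For v_clean v_bits (Seq (Measure v_meas (v_zero, v_clean))
      (If v_meas (Gate (X_gate (v_zero, v_clean))) Skip))) s)
    (\<lambda>s'. time s' \<le> time s + (3 + vars s v_bits * (3 + 3)) \<and> blank (qst s'))"
proof -
  let ?b = "vars s v_bits"
  let ?c = "Seq (Measure v_meas (v_zero, v_clean)) (If v_meas (Gate (X_gate (v_zero, v_clean))) Skip)"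
  let ?D = "\<lambda>k. {b \<in> free_low ?b (\<lambda>_. False). \<forall>u<k. \<not> b (0, u)}"
  have "?b < 2 ^ w" using bw w_less by (rule le_less_trans)
  have "wp (exec w A B (For v_clean v_bits ?c) s)
      (\<lambda>s'. time s' \<le> time s + (3 + ?b * (3 + 3)) \<and> unit_on (?D ?b) (qst s'))"
  proof (rule wp_For[where I = "\<lambda>k s'. unit_on (?D k) (qst s')", OF w_pos \<open>?b < 2 ^ w\<close>])
    fix k s' assume k: "k < ?b" and u: "unit_on (?D k) (qst s')" and i: "vars s' v_clean = k"
      and f: "frame (For v_clean v_bits ?c) s s'"
    have "vars s' v_zero = 0" using env_step(1)[OF f env] by simp
    then have m: "exec w A B (Measure v_meas (v_zero, v_clean)) s' = measure_qubit v_meas (0, k) (tick s')"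
      using i by (simp add: tick_def)
    show "wp (exec w A B ?c s') (\<lambda>s''. time s'' \<le> time s' + 3 \<and> unit_on (?D (Suc k)) (qst s''))"
      unfolding exec.simps(8) wp_bind m
    proof (rule wp_measure_qubit)
      show "unit_on (?D k) (qst (tick s'))" using u by (simp add: tick_def)
      fix v
      let ?\<psi> = "collapse (qst (tick s')) (0, k) v"
      let ?s = "set_var v_meas (of_bool v) (tick s'\<lparr>qst := ?\<psi>\<rparr>)"
      assume un: "unit_on {b \<in> ?D k. b (0, k) = v} ?\<psi>"
      have "unit_on (?D (Suc k)) (if v then ?\<psi> \<circ> flip_if (\<lambda>_. True) (0, k) else ?\<psi>)"
      proof (cases v)
        case True
        have "unit_on (flip_if (\<lambda>_. True) (0, k) ` {b \<in> ?D k. b (0, k) = v}) (?\<psi> \<circ> flip_if (\<lambda>_. True) (0, k))"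
          using un by (rule unit_on_permute) simp_all
        moreover have "flip_if (\<lambda>_. True) (0, k) ` {b \<in> ?D k. b (0, k) = v} \<subseteq> ?D (Suc k)"
          using True k by (auto simp: flip_if_def free_low_def less_Suc_eq)
        ultimately show ?thesis using True by (auto intro: unit_on_mono)
      next
        case False
        have "{b \<in> ?D k. b (0, k) = v} \<subseteq> ?D (Suc k)"
          using False by (auto simp: less_Suc_eq)
        then show ?thesis using False un by (auto intro: unit_on_mono)
      qed
      moreover have "vars ?s v_zero = 0" "vars ?s v_clean = k" "vars ?s v_meas = of_bool v" "qst ?s = ?\<psi>" "time ?s = time s' + 1"
        using \<open>vars s' v_zero = 0\<close> i by (simp_all add: set_var_def tick_def)
      ultimately show "wp (exec w A B (If v_meas (Gate (X_gate (v_zero, v_clean))) Skip) ?s)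
          (\<lambda>s''. time s'' \<le> time s' + 3 \<and> unit_on (?D (Suc k)) (qst s''))"
        by (cases v) (simp_all add: tick_def del: set_var_def)
    qed
  qed (use env q in \<open>auto simp: same_but_def\<close>)
  moreover have "?D ?b = {\<lambda>_. False}"
  proof -
    have "b = (\<lambda>_. False)" if "b \<in> ?D ?b" for b
    proof
      fix x :: qubit
      show "b x = False" using that by (cases x, cases "fst x = 0 \<and> snd x < ?b") (auto simp: free_low_def)
    qed
    then show ?thesis by (auto simp: free_low_def)
  qed
  ultimately show ?thesis by simp
qed

text \<open>Amplitudes no longer matter after the measurement: it is enough to follow a finite set
  that contains the support, and on this set the flag has the known value \<open>v\<close>.\<close>

lemma clean_up_wp:
  assumes r: "search_ready s" and v: "vars s v_flag = of_bool v"
    and q: "unit_on {b \<in> ent_call (\<not> sw) 2 1 (3, 0) ` qram_read w (mem s) 0 1 ` space_of s. b (3, 0) = v} (qst s)"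
  shows "wp (exec w A B clean_up s) (\<lambda>s'. time s' \<le> time s + 40 * w \<and> blank (qst s'))"
proof -
  let ?b = "vars s v_bits" and ?v = "vars s v_cand" and ?j = "vars s v_j"
  let ?Q = "qram_read w (mem s) 0 1" and ?E = "ent_call (\<not> sw) 2 1 (3, 0)"
  have env: "env s" and b: "?b \<le> len" and v': "?v < 2 ^ w" and j: "?j < 2 ^ w"
    using r by (auto simp: search_ready_def)
  have bw: "?b \<le> w" using b by (simp add: w_def)
  define \<psi>1 where "\<psi>1 = (if v then qst s \<circ> flip_if (\<lambda>_. True) (3, 0) else qst s)"
  \<comment> \<open>The flag was clear before the oracle call, which changes nothing else; so an X
    gate after outcome 1, and nothing after outcome 0, undoes the call.\<close>
  have sub: "(if v then flip_if (\<lambda>_. True) (3, 0) else id) ` {b \<in> ?E ` ?Q ` space_of s. b (3, 0) = v} \<subseteq> ?Q ` space_of s"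
  proof -
    have "(if v then flip_if (\<lambda>_. True) (3, 0) else id) (?E (?Q c)) = ?Q c"
      if "c \<in> space_of s" "?E (?Q c) (3, 0) = v" for c
    proof -
      have c: "\<not> ?Q c (3, 0)"
        using free_low_start_basisD[of c _ _ _ 3 0] that(1) by (auto simp: space_of_def qram_read_apply)
      show ?thesis
        using that(2) c by (cases v) (auto simp: fun_eq_iff flip_if_def ent_call_apply)
    qed
    then show ?thesis by (clarsimp simp del: id_apply split del: if_split)
  qed
  have fin: "finite (space_of s)" by (simp add: space_of_def)
  have "unit_on ((if v then flip_if (\<lambda>_. True) (3, 0) else id) ` {b \<in> ?E ` ?Q ` space_of s. b (3, 0) = v}) \<psi>1"
  proof (cases v)
    case True
    then show ?thesis using unit_on_permute[OF q, of "flip_if (\<lambda>_. True) (3, 0)"] by (simp add: \<psi>1_def)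
  qed (use q in \<open>simp add: \<psi>1_def\<close>)
  then have u1: "unit_on (?Q ` space_of s) \<psi>1"
    by (rule unit_on_mono[OF _ sub]) (simp add: fin)
  have u2: "unit_on (space_of s) (\<psi>1 \<circ> ?Q)"
    using unit_on_permute[OF u1, of ?Q] by (simp add: image_image)
  have "unit_on (xor_reg w 2 ?j ` xor_reg w 0 ?v ` space_of s) (\<psi>1 \<circ> ?Q \<circ> xor_reg w 0 ?v \<circ> xor_reg w 2 ?j)"
    by (intro unit_on_permute u2) simp_all
  moreover have "xor_reg w 2 ?j ` xor_reg w 0 ?v ` space_of s \<subseteq> free_low ?b (\<lambda>_. False)"
    by (auto simp: space_of_def free_low_def xor_reg_apply start_basis_apply)
  ultimately have u3: "unit_on (free_low ?b (\<lambda>_. False)) (\<psi>1 \<circ> ?Q \<circ> xor_reg w 0 ?v \<circ> xor_reg w 2 ?j)"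
    by (rule unit_on_mono) simp
  have i1: "wp (exec w A B (If v_flag (Gate (X_gate (v_three, v_zero))) Skip) s)
      (\<lambda>s'. time s' \<le> time s + 2 \<and> qst s' = \<psi>1)"
    using env v by (cases v) (simp_all add: tick_def \<psi>1_def)
  have i2: "wp (exec w A B (Gate (QRAM v_zero v_one)) s1) (\<lambda>s'. time s' \<le> time s1 + 1 \<and> qst s' = qst s1 \<circ> qram_read w (mem s1) 0 1)"
    if "env s1" for s1 using that by (simp add: tick_def)
  show ?thesis
    unfolding clean_up_def
    apply (rule wp_seqI[OF i1])
    subgoal premises p1 for s1
    proof -
      have s1: "env s1" "vars s1 v_bits = ?b" "vars s1 v_j = ?j" "vars s1 v_cand = ?v" "mem s1 = mem s"
        using env_step[OF p1(1) env] by simp_all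
      show ?thesis
        apply (rule wp_seqI[OF i2[OF s1(1)]])
        subgoal premises p2 for s2
        proof -
          have s2: "env s2" "vars s2 v_bits = ?b" "vars s2 v_j = ?j" "vars s2 v_cand = ?v"
            using env_step[OF p2(1) s1(1)] s1 by simp_all
          show ?thesis
            apply (rule wp_seqI[OF xor_register_wp[OF s2(1)]])
              apply (use v' s2 in simp_all)[2]
            subgoal premises p3 for s3
            proof -
              have s3: "env s3" "vars s3 v_bits = ?b" "vars s3 v_j = ?j"
                using env_step[OF p3(1) s2(1)] s2 by simp_all
              show ?thesis
                apply (rule wp_seqI[OF xor_register_wp[OF s3(1)]])
                  apply (use j s3 in simp_all)[2]
                subgoal premises p4 for s4
                proof -
                  have s4: "env s4" "vars s4 v_bits = ?b"
                    using env_step[OF p4(1) s3(1)] s3 by simp_all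
                  have "qst s4 = \<psi>1 \<circ> ?Q \<circ> xor_reg w 0 ?v \<circ> xor_reg w 2 ?j"
                    unfolding p4(3) p3(3) p2(3) p1(3) s3 s2 s1 using s2(1) s3(1) by simp
                  then have u4: "unit_on (free_low (vars s4 v_bits) (\<lambda>_. False)) (qst s4)"
                    using u3 s4(2) by simp
                  have w20: "20 \<le> w" using len_pos by (simp add: w_def)
                  show ?thesis
                    apply (rule wp_lastI[OF reset_low_wp[OF s4(1) _ u4]])
                    using p1(2) p2(2) p3(2) p4(2) s4(2) bw w20 by simp_all
                qed
                done
            qed
            done
        qed
        done
    qed
    done
qed

text \<open>Outcome 1 has positive probability only if a good element exists, so success is never
  spurious. The chance of outcome 0 is the weight outside the good part, one minus the squared sine
  of the rotated angle.\<close>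

lemma grover_search_triple:
  assumes r: "search_ready s" and q: "blank (qst s)" and it: "vars s v_iters < 2 ^ w"
  shows "triple w A B (grover_search sw) s (90 * w * (vars s v_iters + 1))
    (\<lambda>s'. blank (qst s') \<and> (vars s' v_flag \<noteq> 0 \<longrightarrow> goods_of sw s > 0))
    (\<lambda>s'. if vars s' v_flag \<noteq> 0 then 0 else 1)
    (ennreal (1 - (sin ((2 * real (vars s v_iters) + 1) * angle_of sw s))\<^sup>2))"
proof -
  let ?r = "vars s v_iters" and ?C = "space_of s" and ?g = "good sw (mem s) (vars s v_j)"
  let ?Q = "qram_read w (mem s) 0 1" and ?E = "ent_call (\<not> sw) 2 1 (3, 0)"
  let ?p = "(sin ((2 * real ?r + 1) * angle_of sw s))\<^sup>2"
  let ?V = "\<lambda>s'. if vars s' v_flag \<noteq> 0 then 0 else 1 :: ennreal"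
  have env: "env s" and j: "vars s v_j < 2 ^ w" using r by (auto simp: search_ready_def)
  have fin: "finite ?C" by (simp add: space_of_def)
  have "triple w A B (grover_search sw) s ((40 * w + 83 * w * ?r) + (1 + 40 * w))
    (\<lambda>s'. blank (qst s') \<and> (vars s' v_flag \<noteq> 0 \<longrightarrow> goods_of sw s > 0)) ?V (ennreal (1 - ?p))"
    unfolding grover_search_def
  proof (rule triple_Seq_det)
    show "wp (exec w A B (prepare sw) s) (\<lambda>s'. time s' \<le> time s + (40 * w + 83 * w * ?r) \<and>
        (\<exists>\<psi>. grover_state sw s ?r \<psi> \<and> qst s' = \<psi> \<circ> ?Q \<circ> ?E))"
      using prepare_wp[OF r q it, of sw] by (simp add: add.assoc)
    fix s1 assume f1: "frame (prepare sw) s s1" and "\<exists>\<psi>. grover_state sw s ?r \<psi> \<and> qst s1 = \<psi> \<circ> ?Q \<circ> ?E"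
    then obtain \<psi> where st: "grover_state sw s ?r \<psi>" and q1: "qst s1 = \<psi> \<circ> (?Q \<circ> ?E)" by (auto simp: comp_assoc)
    note e1 = env_step[OF f1 env]
    have s1: "env s1" "vars s1 v_bits = vars s v_bits" "vars s1 v_cand = vars s v_cand"
        "vars s1 v_powcand = vars s v_powcand" "vars s1 v_j = vars s v_j" "mem s1 = mem s"
      using e1 by simp_all
    note r1 = search_ready_step[OF r s1]
    obtain z a b where z: "cmod z = 1"
      and amps: "angle_amps (card {b\<in>?C. ?g b}) (card {b\<in>?C. \<not> ?g b}) ((2 * real ?r + 1) * angle_of sw s) a b"
      and \<psi>: "\<psi> = two_level ?g ?C (z * of_real a) (z * of_real b)"
      using st unfolding grover_state_def goods_of_def bads_of_def by blast
    note unit = unit_on_two_level[OF fin amps z, folded \<psi>]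
    have inv: "(?Q \<circ> ?E) ((?E \<circ> ?Q) b) = b" "(?E \<circ> ?Q) ((?Q \<circ> ?E) b) = b" for b by simp_all
    have u1: "unit_on ((?E \<circ> ?Q) ` ?C) (qst s1)"
      unfolding q1 by (rule unit_on_bij[OF unit(1) inv])
    \<comment> \<open>The computation takes a basis state \<open>c\<close> to one whose flag is
      \<open>good c\<close>, so the flag is distributed like the weight of the good part.\<close>
    have prob: "outcome_prob (qst s1) (3, 0) True = (\<Sum>c | c \<in> ?C \<and> ?g c. (cmod (\<psi> c))\<^sup>2)"
      unfolding q1 outcome_prob_bij[OF unit(1) inv]
      using oracle_flag[OF _ j, of _ "vars s v_bits" "vars s v_cand"]
      by (intro sum.cong) (auto simp: space_of_def)
    have gp: "goods_of sw s > 0" if "outcome_prob (qst s1) (3, 0) True > 0"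
    proof (rule ccontr)
      assume "\<not> goods_of sw s > 0"
      then have "{c. c \<in> ?C \<and> ?g c} = {}" using fin by (simp add: goods_of_def)
      then show False using that prob by (simp only: sum.empty)
    qed
    show "triple w A B (Seq (Measure v_flag (v_three, v_zero)) clean_up) s1 (1 + 40 * w)
      (\<lambda>s'. blank (qst s') \<and> (vars s' v_flag \<noteq> 0 \<longrightarrow> goods_of sw s > 0)) ?V (ennreal (1 - ?p))"
    proof (rule triple_Seq)
      let ?Q1 = "\<lambda>s2. \<exists>v. vars s2 v_flag = of_bool v \<and> (v \<longrightarrow> goods_of sw s > 0) \<and>
          unit_on {b \<in> (?E \<circ> ?Q) ` ?C. b (3, 0) = v} (qst s2)"
      have m: "exec w A B (Measure v_flag (v_three, v_zero)) s1 = measure_qubit v_flag (3, 0) (tick s1)"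
        using s1(1) by simp
      have u1': "unit_on ((?E \<circ> ?Q) ` ?C) (qst (tick s1))" using u1 by (simp add: tick_def)
      have "wp (measure_qubit v_flag (3, 0) (tick s1)) (\<lambda>s2. time s2 \<le> time s1 + 1 \<and> ?Q1 s2)"
      proof (rule wp_measure_qubit[OF u1'])
        fix v assume "outcome_prob (qst (tick s1)) (3, 0) v > 0"
          and "unit_on {b \<in> (?E \<circ> ?Q) ` ?C. b (3, 0) = v} (collapse (qst (tick s1)) (3, 0) v)"
        then show "time (set_var v_flag (of_bool v) (tick s1\<lparr>qst := collapse (qst (tick s1)) (3, 0) v\<rparr>)) \<le> time s1 + 1 \<and>
            ?Q1 (set_var v_flag (of_bool v) (tick s1\<lparr>qst := collapse (qst (tick s1)) (3, 0) v\<rparr>))"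
          using gp by (auto simp: set_var_def tick_def intro!: exI[of _ v])
      qed
      moreover have "expect (measure_qubit v_flag (3, 0) (tick s1)) ?V \<le> ennreal (1 - ?p)"
        unfolding expect_measure_qubit[OF u1'] using prob unit(2) by (simp add: tick_def)
      ultimately show "triple w A B (Measure v_flag (v_three, v_zero)) s1 1 ?Q1 ?V (ennreal (1 - ?p))"
        unfolding triple_def m by simp
    next
      fix s2 assume f2: "frame (Measure v_flag (v_three, v_zero)) s1 s2"
        and "\<exists>v. vars s2 v_flag = of_bool v \<and> (v \<longrightarrow> goods_of sw s > 0) \<and>
          unit_on {b \<in> (?E \<circ> ?Q) ` ?C. b (3, 0) = v} (qst s2)"
      then obtain v where v: "vars s2 v_flag = of_bool v" "v \<longrightarrow> goods_of sw s > 0"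
        and u2: "unit_on {b \<in> (?E \<circ> ?Q) ` ?C. b (3, 0) = v} (qst s2)" by blast
      note e2 = env_step[OF f2 s1(1)]
      have s2: "env s2" "vars s2 v_bits = vars s1 v_bits" "vars s2 v_cand = vars s1 v_cand"
        "vars s2 v_powcand = vars s1 v_powcand" "vars s2 v_j = vars s1 v_j" "mem s2 = mem s1"
        using e2 by simp_all
      note r2 = search_ready_step[OF r1(1) s2]
      have "unit_on {b \<in> ?E ` qram_read w (mem s2) 0 1 ` space_of s2. b (3, 0) = v} (qst s2)"
        using u2 by (simp only: r2(2) r1(2) s2 s1 image_comp)
      from clean_up_wp[OF r2(1) v(1) this]
      have "wp (exec w A B clean_up s2) (\<lambda>s'. time s' \<le> time s2 + 40 * w \<and>
        (blank (qst s') \<and> (vars s' v_flag \<noteq> 0 \<longrightarrow> goods_of sw s > 0)) \<and> ?V s' \<le> ?V s2)"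
      proof (rule wp_frame)
        fix s' assume f: "frame clean_up s2 s'" and Q: "time s' \<le> time s2 + 40 * w \<and> blank (qst s')"
        have "vars s' v_flag = vars s2 v_flag" using f by (simp add: frame_def)
        with Q v show "time s' \<le> time s2 + 40 * w \<and>
          (blank (qst s') \<and> (vars s' v_flag \<noteq> 0 \<longrightarrow> goods_of sw s > 0)) \<and> ?V s' \<le> ?V s2" by simp
      qed
      then show "triple w A B clean_up s2 (40 * w) (\<lambda>s'. blank (qst s') \<and> (vars s' v_flag \<noteq> 0 \<longrightarrow> goods_of sw s > 0))
          ?V (?V s2)" by (rule triple_det)
    qed
  qed
  then show ?thesis
    by (rule triple_conseq) (use w_pos in \<open>auto simp: algebra_simps\<close>)
qed

end

section \<open>Search with an unknown number of marked elements\<close>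

text \<open>Repetitions multiply failure probabilities; \<open>k\<close> will be the bound
  contributed by the attempts still to come.\<close>

lemma triple_scale:
  assumes "triple w A B c s T Q V v"
  shows "triple w A B c s T Q (\<lambda>s'. k * V s') (k * v)"
  using assms unfolding triple_def expect_def
  by (auto simp: nn_integral_cmult mult_left_mono)

text \<open>For prefixes of deterministic instructions, which are evaluated by rewriting.\<close>

lemma triple_step:
  assumes "exec w A B c s = exec w A B d s'" "time s' = time s + k" "triple w A B d s' T Q V v" "T + k \<le> T'"
  shows "triple w A B c s T' Q V v"
  using assms by (auto simp: triple_def elim!: wp_mono)

lemma exec_Seq_basic:
  "exec w A B (Seq (Const x c) d) s = exec w A B d (tick (set_var x (take_bit w c) s))"
  "exec w A B (Seq (Op x f y z) d) s = exec w A B d (tick (set_var x (binop_val w f (vars s y) (vars s z)) s))"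
  "exec w A B (Seq (Load x y) d) s = exec w A B d (tick (set_var x (mem s (vars s y)) s))"
  "exec w A B (Seq (Store x y) d) s = exec w A B d (tick (s\<lparr>mem := (mem s)(vars s x := vars s y)\<rparr>))"
  by simp_all

lemma vars_set_var [simp]: "vars (set_var x v s) y = (if y = x then v else vars s y)"
  and set_var_simps [simp]: "mem (set_var x v s) = mem s" "qst (set_var x v s) = qst s" "time (set_var x v s) = time s"
  and tick_simps [simp]: "vars (tick s) = vars s" "mem (tick s) = mem s" "qst (tick s) = qst s" "time (tick s) = Suc (time s)"
  by (simp_all add: set_var_def tick_def)

lemma triple_If:
  assumes "vars s x \<noteq> 0 \<Longrightarrow> triple w A B c (tick s) T Q V v" "vars s x = 0 \<Longrightarrow> triple w A B d (tick s) T Q V v"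
  shows "triple w A B (If x c d) s (T + 1) Q V v"
  using assms by (auto simp: triple_def tick_def elim!: wp_mono)

abbreviation (input) v_p :: vname where "v_p \<equiv> 50"
abbreviation (input) v_round :: vname where "v_round \<equiv> 51"
abbreviation (input) v_bound :: vname where "v_bound \<equiv> 52"
abbreviation (input) v_rep :: vname where "v_rep \<equiv> 53"
abbreviation (input) v_found :: vname where "v_found \<equiv> 54"
abbreviation (input) v_test :: vname where "v_test \<equiv> 55"
abbreviation (input) v_nine :: vname where "v_nine \<equiv> 56"
abbreviation (input) v_size :: vname where "v_size \<equiv> 57"

definition attempt :: "bool \<Rightarrow> com" where
  "attempt sw = Seq (grover_search sw) (If v_flag (Const v_found 1) Skip)"

text \<open>\<open>v_p\<close> is \<open>3 ^ k\<close> in round \<open>k\<close>, and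
  \<open>v_p div 2\<close> the matching iteration count. The test skips counts for which
  \<open>v_p\<close> exceeds three times the square root of the range size; this keeps the cost low
  although the number of rounds depends on \<open>len\<close> only.\<close>

definition search_round :: "bool \<Rightarrow> com" where
  "search_round sw =
     Seq (Op v_test Mul v_p v_p) (Seq (Op v_test Less v_test v_bound)
       (Seq (If v_test (Seq (Op v_iters Div v_p v_two) (For v_rep v_reps (attempt sw))) Skip)
         (Op v_p Mul v_p v_three)))"

definition amplified_search :: "bool \<Rightarrow> com" where
  "amplified_search sw =
     Seq (Const v_found 0) (Seq (Const v_p 1) (Seq (Const v_nine 9)
       (Seq (Op v_bound Mul v_nine v_size) (Seq (Op v_bound Add v_bound v_one)
         (For v_round v_rounds (search_round sw))))))"

lemma modified_attempt [simp]:
    "modified (attempt sw) = {v_cond, v_x1, v_x2, v_x3, v_h, v_g, v_flag, v_meas, v_clean, v_found}"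
  and storefree_attempt [simp]: "storefree (attempt sw)"
  by (auto simp: attempt_def)

lemma modified_search_round [simp]:
    "modified (search_round sw) = {v_cond, v_x1, v_x2, v_x3, v_h, v_g, v_flag, v_meas, v_clean, v_found, v_test, v_iters, v_rep, v_p}"
  and storefree_search_round [simp]: "storefree (search_round sw)"
  by (auto simp: search_round_def)

lemma modified_amplified_search [simp]:
    "modified (amplified_search sw) = {v_cond, v_x1, v_x2, v_x3, v_h, v_g, v_flag, v_meas, v_clean, v_found, v_test, v_iters, v_rep,
      v_p, v_nine, v_bound, v_round}"
  and storefree_amplified_search [simp]: "storefree (amplified_search sw)"
  by (auto simp: amplified_search_def)

lemma le_floor_sqrt: "p\<^sup>2 \<le> m \<Longrightarrow> p \<le> floor_sqrt m"
  by (metis le_floor_sqrtI)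

context mw_input
begin

text \<open>By alignment the basis states of the search space run through the addresses of the
  range.\<close>

lemma goods_iff:
  assumes "search_ready s"
  shows "goods_of sw s > 0 \<longleftrightarrow>
    (\<exists>x<2 ^ vars s v_bits. ent (\<not> sw) (vars s v_j) (take_bit w (mem s (vars s v_cand + x))))"
proof -
  have b: "vars s v_bits \<le> w" and v: "2 ^ vars s v_bits dvd vars s v_cand" "vars s v_cand < 2 ^ w"
    using assms by (auto simp: search_ready_def w_def)
  have "goods_of sw s > 0 \<longleftrightarrow> (\<exists>c\<in>space_of s. good sw (mem s) (vars s v_j) c)"
    unfolding goods_of_def by (subst card_gt_0_iff) (auto simp: space_of_def)
  also have "\<dots> \<longleftrightarrow> (\<exists>x<2 ^ vars s v_bits. ent (\<not> sw) (vars s v_j) (take_bit w (mem s (vars s v_cand + x))))"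
  proof
    assume "\<exists>c\<in>space_of s. good sw (mem s) (vars s v_j) c"
    then obtain c where c: "c \<in> free_low (vars s v_bits) (start_basis (vars s v_cand) (vars s v_j))"
      and g: "good sw (mem s) (vars s v_j) c" by (auto simp: space_of_def)
    obtain x where "x < 2 ^ vars s v_bits" "word_of w c 0 = vars s v_cand + x"
      using word_of_free_low[OF c v b] by blast
    with g show "\<exists>x<2 ^ vars s v_bits. ent (\<not> sw) (vars s v_j) (take_bit w (mem s (vars s v_cand + x)))"
      by (auto simp: good_def)
  next
    assume "\<exists>x<2 ^ vars s v_bits. ent (\<not> sw) (vars s v_j) (take_bit w (mem s (vars s v_cand + x)))"
    then obtain x where x: "x < 2 ^ vars s v_bits" "ent (\<not> sw) (vars s v_j) (take_bit w (mem s (vars s v_cand + x)))"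
      by blast
    obtain c where "c \<in> space_of s" "word_of w c 0 = vars s v_cand + x"
      using ex_free_low_word[OF x(1) v b, of "vars s v_j"] by (auto simp: space_of_def)
    with x(2) show "\<exists>c\<in>space_of s. good sw (mem s) (vars s v_j) c"
      unfolding good_def by metis
  qed
  finally show ?thesis .
qed

text \<open>\<open>X\<close> stands for the failure bound of later attempts. The potential vanishes
  once something is found, and also for \<open>G = 0\<close>, where finding nothing is right. As
  \<open>v_found\<close> is only ever set here, it records whether any attempt succeeded.\<close>

lemma attempt_triple:
  fixes X :: ennreal
  assumes r: "search_ready s" and q: "blank (qst s)" and it: "vars s v_iters < 2 ^ w"
    and f: "vars s v_found \<noteq> 0 \<longrightarrow> G > 0" and G: "goods_of sw s = G"
  defines "\<delta> \<equiv> ennreal (1 - (sin ((2 * real (vars s v_iters) + 1) * angle_of sw s))\<^sup>2)"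
  shows "triple w A B (attempt sw) s (90 * w * (vars s v_iters + 1) + 2)
    (\<lambda>s'. blank (qst s') \<and> (vars s' v_found \<noteq> 0 \<longrightarrow> G > 0))
    (\<lambda>s'. if vars s' v_found \<noteq> 0 \<or> G = 0 then 0 else X)
    (if vars s v_found \<noteq> 0 \<or> G = 0 then 0 else X * \<delta>)"
proof -
  let ?k = "if vars s v_found \<noteq> 0 \<or> G = 0 then 0 else X"
  have "triple w A B (attempt sw) s (90 * w * (vars s v_iters + 1) + 2)
    (\<lambda>s'. blank (qst s') \<and> (vars s' v_found \<noteq> 0 \<longrightarrow> G > 0))
    (\<lambda>s'. if vars s' v_found \<noteq> 0 \<or> G = 0 then 0 else X) (?k * \<delta>)"
    unfolding attempt_def \<delta>_def
  proof (rule triple_Seq[OF triple_scale[OF grover_search_triple[OF r q it]]])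
    fix s1 assume fr: "frame (grover_search sw) s s1"
      and u: "blank (qst s1) \<and> (vars s1 v_flag \<noteq> 0 \<longrightarrow> goods_of sw s > 0)"
    have "vars s1 v_found = vars s v_found" using fr by (simp add: frame_def)
    then show "triple w A B (If v_flag (Const v_found 1) Skip) s1 2
        (\<lambda>s'. blank (qst s') \<and> (vars s' v_found \<noteq> 0 \<longrightarrow> G > 0))
        (\<lambda>s'. if vars s' v_found \<noteq> 0 \<or> G = 0 then 0 else X) (?k * (if vars s1 v_flag \<noteq> 0 then 0 else 1))"
      using u f G w_pos by (intro triple_det) (auto simp: tick_def set_var_def)
  qed
  then show ?thesis by (rule triple_conseq) auto
qed

text \<open>The exponent serves the union bound: four factors \<open>2 ^ len\<close> outweigh
  \<open>n * n * len\<close>. It is reached by \<open>4 * len\<close> attempts that succeed with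
  probability at least 1/2 each.\<close>

definition fail_prob :: ennreal where "fail_prob = ennreal ((1 / 2) ^ (4 * len))"

lemma attempts_triple:
  fixes X :: ennreal
  assumes r: "search_ready s" and q: "blank (qst s)" and it: "vars s v_iters < 2 ^ w"
    and f: "vars s v_found \<noteq> 0 \<longrightarrow> G > 0" and G: "goods_of sw s = G"
  defines "\<delta> \<equiv> ennreal (1 - (sin ((2 * real (vars s v_iters) + 1) * angle_of sw s))\<^sup>2)"
  shows "triple w A B (For v_rep v_reps (attempt sw)) s (3 + 4 * len * (90 * w * (vars s v_iters + 1) + 5))
    (\<lambda>s'. blank (qst s') \<and> (vars s' v_found \<noteq> 0 \<longrightarrow> G > 0))
    (\<lambda>s'. if vars s' v_found \<noteq> 0 \<or> G = 0 then 0 else X)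
    (if vars s v_found \<noteq> 0 \<or> G = 0 then 0 else X * \<delta> ^ (4 * len))"
proof -
  have env: "env s" using r by (simp add: search_ready_def)
  \<comment> \<open>Each attempt uses up one factor \<delta>.\<close>
  define V where "V = (\<lambda>k (s' :: config). if vars s' v_found \<noteq> 0 \<or> G = 0 then 0 else X * \<delta> ^ (4 * len - k))"
  define I where "I = (\<lambda>(k::nat) (s' :: config). blank (qst s') \<and> (vars s' v_found \<noteq> 0 \<longrightarrow> G > 0))"
  have "triple w A B (For v_rep v_reps (attempt sw)) s
      (3 + (\<Sum>k<4 * len. (90 * w * (vars s v_iters + 1) + 2) + 3)) (I (4 * len)) (V (4 * len)) (V 0 s)"
  proof (rule triple_For[OF w_pos reps_less_w])
    fix k s' assume k: "k < 4 * len" and I: "I k s'" and fr: "frame (For v_rep v_reps (attempt sw)) s s'"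
    note e = env_step[OF fr env]
    have s': "env s'" "vars s' v_bits = vars s v_bits" "vars s' v_cand = vars s v_cand"
        "vars s' v_powcand = vars s v_powcand" "vars s' v_j = vars s v_j" "mem s' = mem s"
      using e by simp_all
    have it': "vars s' v_iters = vars s v_iters" using e by simp
    note r' = search_ready_step[OF r s']
    have "triple w A B (attempt sw) s' (90 * w * (vars s v_iters + 1) + 2) (I (Suc k))
        (\<lambda>s'. if vars s' v_found \<noteq> 0 \<or> G = 0 then 0 else X * \<delta> ^ (4 * len - Suc k))
        (if vars s' v_found \<noteq> 0 \<or> G = 0 then 0 else X * \<delta> ^ (4 * len - Suc k) * \<delta>)"
      using attempt_triple[OF r'(1), of G sw "X * \<delta> ^ (4 * len - Suc k)"] I it G
      unfolding I_def \<delta>_def r' it' by simp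
    moreover have "X * \<delta> ^ (4 * len - Suc k) * \<delta> = X * \<delta> ^ (4 * len - k)"
    proof -
      have "4 * len - k = Suc (4 * len - Suc k)" using k by simp
      then show ?thesis by (simp add: mult_ac)
    qed
    ultimately show "triple w A B (attempt sw) s' (90 * w * (vars s v_iters + 1) + 2) (I (Suc k)) (V (Suc k)) (V k s')"
      unfolding V_def by (simp only:)
  qed (use env q f in \<open>auto simp: same_but_def I_def V_def\<close>)
  then show ?thesis
    by (rule triple_conseq) (auto simp: V_def I_def)
qed

text \<open>The largest value of \<open>v_p\<close> that the guard admits on a range of
  \<open>2 ^ b\<close> cells; the factor 9 is that of \<open>ex_good_power\<close>.\<close>

definition sqrt_cost :: "nat \<Rightarrow> nat" where "sqrt_cost b = floor_sqrt (9 * 2 ^ b)"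

lemma sqrt_cost_ge: "p\<^sup>2 \<le> 9 * 2 ^ b \<Longrightarrow> p \<le> sqrt_cost b"
  unfolding sqrt_cost_def by (rule le_floor_sqrt)

lemma sqrt_cost_ge_3: "3 \<le> sqrt_cost b"
proof (rule sqrt_cost_ge)
  have "(1::nat) \<le> 2 ^ b" by simp
  then show "3\<^sup>2 \<le> 9 * (2::nat) ^ b" by (simp add: power2_eq_square)
qed

text \<open>\<open>S\<close> is the round with a favourable angle. As long as it lies ahead, the
  failure bound is \<open>fail_prob\<close>; once it is over, the potential is the indicator of
  failure itself.\<close>

definition round_potential :: "nat \<Rightarrow> nat \<Rightarrow> nat \<Rightarrow> config \<Rightarrow> ennreal" where
  "round_potential S G k s = (if vars s v_found \<noteq> 0 \<or> G = 0 then 0 else if k \<le> S then fail_prob else 1)"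

lemma four_power_bound: "k \<le> m \<Longrightarrow> (3::nat) ^ k \<le> 4 ^ m"
  using power_mono[of "3::nat" 4 k] power_increasing[of k m "4::nat"] by linarith

lemma three_power_bound: "k \<le> len + 2 \<Longrightarrow> (3::nat) ^ k < 2 ^ w"
proof -
  assume "k \<le> len + 2"
  then have "(3::nat) ^ k \<le> 4 ^ (len + 2)"
    using four_power_bound by blast
  also have "\<dots> = (2::nat) ^ (2 * (len + 2))" by (simp add: power_mult)
  also have "\<dots> < 2 ^ w" using len_pos by (intro power_strict_increasing) (auto simp: w_def)
  finally show ?thesis .
qed

text \<open>The last round has number \<open>len + 1\<close>, so the square computed for the guard
  does not overflow.\<close>

lemma nine_power_bound: "k \<le> len + 1 \<Longrightarrow> (3::nat) ^ k * 3 ^ k < 2 ^ w"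
proof -
  assume "k \<le> len + 1"
  then have "(3::nat) ^ k * 3 ^ k \<le> 4 ^ (len + 1) * 4 ^ (len + 1)"
    by (intro mult_mono four_power_bound) auto
  also have "\<dots> = (2::nat) ^ (2 * (len + 1) + 2 * (len + 1))" by (simp add: power_mult power_add flip: power_mult_distrib)
  also have "\<dots> < 2 ^ w" using len_pos by (intro power_strict_increasing) (auto simp: w_def)
  finally show ?thesis .
qed

lemma search_round_triple:
  assumes r: "search_ready s" and q: "blank (qst s)"
    and f: "vars s v_found \<noteq> 0 \<longrightarrow> G > 0" and G: "goods_of sw s = G"
    and k: "k < len + 2" "vars s v_p = 3 ^ k" and bnd: "vars s v_bound = 9 * 2 ^ vars s v_bits + 1"
    and S: "G > 0 \<Longrightarrow> (sin (3 ^ S * angle_of sw s))\<^sup>2 \<ge> 1 / 2 \<and> (3 ^ S)\<^sup>2 \<le> (9 * 2 ^ vars s v_bits :: nat)"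
  shows "triple w A B (search_round sw) s (22 * w ^ 2 * sqrt_cost (vars s v_bits))
    (\<lambda>s'. blank (qst s') \<and> (vars s' v_found \<noteq> 0 \<longrightarrow> G > 0) \<and> vars s' v_p = 3 ^ Suc k)
    (round_potential S G (Suc k)) (round_potential S G k s)"
proof -
  let ?p = "3 ^ k :: nat" and ?b = "vars s v_bits" and ?P = "sqrt_cost (vars s v_bits)"
  let ?c = "Seq (Op v_iters Div v_p v_two) (For v_rep v_reps (attempt sw))"
  have env: "env s" using r by (simp add: search_ready_def)
  define s2 where "s2 = tick (set_var v_test (of_bool (?p * ?p < 9 * 2 ^ ?b + 1)) (tick (set_var v_test (?p * ?p) s)))"
  define T where "T = 3 + 4 * len * (90 * w * ?P + 5)"
  have ex: "exec w A B (search_round sw) s = exec w A B (Seq (If v_test ?c Skip) (Op v_p Mul v_p v_three)) s2"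
  proof -
    have "take_bit w (?p * ?p) = ?p * ?p" using k nine_power_bound[of k] by (intro take_bit_self) simp
    then show ?thesis
      unfolding search_round_def exec_Seq_basic s2_def by (simp add: k(2) bnd del: exec.simps)
  qed
  have s2: "env s2" "vars s2 v_bits = vars s v_bits" "vars s2 v_cand = vars s v_cand"
        "vars s2 v_powcand = vars s v_powcand" "vars s2 v_j = vars s v_j" "mem s2 = mem s"
    using env by (simp_all add: s2_def)
  have s2': "vars s2 v_found = vars s v_found" "vars s2 v_p = ?p" "qst s2 = qst s"
      "vars s2 v_test = of_bool (?p * ?p < 9 * 2 ^ ?b + 1)" "time s2 = time s + 2"
    using k by (simp_all add: s2_def)
  note r2 = search_ready_step[OF r s2]
  have "triple w A B (If v_test ?c Skip) s2 ((T + 1) + 1)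
    (\<lambda>s'. blank (qst s') \<and> (vars s' v_found \<noteq> 0 \<longrightarrow> G > 0))
    (round_potential S G (Suc k)) (round_potential S G k s)"
  proof (rule triple_If)
    assume "vars s2 v_test \<noteq> 0"
    then have "?p * ?p < 9 * 2 ^ ?b + 1" unfolding s2'(4) of_bool_eq_0_iff not_not .
    then have pp: "?p * ?p \<le> 9 * 2 ^ ?b" by linarith
    then have pP: "?p \<le> ?P" by (intro sqrt_cost_ge) (simp only: power2_eq_square)
    define s4 where "s4 = tick (set_var v_iters (?p div 2) (tick s2))"
    have pw: "?p div 2 < 2 ^ w" by (rule le_less_trans[OF div_le_dividend]) (use three_power_bound[of k] k(1) in simp)
    have s4: "env s4" "vars s4 v_bits = vars s v_bits" "vars s4 v_cand = vars s v_cand"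
        "vars s4 v_powcand = vars s v_powcand" "vars s4 v_j = vars s v_j" "mem s4 = mem s"
      using s2 by (simp_all add: s4_def)
    have s4': "vars s4 v_found = vars s v_found" "vars s4 v_iters = ?p div 2" "qst s4 = qst s" "time s4 = time s2 + 2"
      using s2' by (simp_all add: s4_def)
    note r4 = search_ready_step[OF r s4]
    \<comment> \<open>As \<open>?p\<close> is odd, \<open>?p div 2\<close> iterations turn the state
      to exactly \<open>3 ^ k\<close> times the initial angle.\<close>
    have odd: "odd ?p" by simp
    then have "2 * (?p div 2) + 1 = ?p" by (rule odd_two_times_div_two_succ)
    from arg_cong[OF this, of real] have p2: "2 * real (?p div 2) + 1 = 3 ^ k" by (simp only: of_nat_add of_nat_mult of_nat_numeral of_nat_power of_nat_1)
    define \<delta> where "\<delta> = ennreal (1 - (sin (3 ^ k * angle_of sw s))\<^sup>2)"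
    define X where "X = (if Suc k \<le> S then fail_prob else 1)"
    have a: "triple w A B (For v_rep v_reps (attempt sw)) s4 (3 + 4 * len * (90 * w * (?p div 2 + 1) + 5))
      (\<lambda>s'. blank (qst s') \<and> (vars s' v_found \<noteq> 0 \<longrightarrow> G > 0))
      (\<lambda>s'. if vars s' v_found \<noteq> 0 \<or> G = 0 then 0 else X)
      (if vars s v_found \<noteq> 0 \<or> G = 0 then 0 else X * \<delta> ^ (4 * len))"
      using attempts_triple[OF r4(1), of G sw X] q pw f G unfolding s4' p2 r4 \<delta>_def by simp
    have le: "(if vars s v_found \<noteq> 0 \<or> G = 0 then 0 else X * \<delta> ^ (4 * len)) \<le> round_potential S G k s"
    proof (cases "vars s v_found \<noteq> 0 \<or> G = 0")
      case False
      have d1: "\<delta> \<le> 1" unfolding \<delta>_def by simp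
      \<comment> \<open>Only round \<open>S\<close> has to gain anything, and there \<delta> is at
        most 1/2. In every other round \<open>\<delta> \<le> 1\<close> suffices.\<close>
      have "X * \<delta> ^ (4 * len) \<le> (if k \<le> S then fail_prob else 1)"
      proof (cases "k = S")
        case True
        have "\<delta> \<le> ennreal (1 / 2)" unfolding \<delta>_def using S False True by (intro ennreal_leI) auto
        then have "\<delta> ^ (4 * len) \<le> ennreal (1 / 2) ^ (4 * len)" by (rule power_mono) simp
        also have "\<dots> = fail_prob" unfolding fail_prob_def by (rule ennreal_power) simp
        finally show ?thesis using True by (simp add: X_def)
      next
        case False
        have "\<delta> ^ (4 * len) \<le> 1" using d1 by (simp add: power_le_one)
        then have "X * \<delta> ^ (4 * len) \<le> X" using mult_left_mono[of "\<delta> ^ (4 * len)" 1 X] by simp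
        then show ?thesis using False by (auto simp: X_def)
      qed
      then show ?thesis using False by (simp add: round_potential_def)
    qed (simp add: round_potential_def)
    have "?p div 2 + 1 \<le> ?P" using odd pP by presburger
    then have t: "3 + 4 * len * (90 * w * (?p div 2 + 1) + 5) \<le> T"
      unfolding T_def by (intro add_mono mult_left_mono) auto
    have "triple w A B (For v_rep v_reps (attempt sw)) s4 T
      (\<lambda>s'. blank (qst s') \<and> (vars s' v_found \<noteq> 0 \<longrightarrow> G > 0))
      (round_potential S G (Suc k)) (round_potential S G k s)"
      using a t le by (rule triple_conseq) (auto simp: round_potential_def X_def)
    moreover have "exec w A B ?c (tick s2) = exec w A B (For v_rep v_reps (attempt sw)) s4"
    proof -
      have "vars (tick s2) v_two = 2" using s2(1) by simp
      then show ?thesis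
        unfolding exec_Seq_basic s4_def using s2'(2) take_bit_self[OF pw] by (simp del: exec.simps)
    qed
    ultimately show "triple w A B ?c (tick s2) (T + 1) (\<lambda>s'. blank (qst s') \<and> (vars s' v_found \<noteq> 0 \<longrightarrow> G > 0))
      (round_potential S G (Suc k)) (round_potential S G k s)"
      by (intro triple_step[of w A B ?c "tick s2" "For v_rep v_reps (attempt sw)" s4 1 T]) (auto simp: s4'(4) tick_def)
  next
    assume "vars s2 v_test = 0"
    then have "\<not> ?p * ?p < 9 * 2 ^ ?b + 1" unfolding s2'(4) of_bool_eq_0_iff .
    then have pp: "9 * 2 ^ ?b < ?p * ?p" by linarith
    \<comment> \<open>A skipped round lies beyond \<open>S\<close>, whose power of 3 passes the
      guard, so the favourable round has been played already.\<close>
    have "S < k" if "G > 0"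
    proof (rule ccontr)
      assume "\<not> S < k"
      then have "?p \<le> 3 ^ S" by (simp add: power_increasing)
      then have "?p * ?p \<le> (3 ^ S)\<^sup>2" by (simp add: power2_eq_square mult_mono)
      with S[OF that] pp show False by linarith
    qed
    then show "triple w A B Skip (tick s2) (T + 1) (\<lambda>s'. blank (qst s') \<and> (vars s' v_found \<noteq> 0 \<longrightarrow> G > 0))
      (round_potential S G (Suc k)) (round_potential S G k s)"
      using q f s2' by (intro triple_det) (auto simp: tick_def round_potential_def)
  qed
  then have "triple w A B (Seq (If v_test ?c Skip) (Op v_p Mul v_p v_three)) s2 (((T + 1) + 1) + 1)
      (\<lambda>s'. blank (qst s') \<and> (vars s' v_found \<noteq> 0 \<longrightarrow> G > 0) \<and> vars s' v_p = 3 ^ Suc k)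
    (round_potential S G (Suc k)) (round_potential S G k s)"
  proof (rule triple_Seq)
    fix s5 assume fr: "frame (If v_test ?c Skip) s2 s5"
      and u: "blank (qst s5) \<and> (vars s5 v_found \<noteq> 0 \<longrightarrow> G > 0)"
    have "vars s5 v_p = ?p" "vars s5 v_three = 3"
      using env_step[OF fr s2(1)] s2' by simp_all
    moreover have "take_bit w (3 ^ k * 3) = (3 ^ Suc k :: nat)"
      using three_power_bound[of "Suc k"] k by (simp add: take_bit_self mult.commute)
    ultimately show "triple w A B (Op v_p Mul v_p v_three) s5 1
      (\<lambda>s'. blank (qst s') \<and> (vars s' v_found \<noteq> 0 \<longrightarrow> G > 0) \<and> vars s' v_p = 3 ^ Suc k)
      (round_potential S G (Suc k)) (round_potential S G (Suc k) s5)"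
      using u by (intro triple_det) (auto simp: tick_def set_var_def round_potential_def)
  qed
  then have "triple w A B (search_round sw) s (T + 5)
      (\<lambda>s'. blank (qst s') \<and> (vars s' v_found \<noteq> 0 \<longrightarrow> G > 0) \<and> vars s' v_p = 3 ^ Suc k)
    (round_potential S G (Suc k)) (round_potential S G k s)"
    by (rule triple_step[OF ex s2'(5)]) simp
  moreover have "T + 5 \<le> 22 * w ^ 2 * ?P"
  proof -
    have P: "3 \<le> ?P" by (rule sqrt_cost_ge_3)
    have w: "20 \<le> w" "4 * len * 5 = w" using len_pos by (simp_all add: w_def)
    have wP: "w * 20 * 3 \<le> w * w * ?P" using w P by (intro mult_mono) auto
    have "T + 5 = 8 + 4 * len * 5 * (18 * w * ?P + 1)" unfolding T_def by (simp add: algebra_simps)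
    also have "\<dots> = 8 + w + 18 * (w * w * ?P)" unfolding w(2) by (simp add: algebra_simps)
    also have "\<dots> \<le> 22 * (w * w * ?P)" using wP w by linarith
    finally show ?thesis by (simp add: power2_eq_square)
  qed
  ultimately show ?thesis by (rule triple_conseq) auto
qed

text \<open>Rounds with an unfavourable count cost time but do no harm. They are not cut short after
  a success, which makes the time bound a sure one.\<close>

lemma amplified_search_triple:
  assumes r: "search_ready s" and q: "blank (qst s)" and sz: "vars s v_size = 2 ^ vars s v_bits"
  shows "triple w A B (amplified_search sw) s (25 * w ^ 3 * sqrt_cost (vars s v_bits))
    (\<lambda>s'. blank (qst s') \<and> (vars s' v_found \<noteq> 0 \<longrightarrow> goods_of sw s > 0))
    (\<lambda>s'. if vars s' v_found \<noteq> 0 \<or> goods_of sw s = 0 then 0 else 1) fail_prob"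
proof -
  let ?b = "vars s v_bits" and ?P = "sqrt_cost (vars s v_bits)"
  define G where "G = goods_of sw s"
  have env: "env s" and b: "?b \<le> len" using r by (auto simp: search_ready_def)
  obtain S where S: "G > 0 \<Longrightarrow> (sin (3 ^ S * angle_of sw s))\<^sup>2 \<ge> 1 / 2 \<and> (3 ^ S)\<^sup>2 \<le> (9 * 2 ^ ?b :: nat)"
    using ex_good_power[of G "bads_of sw s"] goods_bads[of sw s] unfolding G_def by metis
  \<comment> \<open>The favourable round is among the \<open>len + 2\<close> rounds, since
    \<open>9 ^ (len + 2)\<close> exceeds \<open>9 * 2 ^ len\<close>.\<close>
  have SK: "S < len + 2" if "G > 0"
  proof (rule ccontr)
    assume "\<not> S < len + 2"
    then have "(3::nat) ^ (len + 2) \<le> 3 ^ S" by (intro power_increasing) auto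
    then have "((3::nat) ^ (len + 2))\<^sup>2 \<le> (3 ^ S)\<^sup>2" by (rule power_mono) simp
    also have "\<dots> \<le> 9 * 2 ^ ?b" using S[OF that] by simp
    also have "\<dots> \<le> 9 * 2 ^ len" using b by simp
    also have "\<dots> \<le> 9 * 9 ^ len" by (simp add: power_mono)
    also have "\<dots> < 9 * 9 * 9 ^ len" by simp
    also have "\<dots> = ((3::nat) ^ (len + 2))\<^sup>2" by (simp add: power2_eq_square flip: power_mult_distrib)
    finally show False by simp
  qed
  have bnd: "9 * 2 ^ ?b + 1 < (2::nat) ^ w"
  proof -
    have "(2::nat) ^ ?b \<le> 2 ^ len" "(1::nat) \<le> 2 ^ ?b" using b by simp_all
    moreover have "(2::nat) ^ (len + 4) = 16 * 2 ^ len" by (simp add: power_add)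
    ultimately have "9 * 2 ^ ?b + 1 < (2::nat) ^ (len + 4)" by linarith
    also have "\<dots> \<le> 2 ^ w" using len_pos by (intro power_increasing) (auto simp: w_def)
    finally show ?thesis .
  qed
  define s5 where "s5 = tick (set_var v_bound (9 * 2 ^ ?b + 1) (tick (set_var v_bound (9 * 2 ^ ?b) (tick (set_var v_nine 9
    (tick (set_var v_p 1 (tick (set_var v_found 0 s)))))))))"
  have nine: "take_bit w 9 = (9::nat)" "take_bit w (9 * 2 ^ ?b) = (9 * 2 ^ ?b :: nat)"
      "take_bit w (Suc (9 * 2 ^ ?b)) = (Suc (9 * 2 ^ ?b) :: nat)"
  proof -
    have "(1::nat) \<le> 2 ^ ?b" by simp
    then show "take_bit w 9 = (9::nat)" using bnd by (intro take_bit_self) linarith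
    show "take_bit w (9 * 2 ^ ?b) = (9 * 2 ^ ?b :: nat)" using bnd by (intro take_bit_self) linarith
    show "take_bit w (Suc (9 * 2 ^ ?b)) = (Suc (9 * 2 ^ ?b) :: nat)" using bnd by (intro take_bit_self) linarith
  qed
  have ex: "exec w A B (amplified_search sw) s = exec w A B (For v_round v_rounds (search_round sw)) s5"
    unfolding amplified_search_def exec_Seq_basic s5_def using env nine w_pos by (simp add: sz del: exec.simps)
  have s5: "env s5" "vars s5 v_bits = vars s v_bits" "vars s5 v_cand = vars s v_cand"
        "vars s5 v_powcand = vars s v_powcand" "vars s5 v_j = vars s v_j" "mem s5 = mem s"
    using env by (simp_all add: s5_def)
  have s5': "vars s5 v_found = 0" "vars s5 v_p = 1" "qst s5 = qst s" "vars s5 v_bound = 9 * 2 ^ ?b + 1" "time s5 = time s + 5"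
    by (simp_all add: s5_def)
  note r5 = search_ready_step[OF r s5]
  define I where "I = (\<lambda>k (s'::config). blank (qst s') \<and> (vars s' v_found \<noteq> 0 \<longrightarrow> G > 0) \<and> vars s' v_p = 3 ^ k)"
  have "triple w A B (For v_round v_rounds (search_round sw)) s5 (3 + (\<Sum>k<len + 2. 22 * w ^ 2 * ?P + 3))
    (I (len + 2)) (round_potential S G (len + 2)) (round_potential S G 0 s5)"
  proof (rule triple_For[OF w_pos len_less_w])
    fix k s' assume k: "k < len + 2" and I: "I k s'" and fr: "frame (For v_round v_rounds (search_round sw)) s5 s'"
    note e = env_step[OF fr s5(1)]
    have s': "env s'" "vars s' v_bits = vars s v_bits" "vars s' v_cand = vars s v_cand"
        "vars s' v_powcand = vars s v_powcand" "vars s' v_j = vars s v_j" "mem s' = mem s"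
      using e s5 by simp_all
    have bd: "vars s' v_bound = 9 * 2 ^ ?b + 1" using e s5' by simp
    note r' = search_ready_step[OF r s']
    show "triple w A B (search_round sw) s' (22 * w ^ 2 * ?P) (I (Suc k)) (round_potential S G (Suc k)) (round_potential S G k s')"
      using search_round_triple[OF r'(1), of G sw k S] I k bd S unfolding I_def r' s'(2) G_def by simp
  next
    show "I k s'' \<and> round_potential S G k s'' = round_potential S G k s'" if "I k s'" "same_but {v_round, v_cond} s' s''" for k s' s''
      using that by (auto simp: same_but_def I_def round_potential_def)
  qed (use s5 s5' q in \<open>auto simp: I_def\<close>)
  then have "triple w A B (amplified_search sw) s (3 + (\<Sum>k<len + 2. 22 * w ^ 2 * ?P + 3) + 5)
    (I (len + 2)) (round_potential S G (len + 2)) (round_potential S G 0 s5)"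
    by (rule triple_step[OF ex s5'(5)]) simp
  moreover have "3 + (\<Sum>k<len + 2. 22 * w ^ 2 * ?P + 3) + 5 \<le> 25 * w ^ 3 * ?P"
  proof -
    have P: "3 \<le> ?P" by (rule sqrt_cost_ge_3)
    have w: "20 \<le> w" "len + 2 \<le> w" using len_pos by (simp_all add: w_def)
    have wP: "20 * 20 * 3 \<le> w * w * ?P" using w P by (intro mult_mono) auto
    have "3 + (\<Sum>k<len + 2. 22 * w ^ 2 * ?P + 3) + 5 = 8 + (len + 2) * (22 * w ^ 2 * ?P + 3)" by simp
    also have "\<dots> \<le> 8 + (len + 2) * (23 * (w * w * ?P))"
      using wP by (intro add_left_mono mult_left_mono) (auto simp: power2_eq_square)
    also have "\<dots> \<le> 8 + w * (23 * (w * w * ?P))"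
      using w by (intro add_left_mono mult_right_mono) auto
    also have "\<dots> \<le> w * (w * w * ?P) + w * (23 * (w * w * ?P))"
    proof -
      have "1 * 8 \<le> w * (w * w * ?P)" using w wP by (intro mult_mono) linarith+
      then show ?thesis by simp
    qed
    also have "\<dots> \<le> 25 * w ^ 3 * ?P" by (simp add: power3_eq_cube)
    finally show ?thesis .
  qed
  moreover have "round_potential S G 0 s5 \<le> fail_prob"
    by (simp add: round_potential_def)
  ultimately show ?thesis
  proof (rule triple_conseq)
    fix s' assume "I (len + 2) s'"
    then show "(blank (qst s') \<and> (vars s' v_found \<noteq> 0 \<longrightarrow> goods_of sw s > 0)) \<and>
        (if vars s' v_found \<noteq> 0 \<or> goods_of sw s = 0 then 0 else 1) \<le> round_potential S G (len + 2) s'"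
      using SK by (auto simp: I_def round_potential_def G_def)
  qed
qed

end

section \<open>Maximum search\<close>

text \<open>Union bound: a failure bound \<open>k\<close> from elsewhere is carried along. The total
  mass is at most 1, so the constant contributes at most \<open>k\<close>.\<close>

lemma triple_add:
  assumes "triple w A B c s T Q V v"
  shows "triple w A B c s T Q (\<lambda>s'. k + V s') (k + v)"
proof -
  have "expect (exec w A B c s) (\<lambda>s'. k + V s') = expect (exec w A B c s) (\<lambda>_. k) + expect (exec w A B c s) V"
    unfolding expect_def by (simp add: nn_integral_add)
  also have "\<dots> \<le> k + v"
    using assms expect_const_le by (intro add_mono) (auto simp: triple_def)
  finally show ?thesis using assms by (simp add: triple_def)
qed

section \<open>Reading a matrix entry classically\<close>

context mw_input
begin

lemma query_wp:
  assumes env: "env s" and q: "blank (qst s)"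
    and ij: "vars s i < 2 ^ w" "vars s j < 2 ^ w" "{i, j} \<inter> {x, v_cond, v_x1, v_x2, v_x3} = {}"
    and x: "x \<notin> {v_cond, v_x1, v_x2, v_x3}" "x \<notin> insert v_n {v_zero..v_rounds}"
  shows "wp (exec w A B (query sw x i j) s) (\<lambda>s'. time s' \<le> time s + 60 * w \<and>
    blank (qst s') \<and> vars s' x = of_bool (ent sw (vars s i) (vars s j)))"
proof -
  let ?i = "vars s i" and ?j = "vars s j"
  define b1 where "b1 = xor_reg w 1 ?j (xor_reg w 0 ?i (\<lambda>_. False))"
  let ?E = "ent_call sw 0 1 (3, 0)" and ?F = "flip_if (\<lambda>_. True) (3, 0)"
  have b1: "b1 (r, t) \<longleftrightarrow> t < w \<and> (r = 0 \<and> bit ?i t \<or> r = 1 \<and> bit ?j t)" for r t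
    by (auto simp: b1_def xor_reg_apply)
  have "word_of w b1 0 = ?i" "word_of w b1 1 = ?j"
    using bit_nat_less[OF ij(1)] bit_nat_less[OF ij(2)] by (intro word_of_eqI; auto simp: b1)+
  then have E: "?E b1 (3, 0) = ent sw ?i ?j" by (simp add: ent_call_apply b1)
  \<comment> \<open>The oracle call alters only the flag, which is clear in
    \<open>b1\<close>.\<close>
  have F: "(if ent sw ?i ?j then ?F (?E b1) else ?E b1) = b1"
    using b1[of 3 0] E by (auto simp: fun_eq_iff flip_if_def ent_call_apply)
  have g: "wp (exec w A B (Gate (matrix_gate sw v_zero v_one (v_three, v_zero))) s2)
      (\<lambda>s'. time s' \<le> time s2 + 1 \<and> qst s' = qst s2 \<circ> ?E)" if "env s2" for s2
    using that by simp
  have m: "wp (exec w A B (Measure x (v_three, v_zero)) s3) (\<lambda>s'. time s' \<le> time s3 + 1 \<and>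
      unit_on {?E b1} (qst s') \<and> vars s' x = of_bool (ent sw ?i ?j))"
    if "env s3" and u: "unit_on {?E b1} (qst s3)" for s3
  proof -
    have ex: "exec w A B (Measure x (v_three, v_zero)) s3 = measure_qubit x (3, 0) (tick s3)"
      using that(1) by simp
    have u': "unit_on {?E b1} (qst (tick s3))" using u by simp
    show ?thesis
      unfolding ex
    proof (rule wp_measure_qubit[OF u'])
      fix v assume un: "unit_on {b \<in> {?E b1}. b (3, 0) = v} (collapse (qst (tick s3)) (3, 0) v)"
      \<comment> \<open>The other outcome would leave an empty support, contradicting norm
        1.\<close>
      have v: "v = ent sw ?i ?j"
      proof (rule ccontr)
        assume "v \<noteq> ent sw ?i ?j"
        then have "{b \<in> {?E b1}. b (3, 0) = v} = {}" using E by auto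
        with un show False by (simp only: unit_on_def sum.empty) simp
      qed
      have "{b \<in> {?E b1}. b (3, 0) = v} = {?E b1}" using v E by auto
      then show "time (set_var x (of_bool v) (tick s3\<lparr>qst := collapse (qst (tick s3)) (3, 0) v\<rparr>)) \<le> time s3 + 1 \<and>
        unit_on {?E b1} (qst (set_var x (of_bool v) (tick s3\<lparr>qst := collapse (qst (tick s3)) (3, 0) v\<rparr>))) \<and>
        vars (set_var x (of_bool v) (tick s3\<lparr>qst := collapse (qst (tick s3)) (3, 0) v\<rparr>)) x = of_bool (ent sw ?i ?j)"
        using un v by simp
    qed
  qed
  have i: "wp (exec w A B (If x (Gate (X_gate (v_three, v_zero))) Skip) s4) (\<lambda>s'. time s' \<le> time s4 + 2 \<and> unit_on {b1} (qst s'))"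
    if "env s4" "unit_on {?E b1} (qst s4)" "vars s4 x = of_bool (ent sw ?i ?j)" for s4
    using that unit_on_permute[OF that(2), of ?F] F by (cases "ent sw ?i ?j") simp_all
  have w20: "20 \<le> w" using len_pos by (simp add: w_def)
  show ?thesis
    unfolding query_def
    apply (rule wp_seqI[OF xor_register_wp[OF env]])
      apply (use ij in simp_all)[2]
    subgoal premises p1 for s1
    proof -
      have s1: "env s1" "vars s1 i = ?i" "vars s1 j = ?j"
        using env_step[OF p1(1) env] ij by auto
      show ?thesis
        apply (rule wp_seqI[OF xor_register_wp[OF s1(1)]])
          apply (use ij s1 in simp_all)[2]
        subgoal premises p2 for s2
        proof -
          have s2: "env s2" "vars s2 i = ?i" "vars s2 j = ?j"
            using env_step[OF p2(1) s1(1)] s1 ij by auto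
          have "qst s2 = (qst s \<circ> xor_reg w 0 ?i) \<circ> xor_reg w 1 ?j"
            unfolding p2(3) p1(3) s1(3) using env s1(1) by simp
          then have q2: "unit_on {b1} (qst s2)"
            using unit_on_permute[OF unit_on_permute[OF q, of "xor_reg w 0 ?i"], of "xor_reg w 1 ?j"] by (simp add: b1_def)
          show ?thesis
            apply (rule wp_seqI[OF g[OF s2(1)]])
            subgoal premises p3 for s3
            proof -
              have s3: "env s3" "vars s3 i = ?i" "vars s3 j = ?j"
                using env_step[OF p3(1) s2(1)] s2 by auto
              have q3: "unit_on {?E b1} (qst s3)"
                unfolding p3(3) using unit_on_permute[OF q2, of ?E] by simp
              show ?thesis
                apply (rule wp_seqI[OF m[OF s3(1) q3]])
                subgoal premises p4 for s4
                proof -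
                  have s4: "env s4" "vars s4 i = ?i" "vars s4 j = ?j"
                    using env_step[OF p4(1) s3(1)] s3 ij x by auto
                  show ?thesis
                    apply (rule wp_seqI[OF i[OF s4(1)]])
                      apply (use p4 in simp_all)[2]
                    subgoal premises p5 for s5
                    proof -
                      have s5: "env s5" "vars s5 i = ?i" "vars s5 j = ?j" "vars s5 x = of_bool (ent sw ?i ?j)"
                        using env_step[OF p5(1) s4(1)] s4 p4(3) by auto
                      show ?thesis
                        apply (rule wp_seqI[OF xor_register_wp[OF s5(1)]])
                          apply (use ij s5 in simp_all)[2]
                        subgoal premises p6 for s6
                        proof -
                          have s6: "env s6" "vars s6 i = ?i" "vars s6 j = ?j" "vars s6 x = of_bool (ent sw ?i ?j)"
                            using env_step[OF p6(1) s5(1)] s5 ij x by auto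
                          show ?thesis
                            apply (rule wp_lastI[OF xor_register_wp[OF s6(1)]])
                              apply (use ij s6 in simp_all)[2]
                            subgoal premises p7 for s7
                            proof -
                              have "qst s7 = (qst s5 \<circ> xor_reg w 0 ?i) \<circ> xor_reg w 1 ?j"
                                unfolding p7(3) p6(3) s6(3) s5(2) using s5(1) s6(1) by simp
                              moreover have "xor_reg w 1 ?j (xor_reg w 0 ?i b1) = (\<lambda>_. False)"
                                unfolding b1_def xor_reg_commute[of w 0 ?i w 1 ?j] by simp
                              ultimately have q7: "blank (qst s7)"
                                using unit_on_permute[OF unit_on_permute[OF p5(3), of "xor_reg w 0 ?i"], of "xor_reg w 1 ?j"] by simp
                              have "vars s7 x = of_bool (ent sw ?i ?j)"
                                using env_step(2)[OF p7(1) s6(1)] s6 x by auto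
                              then show ?thesis
                                using q7 p1(2) p2(2) p3(2) p4(2) p5(2) p6(2) p7(2) w20 by linarith
                            qed
                            done
                        qed
                        done
                    qed
                    done
                qed
                done
            qed
            done
        qed
        done
    qed
    done
qed

end

section \<open>Binary search for the last marked position\<close>

abbreviation (input) v_ans :: vname where "v_ans \<equiv> 60"
abbreviation (input) v_bb :: vname where "v_bb \<equiv> 61"
abbreviation (input) v_t :: vname where "v_t \<equiv> 62"
abbreviation (input) v_i :: vname where "v_i \<equiv> 70"
abbreviation (input) v_k :: vname where "v_k \<equiv> 71"
abbreviation (input) v_cnt :: vname where "v_cnt \<equiv> 72"
abbreviation (input) v_pw :: vname where "v_pw \<equiv> 73"
abbreviation (input) v_c :: vname where "v_c \<equiv> 74"
abbreviation (input) v_addr :: vname where "v_addr \<equiv> 75"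
abbreviation (input) v_tmp :: vname where "v_tmp \<equiv> 76"
abbreviation (input) v_res :: vname where "v_res \<equiv> 77"
abbreviation (input) v_val :: vname where "v_val \<equiv> 78"
abbreviation (input) v_m :: vname where "v_m \<equiv> 79"

text \<open>\<open>v_ans\<close> is the lower end of the current range, relative to
  \<open>tab\<close>; after the halving, \<open>v_cand\<close> is the address of its upper
  half.\<close>

definition bit_step :: "bool \<Rightarrow> com" where
  "bit_step sw =
     Seq (Op v_size Div v_size v_two) (Seq (Op v_bits Sub v_bits v_one)
       (Seq (Op v_cand Add v_tab v_ans) (Seq (Op v_cand Add v_cand v_size) (Seq (Op v_powcand Add v_ptab v_size)
         (Seq (amplified_search sw) (If v_found (Op v_ans Add v_ans v_size) Skip))))))"

definition max_search :: "bool \<Rightarrow> com" where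
  "max_search sw =
     Seq (Const v_ans 0) (Seq (Op v_size Add v_pw v_zero) (Seq (Op v_bits Add v_t v_zero)
       (For v_bb v_t (bit_step sw))))"

lemma modified_bit_step [simp]:
    "modified (bit_step sw) = {v_cond, v_x1, v_x2, v_x3, v_h, v_g, v_flag, v_meas, v_clean, v_found, v_test, v_iters, v_rep,
      v_p, v_nine, v_bound, v_round, v_size, v_bits, v_cand, v_powcand, v_ans}"
  and storefree_bit_step [simp]: "storefree (bit_step sw)"
  by (auto simp: bit_step_def)

lemma modified_max_search [simp]:
    "modified (max_search sw) = {v_cond, v_x1, v_x2, v_x3, v_h, v_g, v_flag, v_meas, v_clean, v_found, v_test, v_iters, v_rep,
      v_p, v_nine, v_bound, v_round, v_size, v_bits, v_cand, v_powcand, v_ans, v_bb}"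
  and storefree_max_search [simp]: "storefree (max_search sw)"
  by (auto simp: max_search_def)

context mw_input
begin

text \<open>The searches run over at most \<open>len - 1\<close> bits, hence the bound on
  \<open>b\<close>. Oddness is what \<open>zero_reflection\<close> tests, through bit 0 of register
  1.\<close>

definition pow_table :: "(nat \<Rightarrow> nat) \<Rightarrow> bool" where
  "pow_table m \<longleftrightarrow> (\<forall>b<len. \<forall>x<2 ^ b. odd (m (ptab + 2 ^ b + x)) \<longleftrightarrow> x = 0)"

definition hits :: "bool \<Rightarrow> (nat \<Rightarrow> nat) \<Rightarrow> nat \<Rightarrow> nat \<Rightarrow> nat set" where
  "hits sw m j t = {l. l < 2 ^ t \<and> ent (\<not> sw) j (take_bit w (m (tab + l)))}"

lemma sqrt_cost_mono: "b \<le> t \<Longrightarrow> sqrt_cost b \<le> sqrt_cost t"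
  unfolding sqrt_cost_def by (intro monoD[OF mono_floor_sqrt] mult_left_mono power_increasing) auto

text \<open>The part that holds surely: no search reports a phantom, so a positive answer never
  exceeds all hits.\<close>

definition search_inv :: "bool \<Rightarrow> (nat \<Rightarrow> nat) \<Rightarrow> nat \<Rightarrow> nat \<Rightarrow> nat \<Rightarrow> config \<Rightarrow> bool" where
  "search_inv sw m j t k s \<longleftrightarrow> blank (qst s) \<and> vars s v_bits = t - k \<and> vars s v_size = 2 ^ (t - k) \<and>
     2 ^ (t - k) dvd vars s v_ans \<and> vars s v_ans < 2 ^ t \<and>
     (vars s v_ans = 0 \<or> (\<exists>l\<in>hits sw m j t. vars s v_ans \<le> l))"

text \<open>The part that holds with high probability: a bound for the searches still to come, plus
  the indicator that some hit has been cut off above the current range.\<close>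

definition search_pot :: "bool \<Rightarrow> (nat \<Rightarrow> nat) \<Rightarrow> nat \<Rightarrow> nat \<Rightarrow> nat \<Rightarrow> config \<Rightarrow> ennreal" where
  "search_pot sw m j t k s =
     of_nat (t - k) * fail_prob + (if \<forall>l\<in>hits sw m j t. l < vars s v_ans + 2 ^ (t - k) then 0 else 1)"

lemma tab_bounds: "t \<le> len \<Longrightarrow> tab + 2 ^ t < 2 ^ w" "t \<le> len \<Longrightarrow> 2 ^ t dvd tab"
proof -
  assume t: "t \<le> len"
  have "(2::nat) ^ t \<le> 2 ^ (2 * len)" using t by (intro power_increasing) auto
  then have "tab + 2 ^ t \<le> 2 ^ (2 * len + 1)" by (simp add: tab_def)
  also have "(2::nat) ^ (2 * len + 1) < 2 ^ w" using len_pos by (intro power_strict_increasing) (auto simp: w_def)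
  finally show "tab + 2 ^ t < 2 ^ w" .
  show "2 ^ t dvd tab" unfolding tab_def using t by (intro le_imp_power_dvd) simp
qed

lemma bit_step_triple:
  assumes env: "env s" and inv: "search_inv sw m j t k s" and k: "k < t" "t \<le> len" and j: "vars s v_j = j" "j < 2 ^ w"
    and m: "mem s = m" "pow_table m"
  shows "triple w A B (bit_step sw) s (26 * w ^ 3 * sqrt_cost t)
    (search_inv sw m j t (Suc k)) (search_pot sw m j t (Suc k)) (search_pot sw m j t k s)"
proof -
  define b where "b = t - Suc k"
  have tb: "t - k = Suc b" "t - Suc k = b" "b < len" "b \<le> t" using k by (auto simp: b_def)
  define a where "a = vars s v_ans"
  have u: "blank (qst s)" and bits: "vars s v_bits = Suc b" and size: "vars s v_size = 2 ^ Suc b"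
    and advd: "2 ^ Suc b dvd a" and alt: "a < 2 ^ t" and ahit: "a = 0 \<or> (\<exists>l\<in>hits sw m j t. a \<le> l)"
    using inv unfolding search_inv_def tb a_def by simp_all
  \<comment> \<open>The current range does not cross the end of the list, since \<open>a\<close> and
    \<open>2 ^ t\<close> are both multiples of \<open>2 ^ Suc b\<close>.\<close>
  have ab: "a + 2 ^ Suc b \<le> 2 ^ t"
  proof -
    obtain y where y: "a = 2 ^ Suc b * y" using advd by blast
    have "Suc b \<le> t" using tb(1) by (metis diff_le_self)
    then have t: "(2::nat) ^ t = 2 ^ Suc b * 2 ^ (t - Suc b)" by (simp only: power_add[symmetric] le_add_diff_inverse)
    have "y < 2 ^ (t - Suc b)" using alt unfolding y t by simp
    then have "2 ^ Suc b * (y + 1) \<le> 2 ^ Suc b * 2 ^ (t - Suc b)" by (intro mult_left_mono) auto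
    then show ?thesis unfolding y t by simp
  qed
  have tw: "tab + 2 ^ t < 2 ^ w" using tab_bounds(1)[OF k(2)] .
  have lt: "tab + a < 2 ^ w" "tab + a + 2 ^ b < 2 ^ w" "(2::nat) ^ b < 2 ^ w" "ptab + 2 ^ b < 2 ^ w" "b < 2 ^ w" "a + 2 ^ b < 2 ^ w"
  proof -
    have p: "(2::nat) ^ b \<le> 2 ^ Suc b" by simp
    show "tab + a < 2 ^ w" "tab + a + 2 ^ b < 2 ^ w" "(2::nat) ^ b < 2 ^ w" "a + 2 ^ b < 2 ^ w"
      using ab tw p by linarith+
    show "ptab + 2 ^ b < 2 ^ w" using pow_bounds(2)[of b] tb by simp
    show "b < 2 ^ w" using \<open>b < len\<close> len_less_w by linarith
  qed
  define s5 where "s5 = tick (set_var v_powcand (ptab + 2 ^ b) (tick (set_var v_cand (tab + a + 2 ^ b)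
    (tick (set_var v_cand (tab + a) (tick (set_var v_bits b (tick (set_var v_size (2 ^ b) s)))))))))"
  have ex: "exec w A B (bit_step sw) s = exec w A B (Seq (amplified_search sw) (If v_found (Op v_ans Add v_ans v_size) Skip)) s5"
    unfolding bit_step_def exec_Seq_basic s5_def
    using env bits size lt by (simp add: take_bit_self a_def[symmetric] del: exec.simps)
  have env5: "env s5" using env by (simp add: s5_def)
  have s5: "vars s5 v_bits = b" "vars s5 v_size = 2 ^ b" "vars s5 v_cand = tab + a + 2 ^ b" "vars s5 v_powcand = ptab + 2 ^ b"
      "vars s5 v_ans = a" "vars s5 v_j = j" "mem s5 = m" "qst s5 = qst s" "time s5 = time s + 5"
    using j m by (simp_all add: s5_def a_def)
  have cdvd: "2 ^ b dvd tab + a + 2 ^ b"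
  proof -
    have "2 ^ b dvd a" using advd by (meson dvd_trans le_imp_power_dvd lessI less_imp_le)
    then show ?thesis using tab_bounds(2)[of b] tb by simp
  qed
  have ready: "search_ready s5"
    unfolding search_ready_def using env5 s5 lt cdvd tb j m by (simp add: pow_table_def)
  \<comment> \<open>Good elements correspond to hits in the upper half, which lies inside the list
    by \<open>ab\<close>.\<close>
  have G: "goods_of sw s5 > 0 \<longleftrightarrow> (\<exists>l\<in>hits sw m j t. a + 2 ^ b \<le> l \<and> l < a + 2 ^ Suc b)"
  proof -
    have "goods_of sw s5 > 0 \<longleftrightarrow> (\<exists>x<2 ^ b. ent (\<not> sw) j (take_bit w (m (tab + (a + 2 ^ b + x)))))"
      unfolding goods_iff[OF ready] s5 by (simp add: add.assoc)
    also have "\<dots> \<longleftrightarrow> (\<exists>x<2 ^ b. a + 2 ^ b + x \<in> hits sw m j t)"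
    proof -
      have "a + 2 ^ b + x < 2 ^ t" if "x < 2 ^ b" for x using ab that by simp
      then show ?thesis unfolding hits_def by blast
    qed
    also have "\<dots> \<longleftrightarrow> (\<exists>l\<in>hits sw m j t. a + 2 ^ b \<le> l \<and> l < a + 2 ^ Suc b)"
    proof
      assume "\<exists>l\<in>hits sw m j t. a + 2 ^ b \<le> l \<and> l < a + 2 ^ Suc b"
      then obtain l where l: "l \<in> hits sw m j t" "a + 2 ^ b \<le> l" "l < a + 2 ^ Suc b" by blast
      then have "l - (a + 2 ^ b) < 2 ^ b" "a + 2 ^ b + (l - (a + 2 ^ b)) = l" by auto
      with l(1) show "\<exists>x<2 ^ b. a + 2 ^ b + x \<in> hits sw m j t" by metis
    next
      assume "\<exists>x<2 ^ b. a + 2 ^ b + x \<in> hits sw m j t"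
      then obtain x where "x < 2 ^ b" "a + 2 ^ b + x \<in> hits sw m j t" by blast
      then show "\<exists>l\<in>hits sw m j t. a + 2 ^ b \<le> l \<and> l < a + 2 ^ Suc b"
        by (intro bexI[of _ "a + 2 ^ b + x"]) simp_all
    qed
    finally show ?thesis .
  qed
  let ?V = "\<lambda>s'. if vars s' v_found \<noteq> 0 \<or> goods_of sw s5 = 0 then 0 else 1 :: ennreal"
  let ?good = "\<forall>l\<in>hits sw m j t. l < a + 2 ^ Suc b"
  let ?K = "of_nat b * fail_prob + (if ?good then 0 else 1 :: ennreal)"
  have "triple w A B (amplified_search sw) s5 (25 * w ^ 3 * sqrt_cost b)
    (\<lambda>s'. blank (qst s') \<and> (vars s' v_found \<noteq> 0 \<longrightarrow> goods_of sw s5 > 0))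
    (\<lambda>s'. ?K + ?V s') (?K + fail_prob)"
    using triple_add[OF amplified_search_triple[OF ready, of sw]] u s5 by simp
  then have "triple w A B (Seq (amplified_search sw) (If v_found (Op v_ans Add v_ans v_size) Skip)) s5 (25 * w ^ 3 * sqrt_cost b + 2)
    (search_inv sw m j t (Suc k)) (search_pot sw m j t (Suc k)) (?K + fail_prob)"
  proof (rule triple_Seq)
    fix s6 assume fr: "frame (amplified_search sw) s5 s6"
      and Q: "blank (qst s6) \<and> (vars s6 v_found \<noteq> 0 \<longrightarrow> goods_of sw s5 > 0)"
    note e6 = env_step[OF fr env5]
    have s6: "vars s6 v_bits = b" "vars s6 v_size = 2 ^ b" "vars s6 v_ans = a"
      using e6 s5 by simp_all
    define s7 where "s7 = (if vars s6 v_found \<noteq> 0 then tick (set_var v_ans (a + 2 ^ b) (tick s6)) else tick (tick s6))"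
    have ex7: "exec w A B (If v_found (Op v_ans Add v_ans v_size) Skip) s6 = return_spmf s7"
      using s6 lt by (simp add: s7_def take_bit_self)
    have a7: "vars s7 v_ans = (if vars s6 v_found \<noteq> 0 then a + 2 ^ b else a)"
      and s7: "vars s7 v_bits = b" "vars s7 v_size = 2 ^ b" "qst s7 = qst s6" "time s7 = time s6 + 2"
      using s6 by (simp_all add: s7_def)
    have inv7: "search_inv sw m j t (Suc k) s7"
    proof -
      have d: "2 ^ b dvd a" using advd by (meson dvd_trans le_imp_power_dvd lessI less_imp_le)
      have l: "a + 2 ^ b < 2 ^ t"
      proof -
        have "(2::nat) ^ b < 2 ^ Suc b" by simp
        then show ?thesis using ab by linarith
      qed
      have "vars s6 v_found \<noteq> 0 \<Longrightarrow> \<exists>l\<in>hits sw m j t. a + 2 ^ b \<le> l" using Q G by auto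
      then show ?thesis
        unfolding search_inv_def tb using Q s7 a7 d l ahit alt by simp
    qed
    have pot: "search_pot sw m j t (Suc k) s7 \<le> ?K + ?V s6"
    proof -
      \<comment> \<open>A hit beyond the new range was either lost before or lies in the upper half
        that this search wrongly took for empty.\<close>
      have "(if \<forall>l\<in>hits sw m j t. l < vars s7 v_ans + 2 ^ b then 0 else 1 :: ennreal) \<le> (if ?good then 0 else 1) + ?V s6"
      proof (cases "?good \<and> (vars s6 v_found \<noteq> 0 \<or> goods_of sw s5 = 0)")
        case True
        then have "\<forall>l\<in>hits sw m j t. l < vars s7 v_ans + 2 ^ b"
          using G a7 by (cases "vars s6 v_found \<noteq> 0") (auto simp: not_le)
        then show ?thesis by simp
      next
        case False
        then have "1 \<le> (if ?good then 0 else 1) + ?V s6" by auto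
        then show ?thesis by (auto intro: order_trans)
      qed
      then show ?thesis unfolding search_pot_def tb add.assoc by (rule add_left_mono)
    qed
    show "triple w A B (If v_found (Op v_ans Add v_ans v_size) Skip) s6 2
      (search_inv sw m j t (Suc k)) (search_pot sw m j t (Suc k)) (?K + ?V s6)"
      unfolding triple_def ex7 using inv7 pot s7(4) by simp
  qed
  then have "triple w A B (bit_step sw) s (25 * w ^ 3 * sqrt_cost b + 2 + 5)
    (search_inv sw m j t (Suc k)) (search_pot sw m j t (Suc k)) (?K + fail_prob)"
    by (rule triple_step[OF ex s5(9)]) simp
  moreover have "25 * w ^ 3 * sqrt_cost b + 2 + 5 \<le> 26 * w ^ 3 * sqrt_cost t"
  proof -
    have "20 \<le> w" using len_pos by (simp add: w_def)
    then have "20 ^ 3 \<le> w ^ 3" by (rule power_mono) simp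
    then have "20 ^ 3 * 3 \<le> w ^ 3 * sqrt_cost t" using sqrt_cost_ge_3[of t] by (intro mult_mono) auto
    then have "24000 \<le> w ^ 3 * sqrt_cost t" by simp
    moreover have "w ^ 3 * sqrt_cost b \<le> w ^ 3 * sqrt_cost t" using sqrt_cost_mono[OF tb(4)] by (rule mult_left_mono) simp
    ultimately show ?thesis unfolding mult.assoc by linarith
  qed
  moreover have "?K + fail_prob \<le> search_pot sw m j t k s"
    unfolding search_pot_def tb a_def[symmetric] by (simp add: algebra_simps)
  ultimately show ?thesis by (rule triple_conseq) auto
qed

text \<open>The answer 0 is ambiguous: it also stands for an empty set of hits. The final query in
  \<open>cell\<close> decides between the two.\<close>

definition found_max :: "bool \<Rightarrow> (nat \<Rightarrow> nat) \<Rightarrow> nat \<Rightarrow> nat \<Rightarrow> nat \<Rightarrow> bool" where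
  "found_max sw m j t a \<longleftrightarrow> (if hits sw m j t = {} then a = 0 else a = Max (hits sw m j t))"

lemma finite_hits: "finite (hits sw m j t)"
  by (simp add: hits_def)

lemma max_search_triple:
  assumes env: "env s" and u: "blank (qst s)" and t: "vars s v_t = t" "t \<le> len" "vars s v_pw = 2 ^ t"
    and j: "vars s v_j = j" "j < 2 ^ w" and m: "mem s = m" "pow_table m"
  shows "triple w A B (max_search sw) s (2 * w ^ 4 * sqrt_cost t)
    (\<lambda>s'. blank (qst s') \<and> vars s' v_ans < 2 ^ t)
    (\<lambda>s'. if found_max sw m j t (vars s' v_ans) then 0 else 1) (of_nat len * fail_prob)"
proof -
  define s3 where "s3 = tick (set_var v_bits t (tick (set_var v_size (2 ^ t) (tick (set_var v_ans 0 s)))))"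
  have tw: "(2::nat) ^ t < 2 ^ w" "t < 2 ^ w"
    using tab_bounds(1)[OF t(2)] t(2) len_less_w by linarith+
  have ex: "exec w A B (max_search sw) s = exec w A B (For v_bb v_t (bit_step sw)) s3"
    unfolding max_search_def exec_Seq_basic s3_def using env t tw by (simp add: take_bit_self del: exec.simps)
  have env3: "env s3" using env by (simp add: s3_def)
  have s3: "vars s3 v_bits = t" "vars s3 v_size = 2 ^ t" "vars s3 v_ans = 0" "vars s3 v_j = j" "vars s3 v_t = t"
     "mem s3 = m" "qst s3 = qst s" "time s3 = time s + 3"
    using j m t by (simp_all add: s3_def)
  have "triple w A B (For v_bb v_t (bit_step sw)) s3 (3 + (\<Sum>k<t. 26 * w ^ 3 * sqrt_cost t + 3))
    (search_inv sw m j t t) (search_pot sw m j t t) (search_pot sw m j t 0 s3)"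
  proof (rule triple_For[where I = "search_inv sw m j t" and V = "search_pot sw m j t"
        and T = "\<lambda>_. 26 * w ^ 3 * sqrt_cost t", OF w_pos tw(2)])
    fix k s' assume k: "k < t" and I: "search_inv sw m j t k s'" and fr: "frame (For v_bb v_t (bit_step sw)) s3 s'"
    have "env s'" "vars s' v_j = j" "mem s' = m"
      using env_step[OF fr env3] s3 by simp_all
    then show "triple w A B (bit_step sw) s' (26 * w ^ 3 * sqrt_cost t)
      (search_inv sw m j t (Suc k)) (search_pot sw m j t (Suc k)) (search_pot sw m j t k s')"
      by (intro bit_step_triple I k t(2) j(2) m(2))
  next
    show "search_inv sw m j t k s'' \<and> search_pot sw m j t k s'' = search_pot sw m j t k s'"
      if "search_inv sw m j t k s'" "same_but {v_bb, v_cond} s' s''" for k s' s''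
      using that by (simp add: same_but_def search_inv_def search_pot_def)
  next
    show "search_inv sw m j t 0 s3" using s3 u by (simp add: search_inv_def)
  qed (use env3 s3 in simp_all)
  then have "triple w A B (max_search sw) s (3 + (\<Sum>k<t. 26 * w ^ 3 * sqrt_cost t + 3) + 3)
    (search_inv sw m j t t) (search_pot sw m j t t) (search_pot sw m j t 0 s3)"
    by (rule triple_step[OF ex s3(8)]) simp
  moreover have "3 + (\<Sum>k<t. 26 * w ^ 3 * sqrt_cost t + 3) + 3 \<le> 2 * w ^ 4 * sqrt_cost t"
  proof -
    have w: "20 \<le> w" "t * 20 \<le> w" using len_pos t(2) by (simp_all add: w_def)
    then have "20 ^ 3 \<le> w ^ 3" by (intro power_mono) auto
    then have P: "20 ^ 3 * 3 \<le> w ^ 3 * sqrt_cost t" using sqrt_cost_ge_3[of t] by (intro mult_mono) auto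
    define X where "X = w ^ 3 * sqrt_cost t"
    have P': "24000 \<le> X" using P by (simp add: X_def)
    have "3 + (\<Sum>k<t. 26 * w ^ 3 * sqrt_cost t + 3) + 3 = 6 + t * (26 * X + 3)" by (simp add: X_def)
    also have "\<dots> \<le> 6 + t * (27 * X)"
      using P' by (intro add_left_mono mult_left_mono) auto
    also have "\<dots> \<le> X + t * (27 * X)" using P' by simp
    also have "\<dots> = (1 + 7 * t) * X + (t * 20) * X" by (simp add: algebra_simps)
    also have "\<dots> \<le> w * X + w * X"
      using w by (intro add_mono mult_right_mono) auto
    also have "\<dots> = 2 * w ^ 4 * sqrt_cost t" by (simp add: X_def power4_eq_xxxx power3_eq_cube)
    finally show ?thesis .
  qed
  \<comment> \<open>Initially the range is the whole list, so the indicator is 0 and only the bounds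
    of the \<open>t\<close> searches remain.\<close>
  moreover have "search_pot sw m j t 0 s3 \<le> of_nat len * fail_prob"
  proof -
    have "search_pot sw m j t 0 s3 = of_nat t * fail_prob"
      using s3 by (simp add: search_pot_def hits_def)
    also have "\<dots> \<le> of_nat len * fail_prob" using t(2) by (intro mult_right_mono) auto
    finally show ?thesis .
  qed
  ultimately show ?thesis
  proof (rule triple_conseq)
    fix s' assume I: "search_inv sw m j t t s'"
    \<comment> \<open>After the last bit the range is a single position: no hit lies above it, and
      the sure invariant provides a hit not below it unless the answer is 0.\<close>
    have "found_max sw m j t (vars s' v_ans)" if all: "\<forall>l\<in>hits sw m j t. l < vars s' v_ans + 1"
    proof (cases "hits sw m j t = {}")
      case True
      then show ?thesis using I by (simp add: found_max_def search_inv_def)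
    next
      case False
      have le: "\<forall>l\<in>hits sw m j t. l \<le> vars s' v_ans" using all by auto
      have "vars s' v_ans \<in> hits sw m j t"
      proof (cases "vars s' v_ans = 0")
        case True
        then show ?thesis using False le by auto
      next
        case nz: False
        then obtain l where "l \<in> hits sw m j t" "vars s' v_ans \<le> l" using I by (auto simp: search_inv_def)
        then show ?thesis using le by (metis le_antisym)
      qed
      then have "Max (hits sw m j t) = vars s' v_ans"
        using le finite_hits by (intro Max_eqI) auto
      then show ?thesis using False by (simp add: found_max_def)
    qed
    then show "(blank (qst s') \<and> vars s' v_ans < 2 ^ t) \<and>
        (if found_max sw m j t (vars s' v_ans) then 0 else 1) \<le> search_pot sw m j t t s'"
      using I unfolding search_inv_def search_pot_def by auto
  qed
qed

end

section \<open>The whole program\<close>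

abbreviation (input) v_pos :: vname where "v_pos \<equiv> 80"

text \<open>The candidate is checked by one more query, since the answer 0 may mean that there is no
  hit at all. The value stored is the index plus one, as \<open>mw_output\<close> requires.\<close>

definition cell :: "bool \<Rightarrow> com" where
  "cell sw =
     Seq (max_search sw) (Seq (Op v_addr Add v_tab v_ans) (Seq (Load v_m v_addr) (Seq (query (\<not> sw) v_res v_j v_m)
       (Seq (If v_res (Op v_val Add v_m v_one) (Const v_val 0))
         (Seq (Op v_pos Mul (if sw then v_j else v_i) v_n) (Seq (Op v_pos Add v_pos (if sw then v_i else v_j))
           (Store v_pos v_val)))))))"

definition collect :: "bool \<Rightarrow> com" where
  "collect sw =
     Seq (Const v_cnt 0) (For v_k v_n (Seq (query sw v_res v_i v_k)
       (If v_res (Seq (Op v_addr Add v_tab v_cnt) (Seq (Store v_addr v_k) (Op v_cnt Add v_cnt v_one))) Skip)))"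

text \<open>The binary search needs a power of two as list length. \<open>len\<close> doubling steps
  suffice, because a row has at most \<open>n < 2 ^ len\<close> entries.\<close>

definition round_up :: com where
  "round_up =
     Seq (Const v_pw 1) (Seq (Const v_t 0) (For v_c v_len (Seq (Op v_tmp Less v_pw v_cnt)
       (If v_tmp (Seq (Op v_pw Add v_pw v_pw) (Op v_t Add v_t v_one)) Skip))))"

text \<open>The filler \<open>n\<close> is an index out of range, whose entry counts as 0, so padded
  positions are never hits.\<close>

definition pad :: com where
  "pad = For v_c v_pw (Seq (Op v_tmp Less v_c v_cnt)
     (If v_tmp Skip (Seq (Op v_addr Add v_tab v_c) (Store v_addr v_n))))"

definition row :: "bool \<Rightarrow> com" where
  "row sw = Seq (collect sw) (Seq round_up (Seq pad (For v_j v_n (cell sw))))"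

lemma modified_cell [simp]:
    "modified (cell sw) = {v_cond, v_x1, v_x2, v_x3, v_h, v_g, v_flag, v_meas, v_clean, v_found, v_test, v_iters, v_rep,
      v_p, v_nine, v_bound, v_round, v_size, v_bits, v_cand, v_powcand, v_ans, v_bb, v_addr, v_m, v_res, v_val, v_pos}"
  by (auto simp: cell_def)

lemma modified_collect [simp]:
    "modified (collect sw) = {v_cond, v_x1, v_x2, v_x3, v_k, v_cnt, v_res, v_addr}"
  by (auto simp: collect_def)

lemma modified_round_up [simp]: "modified round_up = {v_cond, v_pw, v_t, v_c, v_tmp}"
  and storefree_round_up [simp]: "storefree round_up"
  and classical_round_up [simp]: "classical round_up"
  by (auto simp: round_up_def)

lemma modified_pad [simp]: "modified pad = {v_cond, v_c, v_tmp, v_addr}"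
  and classical_pad [simp]: "classical pad"
  by (auto simp: pad_def)

lemma modified_row [simp]:
    "modified (row sw) = {v_cond, v_x1, v_x2, v_x3, v_h, v_g, v_flag, v_meas, v_clean, v_found, v_test, v_iters, v_rep,
      v_p, v_nine, v_bound, v_round, v_size, v_bits, v_cand, v_powcand, v_ans, v_bb, v_addr, v_m, v_res, v_val, v_pos,
      v_k, v_cnt, v_pw, v_t, v_c, v_tmp, v_j}"
  by (auto simp: row_def)

context mw_input
begin

definition common :: "bool \<Rightarrow> nat \<Rightarrow> nat \<Rightarrow> nat set" where
  "common sw i j = {k. k < n \<and> ent sw i k \<and> ent (\<not> sw) j k}"

definition best :: "bool \<Rightarrow> nat \<Rightarrow> nat \<Rightarrow> nat" where
  "best sw i j = (if common sw i j = {} then 0 else Max (common sw i j) + 1)"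

text \<open>With \<open>sw\<close> the product is transposed, so \<open>i\<close> is a column of the
  output.\<close>

definition pos :: "bool \<Rightarrow> nat \<Rightarrow> nat \<Rightarrow> nat" where
  "pos sw i j = (if sw then j * n + i else i * n + j)"

text \<open>Monotonicity is demanded only below a genuine index, which admits the constant padding
  at the end.\<close>

definition row_table :: "bool \<Rightarrow> (nat \<Rightarrow> nat) \<Rightarrow> nat \<Rightarrow> nat \<Rightarrow> bool" where
  "row_table sw m i t \<longleftrightarrow> (\<forall>l<2 ^ t. m (tab + l) \<le> n) \<and>
     (\<forall>l l'. l < l' \<longrightarrow> l' < 2 ^ t \<longrightarrow> m (tab + l') < n \<longrightarrow> m (tab + l) < m (tab + l')) \<and>
     (\<lambda>l. m (tab + l)) ` {..<2 ^ t} \<inter> {..<n} = {k. k < n \<and> ent sw i k}"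

lemma ent_less: "ent sw i j \<Longrightarrow> i < n \<and> j < n"
  using A B by (auto simp: ent_def entry_def split: if_splits)

text \<open>As the list increases, the last hit carries the largest common index.\<close>

lemma cell_value:
  assumes t: "row_table sw m i t" and f: "found_max sw m j t a"
  shows "(if ent (\<not> sw) j (m (tab + a)) then m (tab + a) + 1 else 0) = best sw i j"
proof -
  let ?f = "\<lambda>l. m (tab + l)" and ?H = "hits sw m j t"
  have n: "?f l \<le> n" if "l < 2 ^ t" for l using t that by (simp add: row_table_def)
  have hit: "l \<in> ?H \<longleftrightarrow> l < 2 ^ t \<and> ent (\<not> sw) j (?f l)" for l
  proof -
    have "take_bit w (?f l) = ?f l" if "l < 2 ^ t"
      using n[OF that] n_less_w by (intro take_bit_self) linarith
    then show ?thesis by (auto simp: hits_def)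
  qed
  have common: "common sw i j = ?f ` ?H"
  proof -
    have "(\<lambda>l. ?f l) ` {..<2 ^ t} \<inter> {..<n} = {k. k < n \<and> ent sw i k}" using t by (simp add: row_table_def)
    then have mem: "k \<in> ?f ` {..<2 ^ t} \<and> k < n \<longleftrightarrow> k < n \<and> ent sw i k" for k
      by (metis (no_types, lifting) IntD1 IntD2 IntI lessThan_iff mem_Collect_eq)
    show ?thesis
    proof (intro equalityI subsetI)
      fix k assume "k \<in> common sw i j"
      then have k: "k < n" "ent sw i k" "ent (\<not> sw) j k" by (auto simp: common_def)
      then have "k \<in> ?f ` {..<2 ^ t}" using mem[of k] by blast
      then obtain l where "l < 2 ^ t" "k = ?f l" by auto
      then show "k \<in> ?f ` ?H" using k(3) by (auto simp: hit)
    next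
      fix k assume "k \<in> ?f ` ?H"
      then obtain l where l: "l < 2 ^ t" "ent (\<not> sw) j (?f l)" "k = ?f l" by (auto simp: hit)
      then have "k < n" "k \<in> ?f ` {..<2 ^ t}" using ent_less by auto
      then show "k \<in> common sw i j" using mem[of k] l by (simp add: common_def)
    qed
  qed
  show ?thesis
  proof (cases "?H = {}")
    case True
    then have "a = 0" using f by (simp add: found_max_def)
    \<comment> \<open>Every list has a position 0, so without any hit the final query fails
      there.\<close>
    moreover have "0 \<notin> ?H" using True by simp
    ultimately have "\<not> ent (\<not> sw) j (?f a)" unfolding hit by simp
    then show ?thesis using True common by (simp add: best_def)
  next
    case False
    then have a: "a = Max ?H" using f by (simp add: found_max_def)
    have aH: "a \<in> ?H" unfolding a using False finite_hits by (rule Max_in[rotated])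
    have "Max (?f ` ?H) = ?f a"
    proof (rule Max_eqI)
      fix y assume "y \<in> ?f ` ?H"
      then obtain l where l: "l \<in> ?H" "y = ?f l" by blast
      have "l \<le> a" unfolding a using l finite_hits by (intro Max_ge)
      moreover have "a < 2 ^ t" "?f a < n" using aH ent_less[of "\<not> sw" j] unfolding hit by simp_all
      ultimately have "l = a \<or> ?f l < ?f a" using t unfolding row_table_def by (metis le_neq_implies_less)
      then show "y \<le> ?f a" using l by auto
    qed (use aH finite_hits in auto)
    then show ?thesis using False common aH hit by (simp add: best_def)
  qed
qed

text \<open>The output fits below \<open>tab\<close> because \<open>tab = 2 ^ len * 2 ^ len\<close>
  and \<open>n < 2 ^ len\<close>.\<close>

lemma pos_less:
  assumes "i < n" "j < n"
  shows "pos sw i j < tab" "tab < 2 ^ w" "i * n < 2 ^ w" "j * n < 2 ^ w" "pos sw i j < 2 ^ w"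
proof -
  have le: "a * n + b < n * n" if "a < n" "b < n" for a b
  proof -
    have "a * n + b < (a + 1) * n" using that by simp
    also have "\<dots> \<le> n * n" using that by (intro mult_right_mono) auto
    finally show ?thesis .
  qed
  have "n * n \<le> 2 ^ len * 2 ^ len" using n_less by (intro mult_mono) auto
  also have "\<dots> = tab" by (simp add: tab_def mult_2 power_add)
  finally have nn: "n * n \<le> tab" .
  show p: "pos sw i j < tab" using le[OF assms] le[OF assms(2,1)] nn by (simp add: pos_def)
  show t: "tab < 2 ^ w" using tab_bounds(1)[of 0] by simp
  show "i * n < 2 ^ w" "j * n < 2 ^ w" using le[OF assms] le[OF assms(2,1)] nn t by linarith+
  show "pos sw i j < 2 ^ w" using p t by simp
qed

text \<open>Only \<open>max_search\<close> can go wrong. Everything after it is deterministic, so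
  the failure indicator of the cell is bounded by that of the search.\<close>

lemma cell_triple:
  assumes env: "env s" and u: "blank (qst s)" and t: "vars s v_t = t" "t \<le> len" "vars s v_pw = 2 ^ t"
    and ij: "vars s v_i = i" "i < n" "vars s v_j = j" "j < n"
    and m: "mem s = m" "pow_table m" "row_table sw m i t"
  shows "triple w A B (cell sw) s (3 * w ^ 4 * sqrt_cost t)
    (\<lambda>s'. blank (qst s') \<and> (\<forall>a. a \<noteq> pos sw i j \<longrightarrow> mem s' a = m a))
    (\<lambda>s'. if mem s' (pos sw i j) = best sw i j then 0 else 1) (of_nat len * fail_prob)"
proof -
  have jw: "j < 2 ^ w" "i < 2 ^ w" using ij n_less_w by linarith+
  note pl = pos_less[OF ij(2,4)]
  have "triple w A B (cell sw) s (2 * w ^ 4 * sqrt_cost t + (60 * w + 7))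
    (\<lambda>s'. blank (qst s') \<and> (\<forall>a. a \<noteq> pos sw i j \<longrightarrow> mem s' a = m a))
    (\<lambda>s'. if mem s' (pos sw i j) = best sw i j then 0 else 1) (of_nat len * fail_prob)"
    unfolding cell_def
  proof (rule triple_Seq[OF max_search_triple[OF env u t ij(3) jw(1) m(1,2)]])
    fix s1 assume fr: "frame (max_search sw) s s1" and Q: "blank (qst s1) \<and> vars s1 v_ans < 2 ^ t"
    note e1 = env_step[OF fr env]
    define a where "a = vars s1 v_ans"
    define k where "k = m (tab + a)"
    have s1: "env s1" "vars s1 v_i = i" "vars s1 v_j = j" "mem s1 = m"
      using e1 ij m by simp_all
    have ta: "tab + a < 2 ^ w" using Q tab_bounds(1)[OF t(2)] unfolding a_def by linarith
    have kn: "k \<le> n" using Q m(3) unfolding row_table_def k_def a_def by blast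
    have kw: "k < 2 ^ w" "k + 1 < 2 ^ w"
    proof -
      have "(2::nat) ^ len + 1 \<le> tab + 2 ^ 0"
        unfolding tab_def by (simp add: power_increasing)
      then show "k + 1 < 2 ^ w" using kn n_less tab_bounds(1)[of 0] by simp
      then show "k < 2 ^ w" by simp
    qed
    show "triple w A B (Seq (Op v_addr Add v_tab v_ans) (Seq (Load v_m v_addr) (Seq (query (\<not> sw) v_res v_j v_m)
       (Seq (If v_res (Op v_val Add v_m v_one) (Const v_val 0))
         (Seq (Op v_pos Mul (if sw then v_j else v_i) v_n) (Seq (Op v_pos Add v_pos (if sw then v_i else v_j))
           (Store v_pos v_val))))))) s1 (60 * w + 7)
      (\<lambda>s'. blank (qst s') \<and> (\<forall>a. a \<noteq> pos sw i j \<longrightarrow> mem s' a = m a))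
      (\<lambda>s'. if mem s' (pos sw i j) = best sw i j then 0 else 1) (if found_max sw m j t (vars s1 v_ans) then 0 else 1)"
    proof (rule triple_det)
      define s3 where "s3 = tick (set_var v_m k (tick (set_var v_addr (tab + a) s1)))"
      have s3: "env s3" "vars s3 v_i = i" "vars s3 v_j = j" "mem s3 = m" "vars s3 v_m = k" "qst s3 = qst s1" "time s3 = time s1 + 2"
        using s1 by (simp_all add: s3_def)
      let ?d = "Seq (If v_res (Op v_val Add v_m v_one) (Const v_val 0))
         (Seq (Op v_pos Mul (if sw then v_j else v_i) v_n) (Seq (Op v_pos Add v_pos (if sw then v_i else v_j))
           (Store v_pos v_val)))"
      have ex: "exec w A B (Seq (Op v_addr Add v_tab v_ans) (Seq (Load v_m v_addr) (Seq (query (\<not> sw) v_res v_j v_m) ?d))) s1 =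
          exec w A B (Seq (query (\<not> sw) v_res v_j v_m) ?d) s3"
        unfolding exec_Seq_basic s3_def using s1 ta by (simp add: take_bit_self k_def a_def[symmetric] del: exec.simps)
      let ?r = "ent (\<not> sw) j k"
      let ?R = "\<lambda>s'. time s' \<le> time s1 + (60 * w + 7) \<and> (blank (qst s') \<and> (\<forall>a. a \<noteq> pos sw i j \<longrightarrow> mem s' a = m a)) \<and>
          (if mem s' (pos sw i j) = best sw i j then 0 else 1) \<le> (if found_max sw m j t (vars s1 v_ans) then 0 else 1 :: ennreal)"
      show "wp (exec w A B (Seq (Op v_addr Add v_tab v_ans) (Seq (Load v_m v_addr) (Seq (query (\<not> sw) v_res v_j v_m) ?d))) s1) ?R"
        unfolding ex
      proof (rule wp_seqI[OF query_wp[OF s3(1)]])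
        fix s4 assume f4: "frame (query (\<not> sw) v_res v_j v_m) s3 s4" and t4: "time s4 \<le> time s3 + 60 * w"
          and Q4: "blank (qst s4) \<and> vars s4 v_res = of_bool (ent (\<not> sw) (vars s3 v_j) (vars s3 v_m))"
        have s4: "env s4" "vars s4 v_i = i" "vars s4 v_j = j" "mem s4 = m" "vars s4 v_m = k"
          using env_step[OF f4 s3(1)] s3 by simp_all
        have r4: "vars s4 v_res = of_bool ?r" using Q4 s3 by simp
        define v where "v = (if ?r then k + 1 else 0)"
        define s5 where "s5 = tick (set_var v_val v (tick s4))"
        define s8 where "s8 = tick ((tick (set_var v_pos (pos sw i j) (tick (set_var v_pos ((if sw then j else i) * n) s5))))
           \<lparr>mem := m(pos sw i j := v)\<rparr>)"
        have s5: "env s5" "vars s5 v_i = i" "vars s5 v_j = j" "mem s5 = m" "vars s5 v_val = v"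
          using s4 by (simp_all add: s5_def)
        have "exec w A B (If v_res (Op v_val Add v_m v_one) (Const v_val 0)) s4 = return_spmf s5"
          using r4 s4 kw by (cases ?r) (simp_all add: s5_def v_def take_bit_self)
        then have "exec w A B ?d s4 = exec w A B (Seq (Op v_pos Mul (if sw then v_j else v_i) v_n)
            (Seq (Op v_pos Add v_pos (if sw then v_i else v_j)) (Store v_pos v_val))) s5"
          by (simp only: exec.simps(8) return_bind_spmf)
        also have "\<dots> = return_spmf s8"
        proof -
          have "take_bit w (pos sw i j) = pos sw i j" "take_bit w (i * n) = i * n" "take_bit w (j * n) = j * n"
            using pl(3,4) pl(5)[of sw] by (simp_all only: take_bit_self)
          then show ?thesis
            unfolding exec_Seq_basic s8_def using s5 by (cases sw) (simp_all add: pos_def)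
        qed
        finally have "exec w A B ?d s4 = return_spmf s8" .
        moreover have "?R s8"
        proof -
          have "mem s8 = m(pos sw i j := v)" "qst s8 = qst s4" "time s8 = time s4 + 5"
            by (simp_all add: s8_def s5_def)
          moreover have "v = best sw i j" if "found_max sw m j t (vars s1 v_ans)"
            unfolding v_def k_def a_def by (rule cell_value[OF m(3) that])
          ultimately show ?thesis using Q4 t4 s3 by auto
        qed
        ultimately show "wp (exec w A B ?d s4) ?R" by simp
      qed (use s3 Q jw kw in simp_all)
    qed
  qed
  moreover have "2 * w ^ 4 * sqrt_cost t + (60 * w + 7) \<le> 3 * w ^ 4 * sqrt_cost t"
  proof -
    have w: "20 \<le> w" using len_pos by (simp add: w_def)
    then have "20 ^ 3 \<le> w ^ 3" by (intro power_mono) auto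
    then have "w * (20 ^ 3 * 3) \<le> w * (w ^ 3 * sqrt_cost t)" using sqrt_cost_ge_3[of t] by (intro mult_mono) auto
    then have "24000 * w \<le> w ^ 4 * sqrt_cost t" by (simp add: power4_eq_xxxx power3_eq_cube mult_ac)
    then show ?thesis using w unfolding mult.assoc by linarith
  qed
  ultimately show ?thesis by (rule triple_conseq) auto
qed

text \<open>The last clause secures the output of earlier rows and the power table.\<close>

definition collected :: "bool \<Rightarrow> nat \<Rightarrow> (nat \<Rightarrow> nat) \<Rightarrow> nat \<Rightarrow> config \<Rightarrow> bool" where
  "collected sw i m k s \<longleftrightarrow> blank (qst s) \<and> vars s v_cnt \<le> k \<and>
     (\<forall>l l'. l < l' \<longrightarrow> l' < vars s v_cnt \<longrightarrow> mem s (tab + l) < mem s (tab + l')) \<and>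
     (\<lambda>l. mem s (tab + l)) ` {..<vars s v_cnt} = {k'. k' < k \<and> ent sw i k'} \<and>
     (\<forall>a. a \<notin> {tab..<tab + vars s v_cnt} \<longrightarrow> mem s a = m a)"

lemma tab_small: "l \<le> n \<Longrightarrow> tab + l < 2 ^ w"
  using tab_bounds(1)[of len] n_less by simp

lemma collect_wp:
  assumes env: "env s" and u: "blank (qst s)" and i: "vars s v_i = i" "i < n"
  shows "wp (exec w A B (collect sw) s) (\<lambda>s'. time s' \<le> time s + (n * 63 * w + 4) \<and> collected sw i (mem s) n s')"
proof -
  let ?m = "mem s"
  let ?c = "Seq (query sw v_res v_i v_k)
       (If v_res (Seq (Op v_addr Add v_tab v_cnt) (Seq (Store v_addr v_k) (Op v_cnt Add v_cnt v_one))) Skip)"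
  define s1 where "s1 = tick (set_var v_cnt 0 s)"
  have s1: "env s1" "vars s1 v_i = i" "vars s1 v_cnt = 0" "mem s1 = ?m" "qst s1 = qst s" "time s1 = time s + 1"
    using env i by (simp_all add: s1_def)
  have ex: "exec w A B (collect sw) s = exec w A B (For v_k v_n ?c) s1"
    unfolding collect_def exec_Seq_basic s1_def by (simp del: exec.simps)
  have w20: "20 \<le> w" using len_pos by (simp add: w_def)
  have "wp (exec w A B (For v_k v_n ?c) s1) (\<lambda>s'. time s' \<le> time s1 + (3 + n * ((60 * w + 4) + 3)) \<and> collected sw i ?m n s')"
  proof (rule wp_For[where I = "collected sw i ?m" and T = "60 * w + 4", OF w_pos n_less_w])
    fix k s' assume k: "k < n" and I: "collected sw i ?m k s'" and vk: "vars s' v_k = k" and fr: "frame (For v_k v_n ?c) s1 s'"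
    have s': "env s'" "vars s' v_i = i"
      using env_step[OF fr s1(1)] s1 by simp_all
    have u': "blank (qst s')" using I by (simp add: collected_def)
    show "wp (exec w A B ?c s') (\<lambda>s''. time s'' \<le> time s' + (60 * w + 4) \<and> collected sw i ?m (Suc k) s'')"
    proof (rule wp_seqI[OF query_wp[OF s'(1) u']])
      fix s2 assume f2: "frame (query sw v_res v_i v_k) s' s2" and t2: "time s2 \<le> time s' + 60 * w"
        and Q: "blank (qst s2) \<and> vars s2 v_res = of_bool (ent sw (vars s' v_i) (vars s' v_k))"
      define c where "c = vars s' v_cnt"
      have s2: "env s2" "vars s2 v_cnt = c" "vars s2 v_k = k" "mem s2 = mem s'"
        using env_step[OF f2 s'(1)] vk by (simp_all add: c_def)
      have c: "c \<le> k" and inc: "\<And>l l'. l < l' \<Longrightarrow> l' < c \<Longrightarrow> mem s' (tab + l) < mem s' (tab + l')"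
        and img: "(\<lambda>l. mem s' (tab + l)) ` {..<c} = {k'. k' < k \<and> ent sw i k'}"
        and out: "\<And>a. a \<notin> {tab..<tab + c} \<Longrightarrow> mem s' a = ?m a"
        using I unfolding collected_def c_def by blast+
      show "wp (exec w A B (If v_res (Seq (Op v_addr Add v_tab v_cnt) (Seq (Store v_addr v_k) (Op v_cnt Add v_cnt v_one))) Skip) s2)
        (\<lambda>s''. time s'' \<le> time s' + (60 * w + 4) \<and> collected sw i ?m (Suc k) s'')"
      proof (cases "ent sw i k")
        case False
        then have r: "vars s2 v_res = 0" using Q s' vk by simp
        have "{k'. k' < Suc k \<and> ent sw i k'} = {k'. k' < k \<and> ent sw i k'}" using False by (auto simp: less_Suc_eq)
        then have "collected sw i ?m (Suc k) (tick (tick s2))"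
          using I Q s2 unfolding collected_def c_def by simp
        then show ?thesis using r t2 by simp
      next
        case True
        then have r: "vars s2 v_res = 1" using Q s' vk by simp
        have tc: "take_bit w (tab + c) = tab + c" "take_bit w (Suc c) = Suc c"
          using tab_small[of c] c k n_less_w by (auto intro!: take_bit_self)
        define s5 where "s5 = tick (set_var v_cnt (Suc c) (tick (tick (set_var v_addr (tab + c) (tick s2))\<lparr>mem := (mem s')(tab + c := k)\<rparr>)))"
        have ex5: "exec w A B (If v_res (Seq (Op v_addr Add v_tab v_cnt) (Seq (Store v_addr v_k) (Op v_cnt Add v_cnt v_one))) Skip) s2
            = return_spmf s5"
          using r s2 tc by (simp add: s5_def)
        have s5: "vars s5 v_cnt = Suc c" "mem s5 = (mem s')(tab + c := k)" "qst s5 = qst s2" "time s5 = time s2 + 4"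
          by (simp_all add: s5_def)
        have "collected sw i ?m (Suc k) s5"
          unfolding collected_def s5
        proof (intro conjI allI impI)
          fix l l' assume l: "l < l'" "l' < Suc c"
          show "((mem s')(tab + c := k)) (tab + l) < ((mem s')(tab + c := k)) (tab + l')"
          proof (cases "l' = c")
            case True
            then have "l < c" using l by simp
            then have "mem s' (tab + l) \<in> (\<lambda>l. mem s' (tab + l)) ` {..<c}" by simp
            then have "mem s' (tab + l) < k" unfolding img by simp
            then show ?thesis using True l by simp
          next
            case False
            then show ?thesis using l inc by simp
          qed
        next
          have "(\<lambda>l. ((mem s')(tab + c := k)) (tab + l)) ` {..<Suc c} = insert k ((\<lambda>l. mem s' (tab + l)) ` {..<c})"
            by (auto simp: lessThan_Suc)
          also have "\<dots> = {k'. k' < Suc k \<and> ent sw i k'}" unfolding img using True by (auto simp: less_Suc_eq)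
          finally show "(\<lambda>l. ((mem s')(tab + c := k)) (tab + l)) ` {..<Suc c} = {k'. k' < Suc k \<and> ent sw i k'}" .
        next
          fix a assume "a \<notin> {tab..<tab + Suc c}"
          then show "((mem s')(tab + c := k)) a = ?m a" using out[of a] by auto
        qed (use Q c in auto)
        then show ?thesis unfolding ex5 using t2 s5(4) by simp
      qed
    qed (use s' vk k i n_less_w in simp_all)
  next
    show "collected sw i ?m k s''" if "collected sw i ?m k s'" "same_but {v_k, v_cond} s' s''" for k s' s''
      using that by (simp add: same_but_def collected_def)
  next
    show "collected sw i ?m 0 s1" using s1 u by (simp add: collected_def)
  qed (use s1 in simp_all)
  then show ?thesis
    unfolding ex
  proof (rule wp_mono)
    fix s' assume "time s' \<le> time s1 + (3 + n * (60 * w + 4 + 3)) \<and> collected sw i ?m n s'"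
    moreover have "n * (60 * w + 4 + 3) \<le> n * (63 * w)" using w20 by (intro mult_left_mono) auto
    ultimately show "time s' \<le> time s + (n * 63 * w + 4) \<and> collected sw i ?m n s'" using s1(6) unfolding mult.assoc by linarith
  qed
qed

text \<open>The last disjunct keeps the padded length within a factor 2 of the number of entries, on
  which the cost of the row has to depend.\<close>

lemma round_up_wp:
  assumes env: "env s" and c: "vars s v_cnt = c" "c \<le> n"
  shows "wp (exec w A B round_up s) (\<lambda>s'. time s' \<le> time s + (5 + len * 7) \<and>
    vars s' v_pw = 2 ^ vars s' v_t \<and> vars s' v_t \<le> len \<and> c \<le> vars s' v_pw \<and> (vars s' v_pw < 2 * c \<or> vars s' v_t = 0))"
proof -
  let ?c = "Seq (Op v_tmp Less v_pw v_cnt) (If v_tmp (Seq (Op v_pw Add v_pw v_pw) (Op v_t Add v_t v_one)) Skip)"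
  define s2 where "s2 = tick (set_var v_t 0 (tick (set_var v_pw 1 s)))"
  have s2: "env s2" "vars s2 v_cnt = c" "vars s2 v_pw = 1" "vars s2 v_t = 0" "time s2 = time s + 2"
    using env c by (simp_all add: s2_def)
  have ex: "exec w A B round_up s = exec w A B (For v_c v_len ?c) s2"
    unfolding round_up_def exec_Seq_basic s2_def using w_pos by (simp del: exec.simps)
  \<comment> \<open>The last clause says that doubling has never paused while the length is too
    small; after \<open>len\<close> rounds this would mean \<open>2 ^ len < c\<close>, which is
    impossible.\<close>
  define I where "I = (\<lambda>k (s'::config). vars s' v_pw = 2 ^ vars s' v_t \<and> vars s' v_t \<le> k \<and> (vars s' v_pw < 2 * c \<or> vars s' v_t = 0) \<and>
      (vars s' v_pw < c \<longrightarrow> vars s' v_t = k))"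
  have lw: "len < 2 ^ w" using len_less_w by simp
  have "wp (exec w A B (For v_c v_len ?c) s2) (\<lambda>s'. time s' \<le> time s2 + (3 + len * (4 + 3)) \<and> I len s')"
  proof (rule wp_For[where I = I and T = 4, OF w_pos lw])
    fix k s' assume k: "k < len" and I: "I k s'" and fr: "frame (For v_c v_len ?c) s2 s'"
    have s': "env s'" "vars s' v_cnt = c" using env_step[OF fr s2(1)] s2 by simp_all
    show "wp (exec w A B ?c s') (\<lambda>s''. time s'' \<le> time s' + 4 \<and> I (Suc k) s'')"
    proof (cases "vars s' v_pw < c")
      case True
      then have t: "vars s' v_t = k" "vars s' v_pw = 2 ^ k" using I by (auto simp: I_def)
      have "(2::nat) ^ k + 2 ^ k = 2 ^ Suc k" by simp
      also have "\<dots> \<le> 2 ^ len" using k by (intro power_increasing) auto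
      also have "\<dots> < 2 ^ w" using tab_bounds(1)[of len] by linarith
      finally have a: "take_bit w (2 ^ k + 2 ^ k) = (2 ^ k + 2 ^ k :: nat)" "take_bit w (Suc k) = Suc k"
        using k lw by (auto intro!: take_bit_self)
      show ?thesis using True t a s' w_pos by (simp add: I_def)
    next
      case False
      then show ?thesis using I s' w_pos by (auto simp: I_def)
    qed
  next
    show "I k s''" if "I k s'" "same_but {v_c, v_cond} s' s''" for k s' s''
      using that by (auto simp: same_but_def I_def)
  qed (use s2 in \<open>simp_all add: I_def\<close>)
  then show ?thesis
    unfolding ex
  proof (rule wp_mono)
    fix s' assume I: "time s' \<le> time s2 + (3 + len * (4 + 3)) \<and> I len s'"
    have "c \<le> vars s' v_pw"
    proof (rule ccontr)
      assume "\<not> c \<le> vars s' v_pw"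
      then have "vars s' v_pw = 2 ^ len" using I by (simp add: I_def)
      then show False using \<open>\<not> c \<le> vars s' v_pw\<close> c(2) n_less by simp
    qed
    then show "time s' \<le> time s + (5 + len * 7) \<and> vars s' v_pw = 2 ^ vars s' v_t \<and> vars s' v_t \<le> len \<and>
      c \<le> vars s' v_pw \<and> (vars s' v_pw < 2 * c \<or> vars s' v_t = 0)"
      using I s2(5) by (auto simp: I_def)
  qed
qed

lemma pad_wp:
  assumes env: "env s" and c: "vars s v_cnt = c" and p: "vars s v_pw = 2 ^ t" "t \<le> len"
  shows "wp (exec w A B pad s) (\<lambda>s'. time s' \<le> time s + (3 + 2 ^ t * 7) \<and>
    (\<forall>l. c \<le> l \<and> l < 2 ^ t \<longrightarrow> mem s' (tab + l) = n) \<and> (\<forall>a. a \<notin> {tab + c..<tab + 2 ^ t} \<longrightarrow> mem s' a = mem s a))"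
proof -
  let ?c = "Seq (Op v_tmp Less v_c v_cnt) (If v_tmp Skip (Seq (Op v_addr Add v_tab v_c) (Store v_addr v_n)))"
  define I where "I = (\<lambda>k (s'::config). (\<forall>l. c \<le> l \<and> l < k \<longrightarrow> mem s' (tab + l) = n) \<and>
    (\<forall>a. a \<notin> {tab + c..<tab + k} \<longrightarrow> mem s' a = mem s a))"
  have tw: "(2::nat) ^ t < 2 ^ w" using tab_bounds(1)[OF p(2)] by linarith
  have "wp (exec w A B (For v_c v_pw ?c) s) (\<lambda>s'. time s' \<le> time s + (3 + 2 ^ t * (4 + 3)) \<and> I (2 ^ t) s')"
  proof (rule wp_For[where I = I and T = 4, OF w_pos tw])
    fix k s' assume k: "k < 2 ^ t" and I: "I k s'" and v: "vars s' v_c = k" and fr: "frame (For v_c v_pw ?c) s s'"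
    have s': "env s'" "vars s' v_cnt = c" using env_step[OF fr env] c by simp_all
    have tk: "take_bit w (tab + k) = tab + k" using tab_bounds(1)[OF p(2)] k by (intro take_bit_self) simp
    show "wp (exec w A B ?c s') (\<lambda>s''. time s'' \<le> time s' + 4 \<and> I (Suc k) s'')"
    proof (cases "k < c")
      case True
      then show ?thesis using I s' v w_pos by (simp add: I_def)
    next
      case False
      then show ?thesis using I s' v tk by (auto simp: I_def less_Suc_eq)
    qed
  next
    show "I k s''" if "I k s'" "same_but {v_c, v_cond} s' s''" for k s' s''
      using that by (simp add: same_but_def I_def)
  qed (use env p in \<open>simp_all add: I_def\<close>)
  then show ?thesis unfolding pad_def by (rule wp_mono) (simp add: I_def)
qed

section \<open>Correctness and cost of one row\<close>

definition deg :: "bool \<Rightarrow> nat \<Rightarrow> nat" where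
  "deg sw i = card {k. k < n \<and> ent sw i k}"

text \<open>\<open>18 * (deg sw i + 1)\<close> is 9 times the bound
  \<open>2 * (deg sw i + 1)\<close> on the padded length, so this dominates
  \<open>sqrt_cost\<close>; the summand 1 is due to empty rows.\<close>

definition row_cost :: "bool \<Rightarrow> nat \<Rightarrow> nat" where
  "row_cost sw i = floor_sqrt (18 * (deg sw i + 1))"

definition table_wp :: "bool \<Rightarrow> nat \<Rightarrow> (nat \<Rightarrow> nat) \<Rightarrow> config \<Rightarrow> bool" where
  "table_wp sw i m s \<longleftrightarrow> blank (qst s) \<and> vars s v_t \<le> len \<and> vars s v_pw = 2 ^ vars s v_t \<and>
     2 ^ vars s v_t \<le> 2 * (deg sw i + 1) \<and> row_table sw (mem s) i (vars s v_t) \<and>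
     (\<forall>a. a \<notin> {tab..<tab + 2 ^ len} \<longrightarrow> mem s a = m a)"

lemma row_table_built:
  assumes col: "collected sw i m n s1" and m2: "\<forall>l. vars s1 v_cnt \<le> l \<and> l < 2 ^ t \<longrightarrow> m' (tab + l) = n"
    and m2': "\<forall>a. a \<notin> {tab + vars s1 v_cnt..<tab + 2 ^ t} \<longrightarrow> m' a = mem s1 a" and ct: "vars s1 v_cnt \<le> 2 ^ t"
  shows "row_table sw m' i t" "vars s1 v_cnt = deg sw i"
proof -
  let ?c = "vars s1 v_cnt" and ?f = "\<lambda>l. mem s1 (tab + l)"
  have inc: "\<And>l l'. l < l' \<Longrightarrow> l' < ?c \<Longrightarrow> ?f l < ?f l'" and img: "?f ` {..<?c} = {k'. k' < n \<and> ent sw i k'}"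
    using col unfolding collected_def by metis+
  have low: "m' (tab + l) = ?f l" if "l < ?c" for l using m2' that by simp
  have high: "m' (tab + l) = n" if "?c \<le> l" "l < 2 ^ t" for l using m2 that by simp
  have fn: "?f l < n" if "l < ?c" for l
  proof -
    have "?f l \<in> ?f ` {..<?c}" using that by simp
    then show ?thesis unfolding img by simp
  qed
  show "row_table sw m' i t"
    unfolding row_table_def
  proof (intro conjI allI impI)
    fix l assume "l < (2::nat) ^ t"
    then show "m' (tab + l) \<le> n" using low[of l] high[of l] fn[of l] by (cases "l < ?c") simp_all
  next
    fix l l' assume l: "l < l'" "l' < 2 ^ t" "m' (tab + l') < n"
    then have "l' < ?c" using high[of l'] by (cases "l' < ?c") simp_all
    then show "m' (tab + l) < m' (tab + l')" using low l inc by simp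
  next
    have "(\<lambda>l. m' (tab + l)) ` {..<2 ^ t} \<inter> {..<n} = ?f ` {..<?c}"
    proof (intro equalityI subsetI)
      fix y assume "y \<in> (\<lambda>l. m' (tab + l)) ` {..<2 ^ t} \<inter> {..<n}"
      then obtain l where l: "l < 2 ^ t" "y = m' (tab + l)" "y < n" by auto
      then have "l < ?c" using high[of l] by (cases "l < ?c") simp_all
      then show "y \<in> ?f ` {..<?c}" using low l by simp
    next
      fix y assume "y \<in> ?f ` {..<?c}"
      then obtain l where l: "l < ?c" "y = ?f l" by auto
      then have "y = m' (tab + l)" "l < 2 ^ t" "y < n" using low fn ct by simp_all
      then show "y \<in> (\<lambda>l. m' (tab + l)) ` {..<2 ^ t} \<inter> {..<n}" by simp
    qed
    then show "(\<lambda>l. m' (tab + l)) ` {..<2 ^ t} \<inter> {..<n} = {k. k < n \<and> ent sw i k}" using img by simp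
  qed
  \<comment> \<open>A strictly increasing list has no repetitions, so the counter equals the number
    of entries.\<close>
  have "inj_on ?f {..<?c}"
  proof (rule inj_onI)
    fix x y assume xy: "x \<in> {..<?c}" "y \<in> {..<?c}" "?f x = ?f y"
    show "x = y"
    proof (rule ccontr)
      assume "x \<noteq> y"
      then have "x < y \<or> y < x" by linarith
      then show False using inc[of x y] inc[of y x] xy by auto
    qed
  qed
  from card_image[OF this] show "?c = deg sw i" unfolding img deg_def by simp
qed

lemma table_wp:
  assumes env: "env s" and u: "blank (qst s)" and i: "vars s v_i = i" "i < n"
  shows "wp (exec w A B (Seq (collect sw) (Seq round_up pad)) s) (\<lambda>s'. time s' \<le> time s + n * 80 * w \<and> table_wp sw i (mem s) s')"
proof (rule wp_seqI[OF collect_wp[OF env u i]])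
  fix s1 assume f1: "frame (collect sw) s s1" and t1: "time s1 \<le> time s + (n * 63 * w + 4)" and col: "collected sw i (mem s) n s1"
  let ?c = "vars s1 v_cnt"
  have e1: "env s1" using env_step[OF f1 env] by simp
  have u1: "blank (qst s1)" and cn: "?c \<le> n" and out1: "\<forall>a. a \<notin> {tab..<tab + ?c} \<longrightarrow> mem s1 a = mem s a"
    using col unfolding collected_def by metis+
  show "wp (exec w A B (Seq round_up pad) s1) (\<lambda>s'. time s' \<le> time s + n * 80 * w \<and> table_wp sw i (mem s) s')"
  proof (rule wp_seqI[OF round_up_wp[OF e1 refl cn]])
    fix s2 assume f2: "frame round_up s1 s2" and t2: "time s2 \<le> time s1 + (5 + len * 7)"
      and Q2: "vars s2 v_pw = 2 ^ vars s2 v_t \<and> vars s2 v_t \<le> len \<and> ?c \<le> vars s2 v_pw \<and> (vars s2 v_pw < 2 * ?c \<or> vars s2 v_t = 0)"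
    define t where "t = vars s2 v_t"
    have e2: "env s2" "vars s2 v_cnt = ?c" "mem s2 = mem s1" using env_step[OF f2 e1] by simp_all
    have q2: "qst s2 = qst s1" using f2 by (simp add: frame_def)
    have p2: "vars s2 v_pw = 2 ^ t" "t \<le> len" "?c \<le> 2 ^ t" using Q2 by (auto simp: t_def)
    have bound: "2 ^ t < 2 * ?c \<or> t = 0" using Q2 by (auto simp: t_def)
    show "wp (exec w A B pad s2) (\<lambda>s'. time s' \<le> time s + n * 80 * w \<and> table_wp sw i (mem s) s')"
    proof (rule wp_lastI[OF pad_wp[OF e2(1,2) p2(1,2)]])
      fix s3 assume f3: "frame pad s2 s3" and t3: "time s3 \<le> time s2 + (3 + 2 ^ t * 7)"
        and Q3: "(\<forall>l. ?c \<le> l \<and> l < 2 ^ t \<longrightarrow> mem s3 (tab + l) = n) \<and> (\<forall>a. a \<notin> {tab + ?c..<tab + 2 ^ t} \<longrightarrow> mem s3 a = mem s2 a)"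
      have v3: "vars s3 v_pw = 2 ^ t" "vars s3 v_t = t" using env_step[OF f3 e2(1)] p2(1) by (simp_all add: t_def)
      have q3: "qst s3 = qst s1" using f3 q2 by (simp add: frame_def)
      note built = row_table_built[OF col Q3[THEN conjunct1] Q3[THEN conjunct2, unfolded e2(3)] p2(3)]
      have tl: "(2::nat) ^ t \<le> 2 ^ len" using p2(2) by simp
      have out: "mem s3 a = mem s a" if "a \<notin> {tab..<tab + 2 ^ len}" for a
      proof -
        have "a \<notin> {tab + ?c..<tab + 2 ^ t}" "a \<notin> {tab..<tab + ?c}"
          using that tl p2(3) unfolding atLeastLessThan_iff by linarith+
        then show ?thesis using Q3 e2(3) out1 by simp
      qed
      have d: "2 ^ t \<le> 2 * (deg sw i + 1)" using bound built(2) by auto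
      have "time s3 \<le> time s + n * 80 * w"
      proof -
        have w20: "20 \<le> w" "len * 20 = w" using len_pos by (simp_all add: w_def)
        have "deg sw i \<le> n" using cn built(2) by simp
        have "2 ^ t \<le> 2 * n" using bound cn n_pos by auto
        then have "time s3 \<le> time s + n * 63 * w + 12 + len * 7 + 14 * n" using t1 t2 t3 by simp
        also have "\<dots> \<le> time s + n * 63 * w + w + w + n * w"
          using w20 by (intro add_mono) auto
        also have "\<dots> \<le> time s + n * 63 * w + n * w + n * w + n * w" using n_pos by (intro add_mono) auto
        also have "\<dots> \<le> time s + n * 80 * w" by simp
        finally show ?thesis .
      qed
      then show "time s3 \<le> time s + n * 80 * w \<and> table_wp sw i (mem s) s3"
        unfolding table_wp_def using v3 q3 u1 built(1) d p2 out by simp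
    qed
  qed
qed

lemma pow_table_cong: "pow_table m \<Longrightarrow> (\<And>a. ptab \<le> a \<Longrightarrow> m' a = m a) \<Longrightarrow> pow_table m'"
  by (simp add: pow_table_def)

lemma row_table_cong: "row_table sw m i t \<Longrightarrow> (\<And>a. tab \<le> a \<Longrightarrow> m' a = m a) \<Longrightarrow> row_table sw m' i t"
  by (simp add: row_table_def)

lemma tab_len_le: "tab + 2 ^ len \<le> ptab"
proof -
  have "(2::nat) ^ len \<le> tab" unfolding tab_def by (intro power_increasing) auto
  then show ?thesis by (simp add: ptab_def)
qed

definition row_ok :: "bool \<Rightarrow> (nat \<Rightarrow> nat) \<Rightarrow> nat \<Rightarrow> nat \<Rightarrow> bool" where
  "row_ok sw m i k \<longleftrightarrow> (\<forall>j<k. m (pos sw i j) = best sw i j)"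

lemma pos_inj: "i < n \<Longrightarrow> j < n \<Longrightarrow> i' < n \<Longrightarrow> j' < n \<Longrightarrow> pos sw i j = pos sw i' j' \<longleftrightarrow> i = i' \<and> j = j'"
proof -
  have *: "a = a' \<and> b = b'" if "a * n + b = a' * n + b'" "b < n" "b' < n" for a b a' b'
  proof -
    have "(a * n + b) div n = (a' * n + b') div n" "(a * n + b) mod n = (a' * n + b') mod n" using that(1) by simp_all
    then show ?thesis using that(2,3) by simp
  qed
  assume ij: "i < n" "j < n" "i' < n" "j' < n"
  show "pos sw i j = pos sw i' j' \<longleftrightarrow> i = i' \<and> j = j'"
    using *[of i j i' j'] *[of j i j' i'] ij by (cases sw) (auto simp: pos_def)
qed

text \<open>The outputs are stored below \<open>tab\<close>, so they destroy neither the list nor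
  the power table; the failure bounds of the \<open>n\<close> cells add up.\<close>

lemma row_triple:
  assumes env: "env s" and u: "blank (qst s)" and i: "vars s v_i = i" "i < n" and pt: "pow_table (mem s)"
  shows "triple w A B (row sw) s (4 * n * w ^ 4 * row_cost sw i)
    (\<lambda>s'. blank (qst s') \<and> pow_table (mem s') \<and> (\<forall>a<tab. a \<notin> pos sw i ` {..<n} \<longrightarrow> mem s' a = mem s a))
    (\<lambda>s'. if row_ok sw (mem s') i n then 0 else 1) (of_nat n * (of_nat len * fail_prob))"
proof -
  let ?e = "of_nat len * fail_prob" and ?P = "row_cost sw i"
  \<comment> \<open>Regrouping by associativity lets the three preparatory programs be treated as
    one.\<close>
  have ex: "exec w A B (row sw) s = exec w A B (Seq (Seq (collect sw) (Seq round_up pad)) (For v_j v_n (cell sw))) s"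
  proof -
    have "exec w A B (Seq c d) = (\<lambda>s. bind_spmf (exec w A B c s) (exec w A B d))" for c d by (rule ext) simp
    then show ?thesis by (simp only: row_def bind_spmf_assoc)
  qed
  have "triple w A B (Seq (Seq (collect sw) (Seq round_up pad)) (For v_j v_n (cell sw))) s
     (n * 80 * w + (3 + (\<Sum>k<n. 3 * w ^ 4 * ?P + 3)))
    (\<lambda>s'. blank (qst s') \<and> pow_table (mem s') \<and> (\<forall>a<tab. a \<notin> pos sw i ` {..<n} \<longrightarrow> mem s' a = mem s a))
    (\<lambda>s'. if row_ok sw (mem s') i n then 0 else 1) (of_nat n * ?e)"
  proof (rule triple_Seq_det[OF table_wp[OF env u i]])
    fix s1 assume f1: "frame (Seq (collect sw) (Seq round_up pad)) s s1" and T: "table_wp sw i (mem s) s1"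
    have e1: "env s1" "vars s1 v_i = i" using env_step[OF f1 env] i by simp_all
    define t where "t = vars s1 v_t"
    have u1: "blank (qst s1)" and tl: "t \<le> len" and pw: "vars s1 v_pw = 2 ^ t"
      and dt: "2 ^ t \<le> 2 * (deg sw i + 1)" and rt: "row_table sw (mem s1) i t"
      and out1: "\<And>a. a \<notin> {tab..<tab + 2 ^ len} \<Longrightarrow> mem s1 a = mem s a"
      using T unfolding table_wp_def t_def by metis+
    have pt1: "pow_table (mem s1)" using pt by (rule pow_table_cong) (use tab_len_le out1 in auto)
    have cost: "sqrt_cost t \<le> ?P" unfolding sqrt_cost_def row_cost_def using dt by (intro mono_floor_sqrt') simp
    define I where "I = (\<lambda>k (s'::config). blank (qst s') \<and> (\<forall>a. a \<notin> pos sw i ` {..<k} \<longrightarrow> mem s' a = mem s1 a))"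
    define V where "V = (\<lambda>k (s'::config). of_nat (n - k) * ?e + (if row_ok sw (mem s') i k then 0 else 1))"
    have "triple w A B (For v_j v_n (cell sw)) s1 (3 + (\<Sum>k<n. 3 * w ^ 4 * ?P + 3)) (I n) (V n) (V 0 s1)"
    proof (rule triple_For[where I = I and V = V and T = "\<lambda>_. 3 * w ^ 4 * ?P", OF w_pos n_less_w])
      fix k s' assume k: "k < n" and I: "I k s'" and vk: "vars s' v_j = k" and fr: "frame (For v_j v_n (cell sw)) s1 s'"
      have e': "env s'" "vars s' v_i = i" "vars s' v_t = t" "vars s' v_pw = 2 ^ t"
        using env_step[OF fr e1(1)] e1(2) pw by (simp_all add: t_def)
      have u': "blank (qst s')" and out': "\<And>a. a \<notin> pos sw i ` {..<k} \<Longrightarrow> mem s' a = mem s1 a"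
        using I by (auto simp: I_def)
      \<comment> \<open>Earlier cells of the row have written below \<open>tab\<close> only.\<close>
      have up: "mem s' a = mem s1 a" if "tab \<le> a" for a
      proof (rule out')
        show "a \<notin> pos sw i ` {..<k}"
        proof
          assume "a \<in> pos sw i ` {..<k}"
          then obtain j where j: "j < k" "a = pos sw i j" by auto
          then show False using pos_less(1)[OF i(2), of j sw] k that by simp
        qed
      qed
      have pt': "pow_table (mem s')" using pt1 by (rule pow_table_cong) (use up tab_len_le in auto)
      have rt': "row_table sw (mem s') i t" using rt by (rule row_table_cong) (use up in auto)
      have c: "triple w A B (cell sw) s' (3 * w ^ 4 * sqrt_cost t)
        (\<lambda>s''. blank (qst s'') \<and> (\<forall>a. a \<noteq> pos sw i k \<longrightarrow> mem s'' a = mem s' a))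
        (\<lambda>s''. if mem s'' (pos sw i k) = best sw i k then 0 else 1) ?e"
        by (rule cell_triple[OF e'(1) u' e'(3) tl e'(4) e'(2) i(2) vk k refl pt' rt'])
      let ?K = "of_nat (n - Suc k) * ?e + (if row_ok sw (mem s') i k then 0 else 1 :: ennreal)"
      show "triple w A B (cell sw) s' (3 * w ^ 4 * ?P) (I (Suc k)) (V (Suc k)) (V k s')"
      proof (rule triple_conseq[OF triple_add[OF c, of ?K]])
        show "3 * w ^ 4 * sqrt_cost t \<le> 3 * w ^ 4 * ?P" using cost by (intro mult_left_mono) auto
        have nk: "n - k = Suc (n - Suc k)" using k by simp
        show "?K + ?e \<le> V k s'" unfolding V_def nk by (simp add: algebra_simps)
        fix s'' :: config assume Q: "blank (qst s'') \<and> (\<forall>a. a \<noteq> pos sw i k \<longrightarrow> mem s'' a = mem s' a)"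
        have old: "mem s'' (pos sw i j) = mem s' (pos sw i j)" if "j < k" for j
          using Q pos_inj[OF i(2) _ i(2) k, of j sw] that k by auto
        have "I (Suc k) s''" using Q out' by (auto simp: I_def lessThan_Suc)
        moreover have "(if row_ok sw (mem s'') i (Suc k) then 0 else 1 :: ennreal) \<le>
          (if row_ok sw (mem s') i k then 0 else 1) + (if mem s'' (pos sw i k) = best sw i k then 0 else 1)"
        proof (cases "row_ok sw (mem s') i k \<and> mem s'' (pos sw i k) = best sw i k")
          case True
          then have "row_ok sw (mem s'') i (Suc k)" using old by (auto simp: row_ok_def less_Suc_eq)
          then show ?thesis by simp
        qed auto
        ultimately show "I (Suc k) s'' \<and> V (Suc k) s'' \<le> ?K + (if mem s'' (pos sw i k) = best sw i k then 0 else 1)"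
          unfolding V_def add.assoc by (auto intro: add_left_mono)
      qed
    next
      show "I k s'' \<and> V k s'' = V k s'" if "I k s'" "same_but {v_j, v_cond} s' s''" for k s' s''
        using that by (simp add: same_but_def I_def V_def)
    next
      show "I 0 s1" using u1 by (simp add: I_def)
    qed (use e1 in simp_all)
    then show "triple w A B (For v_j v_n (cell sw)) s1 (3 + (\<Sum>k<n. 3 * w ^ 4 * ?P + 3))
      (\<lambda>s'. blank (qst s') \<and> pow_table (mem s') \<and> (\<forall>a<tab. a \<notin> pos sw i ` {..<n} \<longrightarrow> mem s' a = mem s a))
      (\<lambda>s'. if row_ok sw (mem s') i n then 0 else 1) (of_nat n * ?e)"
    proof (rule triple_conseq)
      show "V 0 s1 \<le> of_nat n * ?e" by (simp add: V_def row_ok_def)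
      fix s' assume I: "I n s'"
      have up: "mem s' a = mem s1 a" if "ptab \<le> a" for a
      proof -
        have "a \<notin> pos sw i ` {..<n}"
        proof
          assume "a \<in> pos sw i ` {..<n}"
          then obtain j where "j < n" "a = pos sw i j" by auto
          then show False using pos_less(1)[OF i(2), of j sw] tab_len_le that by simp
        qed
        then show ?thesis using I by (simp add: I_def)
      qed
      have "pow_table (mem s')" using pt1 by (rule pow_table_cong) (use up in auto)
      moreover have "mem s' a = mem s a" if "a < tab" "a \<notin> pos sw i ` {..<n}" for a
        using I that out1[of a] by (simp add: I_def)
      ultimately show "(blank (qst s') \<and> pow_table (mem s') \<and> (\<forall>a<tab. a \<notin> pos sw i ` {..<n} \<longrightarrow> mem s' a = mem s a)) \<and>
         (if row_ok sw (mem s') i n then 0 else 1) \<le> V n s'"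
        using I by (simp add: I_def V_def)
    qed simp
  qed
  then have "triple w A B (row sw) s (n * 80 * w + (3 + (\<Sum>k<n. 3 * w ^ 4 * ?P + 3)))
    (\<lambda>s'. blank (qst s') \<and> pow_table (mem s') \<and> (\<forall>a<tab. a \<notin> pos sw i ` {..<n} \<longrightarrow> mem s' a = mem s a))
    (\<lambda>s'. if row_ok sw (mem s') i n then 0 else 1) (of_nat n * ?e)"
    unfolding triple_def ex .
  moreover have "n * 80 * w + (3 + (\<Sum>k<n. 3 * w ^ 4 * ?P + 3)) \<le> 4 * n * w ^ 4 * ?P"
  proof -
    have w: "20 \<le> w" using len_pos by (simp add: w_def)
    have P: "1 \<le> ?P" unfolding row_cost_def by (intro le_floor_sqrt) simp
    have "20 ^ 3 \<le> w ^ 3" using w by (intro power_mono) auto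
    then have "w * (20 ^ 3 * 1) \<le> w * (w ^ 3 * ?P)" using P by (intro mult_mono) auto
    then have X: "8000 * w \<le> w ^ 4 * ?P" by (simp add: power4_eq_xxxx power3_eq_cube mult_ac)
    define X where "X = w ^ 4 * ?P"
    have "n * 80 * w + (3 + (\<Sum>k<n. 3 * w ^ 4 * ?P + 3)) = 3 + n * (80 * w + 3 * X + 3)"
      by (simp add: X_def algebra_simps)
    also have "\<dots> \<le> n * 3 + n * (80 * w + 3 * X + 3)" using n_pos by simp
    also have "\<dots> = n * (80 * w + 3 * X + 6)" by (simp add: algebra_simps)
    also have "80 * w + 3 * X + 6 \<le> 4 * X" using X[folded X_def] w by linarith
    then have "n * (80 * w + 3 * X + 6) \<le> n * (4 * X)" by (rule mult_left_mono) simp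
    finally show ?thesis by (simp add: X_def mult_ac)
  qed
  ultimately show ?thesis by (rule triple_conseq) auto
qed

end

section \<open>Initialisation, choice of the sparser matrix, and all rows\<close>

abbreviation (input) v_m1 :: vname where "v_m1 \<equiv> 90"
abbreviation (input) v_m2 :: vname where "v_m2 \<equiv> 91"

definition rows :: "bool \<Rightarrow> com" where
  "rows sw = For v_i v_n (row sw)"

definition count_step :: "bool \<Rightarrow> vname \<Rightarrow> com" where
  "count_step sw d = Seq (query sw v_res v_i v_k) (Op d Add d v_res)"

definition count :: "bool \<Rightarrow> vname \<Rightarrow> com" where
  "count sw d = Seq (Const d 0) (For v_i v_n (For v_k v_n (count_step sw d)))"

text \<open>The program is given only \<open>n\<close>. Its bit length is found by \<open>n\<close>
  rounds of halving, of which those with a nonzero value are counted; a linear number of steps is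
  affordable. All other parameters follow from it.\<close>

definition constants :: com where
  "constants =
     Seq (Const v_zero 0) (Seq (Const v_one 1) (Seq (Const v_two 2) (Seq (Const v_three 3)
     (Seq (Op v_x1 Add v_n v_zero) (Seq (Const v_len 0)
     (Seq (For v_c v_n (If v_x1 (Seq (Op v_x1 Div v_x1 v_two) (Op v_len Add v_len v_one)) Skip))
     (Seq (Const v_tmp 20) (Seq (Op v_w Mul v_tmp v_len) (Seq (Const v_tmp 4) (Seq (Op v_reps Mul v_tmp v_len)
     (Seq (Op v_rounds Add v_len v_two) (Seq (Const v_pw 1)
     (Seq (For v_c v_len (Op v_pw Add v_pw v_pw))
     (Seq (Op v_tab Mul v_pw v_pw) (Op v_ptab Add v_tab v_tab)))))))))))))))"

definition power_table :: com where
  "power_table = Seq (Const v_pw 1)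
     (For v_c v_len (Seq (Op v_addr Add v_ptab v_pw) (Seq (Store v_addr v_one) (Op v_pw Add v_pw v_pw))))"

definition max_witness_prog :: com where
  "max_witness_prog = Seq constants (Seq power_table (Seq (count False v_m1) (Seq (count True v_m2)
     (Seq (Op v_tmp Less v_m2 v_m1) (If v_tmp (rows True) (rows False))))))"

lemma modified_count_step [simp]: "modified (count_step sw d) = {v_cond, v_x1, v_x2, v_x3, v_res, d}"
  and storefree_count_step [simp]: "storefree (count_step sw d)"
  by (auto simp: count_step_def)

lemma modified_count [simp]: "modified (count sw d) = {v_cond, v_x1, v_x2, v_x3, v_res, v_i, v_k, d}"
  and storefree_count [simp]: "storefree (count sw d)"
  by (auto simp: count_def)

lemma modified_power_table [simp]: "modified power_table = {v_cond, v_pw, v_c, v_addr}"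
  and classical_power_table [simp]: "classical power_table"
  by (auto simp: power_table_def)

lemma classical_constants [simp]: "classical constants"
  and storefree_constants [simp]: "storefree constants"
  by (auto simp: constants_def)

context mw_input
begin

text \<open>Different rows write to disjoint output cells, so finished rows stay correct; the list
  at \<open>tab\<close> is rebuilt for each row.\<close>

lemma rows_triple:
  assumes env: "env s" and u: "blank (qst s)" and pt: "pow_table (mem s)"
  shows "triple w A B (rows sw) s (3 + (\<Sum>i<n. 4 * n * w ^ 4 * row_cost sw i + 3)) (\<lambda>_. True)
    (\<lambda>s'. if \<forall>i<n. row_ok sw (mem s') i n then 0 else 1) (of_nat n * (of_nat n * (of_nat len * fail_prob)))"
proof -
  let ?e = "of_nat n * (of_nat len * fail_prob)"
  define I where "I = (\<lambda>(k::nat) (s'::config). blank (qst s') \<and> pow_table (mem s'))"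
  define V where "V = (\<lambda>k (s'::config). of_nat (n - k) * ?e + (if \<forall>i<k. row_ok sw (mem s') i n then 0 else 1))"
  have "triple w A B (For v_i v_n (row sw)) s (3 + (\<Sum>i<n. 4 * n * w ^ 4 * row_cost sw i + 3)) (I n) (V n) (V 0 s)"
  proof (rule triple_For[where I = I and V = V and T = "\<lambda>i. 4 * n * w ^ 4 * row_cost sw i", OF w_pos n_less_w])
    fix k s' assume k: "k < n" and I: "I k s'" and vk: "vars s' v_i = k" and fr: "frame (For v_i v_n (row sw)) s s'"
    have e': "env s'" using env_step[OF fr env] by simp
    have r: "triple w A B (row sw) s' (4 * n * w ^ 4 * row_cost sw k)
      (\<lambda>s''. blank (qst s'') \<and> pow_table (mem s'') \<and> (\<forall>a<tab. a \<notin> pos sw k ` {..<n} \<longrightarrow> mem s'' a = mem s' a))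
      (\<lambda>s''. if row_ok sw (mem s'') k n then 0 else 1) ?e"
      using row_triple[OF e' _ vk k] I by (simp add: I_def)
    let ?K = "of_nat (n - Suc k) * ?e + (if \<forall>i<k. row_ok sw (mem s') i n then 0 else 1 :: ennreal)"
    show "triple w A B (row sw) s' (4 * n * w ^ 4 * row_cost sw k) (I (Suc k)) (V (Suc k)) (V k s')"
    proof (rule triple_conseq[OF triple_add[OF r, of ?K] order_refl])
      have nk: "n - k = Suc (n - Suc k)" using k by simp
      show "?K + ?e \<le> V k s'" unfolding V_def nk by (simp add: algebra_simps)
      fix s'' :: config
      assume Q: "blank (qst s'') \<and> pow_table (mem s'') \<and> (\<forall>a<tab. a \<notin> pos sw k ` {..<n} \<longrightarrow> mem s'' a = mem s' a)"
      have old: "mem s'' (pos sw i j) = mem s' (pos sw i j)" if "i < k" "j < n" for i j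
      proof -
        have "i < n" using that k by simp
        have "pos sw i j \<notin> pos sw k ` {..<n}"
        proof
          assume "pos sw i j \<in> pos sw k ` {..<n}"
          then obtain j' where "j' < n" "pos sw i j = pos sw k j'" by auto
          then show False using pos_inj[OF \<open>i < n\<close> that(2) k] that(1) by auto
        qed
        then show ?thesis using Q pos_less(1)[OF \<open>i < n\<close> that(2), of sw] by blast
      qed
      have old': "row_ok sw (mem s'') i n = row_ok sw (mem s') i n" if "i < k" for i
        using old[OF that] by (simp add: row_ok_def)
      have "(if \<forall>i<Suc k. row_ok sw (mem s'') i n then 0 else 1 :: ennreal) \<le>
          (if \<forall>i<k. row_ok sw (mem s') i n then 0 else 1) + (if row_ok sw (mem s'') k n then 0 else 1)"
      proof (cases "(\<forall>i<k. row_ok sw (mem s') i n) \<and> row_ok sw (mem s'') k n")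
        case True
        then have "\<forall>i<Suc k. row_ok sw (mem s'') i n" using old' by (simp add: less_Suc_eq)
        then show ?thesis by simp
      qed auto
      then show "I (Suc k) s'' \<and> V (Suc k) s'' \<le> ?K + (if row_ok sw (mem s'') k n then 0 else 1)"
        using Q unfolding V_def I_def add.assoc by (auto intro: add_left_mono)
    qed
  next
    show "I k s'' \<and> V k s'' = V k s'" if "I k s'" "same_but {v_i, v_cond} s' s''" for k s' s''
      using that by (simp add: same_but_def I_def V_def)
  next
    show "I 0 s" using u pt by (simp add: I_def)
  qed (use env in simp_all)
  then show ?thesis
    unfolding rows_def
  proof (rule triple_conseq)
    show "V 0 s \<le> of_nat n * ?e" by (simp add: V_def)
  qed (simp_all add: V_def)
qed

lemma deg_le: "deg sw i \<le> n"
proof -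
  have "deg sw i \<le> card {..<n}" unfolding deg_def by (intro card_mono) auto
  then show ?thesis by simp
qed

lemma sum_deg_le: "k \<le> n \<Longrightarrow> (\<Sum>i<k. deg sw i) \<le> k * n"
  using sum_bounded_above[of "{..<k}" "deg sw" n] deg_le by simp

lemma n_sq_less: "n * n < 2 ^ w"
proof -
  have "n * n \<le> 2 ^ len * 2 ^ len" using n_less by (intro mult_mono) auto
  also have "\<dots> = tab" by (simp add: tab_def mult_2 power_add)
  also have "\<dots> < 2 ^ w" using tab_bounds(1)[of 0] by simp
  finally show ?thesis .
qed

text \<open>The count never exceeds \<open>n * n < 2 ^ w\<close>, so no overflow occurs.\<close>

lemma count_row_wp:
  assumes env: "env s" and u: "blank (qst s)" and i: "vars s v_i = i" "i < n"
    and d: "d \<in> {v_m1, v_m2}" and c: "vars s d = (\<Sum>i'<i. deg sw i')"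
  shows "wp (exec w A B (For v_k v_n (count_step sw d)) s) (\<lambda>s'. time s' \<le> time s + (3 + n * ((60 * w + 1) + 3)) \<and>
    (blank (qst s') \<and> vars s' d = (\<Sum>i'<Suc i. deg sw i')))"
proof -
  define I where "I = (\<lambda>k (s'::config). blank (qst s') \<and>
    vars s' d = (\<Sum>i'<i. deg sw i') + card {k'. k' < k \<and> ent sw i k'})"
  have "wp (exec w A B (For v_k v_n (count_step sw d)) s) (\<lambda>s'. time s' \<le> time s + (3 + n * ((60 * w + 1) + 3)) \<and> I n s')"
  proof (rule wp_For[where I = I and T = "60 * w + 1", OF w_pos n_less_w])
    fix k s' assume k: "k < n" and I: "I k s'" and vk: "vars s' v_k = k" and fr: "frame (For v_k v_n (count_step sw d)) s s'"
    have e': "env s'" "vars s' v_i = i" using env_step[OF fr env] i d by auto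
    show "wp (exec w A B (count_step sw d) s') (\<lambda>s''. time s'' \<le> time s' + (60 * w + 1) \<and> I (Suc k) s'')"
      unfolding count_step_def
    proof (rule wp_seqI[OF query_wp[OF e'(1)]])
      fix s2 assume f2: "frame (query sw v_res v_i v_k) s' s2" and t2: "time s2 \<le> time s' + 60 * w"
        and Q: "blank (qst s2) \<and> vars s2 v_res = of_bool (ent sw (vars s' v_i) (vars s' v_k))"
      have d2: "vars s2 d = vars s' d" using env_step[OF f2 e'(1)] d by auto
      let ?K = "\<lambda>k. {k'. k' < k \<and> ent sw i k'}"
      have "?K (Suc k) = (if ent sw i k then insert k (?K k) else ?K k)" by (auto simp: less_Suc_eq)
      then have card: "card (?K (Suc k)) = card (?K k) + of_bool (ent sw i k)" by simp
      have "card (?K (Suc k)) \<le> card {..<n}" using k by (intro card_mono) auto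
      moreover have "(\<Sum>i'<i. deg sw i') \<le> i * n" using sum_deg_le i by simp
      moreover have "i * n + n \<le> n * n"
      proof -
        have "(i + 1) * n \<le> n * n" using i by (intro mult_right_mono) auto
        then show ?thesis by simp
      qed
      ultimately have "(\<Sum>i'<i. deg sw i') + card (?K (Suc k)) < 2 ^ w" using n_sq_less by simp
      then have "take_bit w (vars s2 d + vars s2 v_res) = (\<Sum>i'<i. deg sw i') + card (?K (Suc k))"
        using I Q d2 e' vk card by (simp add: I_def take_bit_self)
      then show "wp (exec w A B (Op d Add d v_res) s2) (\<lambda>s''. time s'' \<le> time s' + (60 * w + 1) \<and> I (Suc k) s'')"
        using Q t2 by (simp add: I_def)
    qed (use e' vk k i n_less_w I in \<open>simp_all add: I_def\<close>)
  next
    show "I k s''" if "I k s'" "same_but {v_k, v_cond} s' s''" for k s' s''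
      using that d by (auto simp: same_but_def I_def)
  next
    show "I 0 s" using c u by (simp add: I_def)
  qed (use env d in auto)
  then show ?thesis by (rule wp_mono) (simp add: I_def deg_def)
qed

lemma count_wp:
  assumes env: "env s" and u: "blank (qst s)" and d: "d \<in> {v_m1, v_m2}"
  shows "wp (exec w A B (count sw d) s) (\<lambda>s'. time s' \<le> time s + 62 * (n * n) * w \<and>
    blank (qst s') \<and> vars s' d = (\<Sum>i<n. deg sw i))"
proof -
  define s1 where "s1 = tick (set_var d 0 s)"
  have s1: "env s1" "vars s1 d = 0" "qst s1 = qst s" "time s1 = time s + 1"
    using env d by (auto simp: s1_def)
  have ex: "exec w A B (count sw d) s = exec w A B (For v_i v_n (For v_k v_n (count_step sw d))) s1"
    unfolding count_def exec_Seq_basic s1_def by (simp del: exec.simps)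
  define I where "I = (\<lambda>k (s'::config). blank (qst s') \<and> vars s' d = (\<Sum>i<k. deg sw i))"
  have "wp (exec w A B (For v_i v_n (For v_k v_n (count_step sw d))) s1)
      (\<lambda>s'. time s' \<le> time s1 + (3 + n * ((3 + n * ((60 * w + 1) + 3)) + 3)) \<and> I n s')"
  proof (rule wp_For[where I = I and T = "3 + n * ((60 * w + 1) + 3)", OF w_pos n_less_w])
    fix k s' assume k: "k < n" and I: "I k s'" and vk: "vars s' v_i = k" and fr: "frame (For v_i v_n (For v_k v_n (count_step sw d))) s1 s'"
    have e': "env s'" using env_step[OF fr s1(1)] d by auto
    show "wp (exec w A B (For v_k v_n (count_step sw d)) s') (\<lambda>s''. time s'' \<le> time s' + (3 + n * (60 * w + 1 + 3)) \<and> I (Suc k) s'')"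
      using count_row_wp[OF e' _ vk k d] I unfolding I_def by blast
  next
    show "I k s''" if "I k s'" "same_but {v_i, v_cond} s' s''" for k s' s''
      using that d by (auto simp: same_but_def I_def)
  next
    show "I 0 s1" using s1 u by (simp add: I_def)
  qed (use s1 d in auto)
  moreover have "1 + (3 + n * ((3 + n * ((60 * w + 1) + 3)) + 3)) \<le> 62 * (n * n) * w"
  proof -
    have w: "20 \<le> w" using len_pos by (simp add: w_def)
    have nn: "1 \<le> n * n" "n \<le> n * n" using n_pos by simp_all
    have "1 + (3 + n * ((3 + n * ((60 * w + 1) + 3)) + 3)) = 4 + 6 * n + (n * n) * (60 * w + 4)"
      by (simp add: algebra_simps)
    also have "\<dots> \<le> 4 * (n * n) + 6 * (n * n) + (n * n) * (60 * w + 4)" using nn by (intro add_mono mult_left_mono) auto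
    also have "\<dots> = (n * n) * (60 * w + 14)" by (simp add: algebra_simps)
    also have "\<dots> \<le> (n * n) * (62 * w)" using w by (intro mult_left_mono) auto
    finally show ?thesis by (simp add: mult_ac)
  qed
  ultimately show ?thesis
    unfolding ex using s1(4) by (auto simp: I_def elim!: wp_mono)
qed

end

text \<open>Supplies the factor 2 by which the final error bound drops from 1/2 to 1/4.\<close>

lemma double_le_power: "1 \<le> l \<Longrightarrow> 2 * l \<le> (2::nat) ^ l"
proof (induction l rule: nat_induct_at_least)
  case (Suc l)
  then show ?case by simp
qed simp

context mw_input
begin

lemma constants_wp:
  "wp (exec w A B constants (init_config n)) (\<lambda>s'. time s' \<le> time (init_config n) + (20 + 6 * n + 4 * len) \<and> env s')"
proof -
  define s6 where "s6 = tick (set_var v_len 0 (tick (set_var v_x1 n (tick (set_var v_three 3 (tick (set_var v_two 2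
    (tick (set_var v_one 1 (tick (set_var v_zero 0 (init_config n))))))))))))"
  let ?c1 = "If v_x1 (Seq (Op v_x1 Div v_x1 v_two) (Op v_len Add v_len v_one)) Skip"
  let ?c2 = "Op v_pw Add v_pw v_pw"
  have w20: "20 \<le> w" using len_pos by (simp add: w_def)
  have w20': "20 < (2::nat) ^ w" using w20 w_less by linarith
  have tb: "take_bit w 2 = (2::nat)" "take_bit w 3 = (3::nat)" "take_bit w 4 = (4::nat)" "take_bit w 20 = (20::nat)" "take_bit w n = n"
    by (rule take_bit_self; use w20' n_less_w in linarith)+
  have w2: "2 \<le> w" using w20 by simp
  have s6: "vars s6 v_n = n" "vars s6 v_zero = 0" "vars s6 v_one = 1" "vars s6 v_two = 2" "vars s6 v_three = 3"
      "vars s6 v_x1 = n" "vars s6 v_len = 0" "time s6 = 6"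
    by (simp_all add: s6_def init_config_def)
  have ln: "2 ^ (len - 1) \<le> n"
    using floor_log_exp2_le[of n] n_pos by (simp add: len_def bit_length_def)
  \<comment> \<open>Halving meets a nonzero value in exactly the first \<open>len\<close>
    rounds.\<close>
  have nz: "n div 2 ^ k \<noteq> 0 \<longleftrightarrow> k < len" for k
  proof
    assume "n div 2 ^ k \<noteq> 0"
    then have "2 ^ k \<le> n" by (simp add: div_eq_0_iff)
    then have "(2::nat) ^ k < 2 ^ len" using n_less by linarith
    then show "k < len" by simp
  next
    assume "k < len"
    then have "(2::nat) ^ k \<le> 2 ^ (len - 1)" by (intro power_increasing) auto
    then have "2 ^ k \<le> n" using ln by linarith
    then show "n div 2 ^ k \<noteq> 0" by (simp add: div_eq_0_iff)
  qed
  \<comment> \<open>Guarantees that \<open>n\<close> rounds reach all binary digits.\<close>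
  have len_n: "len \<le> n"
  proof -
    have "len - 1 < 2 ^ (len - 1)" by simp
    then show ?thesis using ln by linarith
  qed
  define I where "I = (\<lambda>k (s'::config). vars s' v_x1 = n div 2 ^ k \<and> vars s' v_len = min k len)"
  have loop1: "wp (exec w A B (For v_c v_n ?c1) s6) (\<lambda>s'. time s' \<le> time s6 + (3 + n * (3 + 3)) \<and> I n s')"
  proof (rule wp_For[where I = I and T = 3, OF w_pos n_less_w])
    fix k s' assume k: "k < n" and I: "I k s'" and fr: "frame (For v_c v_n ?c1) s6 s'"
    have v: "vars s' v_two = 2" "vars s' v_one = 1" using fr s6 by (simp_all add: frame_def)
    have d: "n div 2 ^ k div 2 = n div 2 ^ Suc k" by (simp only: power_Suc2 div_mult2_eq)
    have dw: "take_bit w (n div 2 ^ Suc k) = n div 2 ^ Suc k"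
      by (intro take_bit_self) (rule le_less_trans[OF div_le_dividend n_less_w])
    show "wp (exec w A B ?c1 s') (\<lambda>s''. time s'' \<le> time s' + 3 \<and> I (Suc k) s'')"
    proof (cases "k < len")
      case True
      then have x: "vars s' v_x1 \<noteq> 0" "vars s' v_x1 div 2 = n div 2 ^ Suc k" using I nz d by (auto simp: I_def)
      have "take_bit w (Suc k) = Suc k" using True len_less_w by (intro take_bit_self) simp
      then show ?thesis using x True I v dw by (simp add: I_def min_def)
    next
      case False
      then have x: "vars s' v_x1 = 0" "n div 2 ^ Suc k = 0" using I nz[of k] nz[of "Suc k"] by (auto simp: I_def)
      then show ?thesis using False I by (simp add: I_def min_def)
    qed
  next
    show "I k s''" if "I k s'" "same_but {v_c, v_cond} s' s''" for k s' s''
      using that by (simp add: same_but_def I_def)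
  qed (use s6 in \<open>simp_all add: I_def\<close>)
  show ?thesis
    unfolding constants_def exec_Seq_basic
  proof -
    let ?d = "Seq (Const v_tmp 20) (Seq (Op v_w Mul v_tmp v_len) (Seq (Const v_tmp 4) (Seq (Op v_reps Mul v_tmp v_len)
      (Seq (Op v_rounds Add v_len v_two) (Seq (Const v_pw 1)
      (Seq (For v_c v_len ?c2) (Seq (Op v_tab Mul v_pw v_pw) (Op v_ptab Add v_tab v_tab))))))))"
    let ?s = "tick (set_var v_len (take_bit w 0) (tick (set_var v_x1 (binop_val w Add
      (vars (tick (set_var v_three (take_bit w 3) (tick (set_var v_two (take_bit w 2) (tick (set_var v_one (take_bit w 1)
        (tick (set_var v_zero (take_bit w 0) (init_config n))))))))) v_n)
      (vars (tick (set_var v_three (take_bit w 3) (tick (set_var v_two (take_bit w 2) (tick (set_var v_one (take_bit w 1)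
        (tick (set_var v_zero (take_bit w 0) (init_config n))))))))) v_zero))
      (tick (set_var v_three (take_bit w 3) (tick (set_var v_two (take_bit w 2) (tick (set_var v_one (take_bit w 1)
        (tick (set_var v_zero (take_bit w 0) (init_config n))))))))))))"
    have eq: "?s = s6" unfolding s6_def using w_pos w2 by (simp add: tb init_config_def)
    show "wp (exec w A B (Seq (For v_c v_n ?c1) ?d) ?s)
       (\<lambda>s'. time s' \<le> time (init_config n) + (20 + 6 * n + 4 * len) \<and> env s')"
      unfolding eq
    proof (rule wp_seqI[OF loop1])
      fix s7 assume f7: "frame (For v_c v_n ?c1) s6 s7" and t7: "time s7 \<le> time s6 + (3 + n * (3 + 3))" and I7: "I n s7"
      have s7: "vars s7 v_n = n" "vars s7 v_zero = 0" "vars s7 v_one = 1" "vars s7 v_two = 2" "vars s7 v_three = 3" "vars s7 v_len = len"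
        using f7 s6 I7 len_n by (simp_all add: frame_def I_def)
      define s13 where "s13 = tick (set_var v_pw 1 (tick (set_var v_rounds (len + 2) (tick (set_var v_reps (4 * len) (tick (set_var v_tmp 4
         (tick (set_var v_w w (tick (set_var v_tmp 20 s7)))))))))))"
      have b: "take_bit w (20 * len) = w" "take_bit w (4 * len) = 4 * len" "take_bit w (Suc (Suc len)) = Suc (Suc len)"
        using w_less reps_less_w len_less_w by (simp_all add: take_bit_self w_def[symmetric])
      have ex: "exec w A B ?d s7 = exec w A B (Seq (For v_c v_len ?c2) (Seq (Op v_tab Mul v_pw v_pw) (Op v_ptab Add v_tab v_tab))) s13"
        unfolding exec_Seq_basic s13_def using s7 b tb w_pos w2 by (simp del: exec.simps)
      have s13: "vars s13 v_n = n" "vars s13 v_zero = 0" "vars s13 v_one = 1" "vars s13 v_two = 2" "vars s13 v_three = 3" "vars s13 v_len = len"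
          "vars s13 v_w = w" "vars s13 v_reps = 4 * len" "vars s13 v_rounds = len + 2" "vars s13 v_pw = 1" "time s13 = time s7 + 6"
        using s7 by (simp_all add: s13_def)
      define J where "J = (\<lambda>k (s'::config). vars s' v_pw = 2 ^ k)"
      have lw: "len < 2 ^ w" using len_less_w by simp
      have loop2: "wp (exec w A B (For v_c v_len ?c2) s13) (\<lambda>s'. time s' \<le> time s13 + (3 + len * (1 + 3)) \<and> J len s')"
      proof (rule wp_For[where I = J and T = 1, OF w_pos lw])
        fix k s' assume k: "k < len" and J: "J k s'"
        have "(2::nat) ^ Suc k \<le> 2 ^ len" using k by (intro power_increasing) auto
        then have "(2::nat) ^ k + 2 ^ k < 2 ^ w" using tab_bounds(1)[of len] by simp
        then have "take_bit w (2 ^ k + 2 ^ k) = (2 ^ k + 2 ^ k :: nat)" by (rule take_bit_self)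
        then show "wp (exec w A B ?c2 s') (\<lambda>s''. time s'' \<le> time s' + 1 \<and> J (Suc k) s'')"
          using J by (simp add: J_def)
      next
        show "J k s''" if "J k s'" "same_but {v_c, v_cond} s' s''" for k s' s''
          using that by (simp add: same_but_def J_def)
      qed (use s13 in \<open>simp_all add: J_def\<close>)
      show "wp (exec w A B ?d s7) (\<lambda>s'. time s' \<le> time (init_config n) + (20 + 6 * n + 4 * len) \<and> env s')"
        unfolding ex
      proof (rule wp_seqI[OF loop2])
        fix s14 assume f: "frame (For v_c v_len ?c2) s13 s14" and t14: "time s14 \<le> time s13 + (3 + len * (1 + 3))" and J14: "J len s14"
        have p: "2 ^ len * 2 ^ len = tab" by (simp add: tab_def mult_2 power_add)
        have "take_bit w tab = tab" "take_bit w (tab + tab) = ptab"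
          using tab_bounds(1)[of 0] pow_bounds(2)[of 0] by (simp_all add: take_bit_self ptab_def)
        then have ex: "exec w A B (Seq (Op v_tab Mul v_pw v_pw) (Op v_ptab Add v_tab v_tab)) s14 =
            return_spmf (tick (set_var v_ptab ptab (tick (set_var v_tab tab s14))))"
          using J14 p by (simp add: J_def)
        have "time s14 + 2 \<le> time (init_config n) + (20 + 6 * n + 4 * len)"
          using t14 t7 s13(11) s6(8) by simp
        moreover have "env (tick (set_var v_ptab ptab (tick (set_var v_tab tab s14))))"
          unfolding env_def using f s13 by (simp add: frame_def del: env_vars)
        ultimately show "wp (exec w A B (Seq (Op v_tab Mul v_pw v_pw) (Op v_ptab Add v_tab v_tab)) s14)
            (\<lambda>s'. time s' \<le> time (init_config n) + (20 + 6 * n + 4 * len) \<and> env s')"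
          unfolding ex by simp
      qed
    qed
  qed
qed

lemma power_table_wp:
  assumes env: "env s" and m: "mem s = (\<lambda>_. 0)"
  shows "wp (exec w A B power_table s) (\<lambda>s'. time s' \<le> time s + (4 + len * 6) \<and> pow_table (mem s'))"
proof -
  let ?c = "Seq (Op v_addr Add v_ptab v_pw) (Seq (Store v_addr v_one) (Op v_pw Add v_pw v_pw))"
  define s1 where "s1 = tick (set_var v_pw 1 s)"
  have s1: "env s1" "vars s1 v_pw = 1" "mem s1 = (\<lambda>_. 0)" "time s1 = time s + 1"
    using env m by (simp_all add: s1_def)
  have ex: "exec w A B power_table s = exec w A B (For v_c v_len ?c) s1"
    unfolding power_table_def exec_Seq_basic s1_def using w_pos by (simp del: exec.simps)
  define I where "I = (\<lambda>k (s'::config). vars s' v_pw = 2 ^ k \<and> mem s' = (\<lambda>a. of_bool (\<exists>b<k. a = ptab + 2 ^ b)))"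
  have lw: "len < 2 ^ w" using len_less_w by simp
  have "wp (exec w A B (For v_c v_len ?c) s1) (\<lambda>s'. time s' \<le> time s1 + (3 + len * (3 + 3)) \<and> I len s')"
  proof (rule wp_For[where I = I and T = 3, OF w_pos lw])
    fix k s' assume k: "k < len" and I: "I k s'" and fr: "frame (For v_c v_len ?c) s1 s'"
    have e': "env s'" using env_step[OF fr s1(1)] by simp
    have "(2::nat) ^ Suc k \<le> 2 ^ len" using k by (intro power_increasing) auto
    then have "(2::nat) ^ k + 2 ^ k < 2 ^ w" using tab_bounds(1)[of len] by simp
    then have t: "take_bit w (2 ^ k + 2 ^ k) = (2 ^ k + 2 ^ k :: nat)" by (rule take_bit_self)
    have t2: "take_bit w (ptab + 2 ^ k) = ptab + 2 ^ k" using pow_bounds(2)[of k] k by (simp add: take_bit_self)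
    have "(\<lambda>a. of_bool (\<exists>b<k. a = ptab + 2 ^ b))(ptab + 2 ^ k := 1) = (\<lambda>a. of_bool (\<exists>b<Suc k. a = ptab + 2 ^ b) :: nat)"
      by (auto simp: fun_eq_iff less_Suc_eq)
    then show "wp (exec w A B ?c s') (\<lambda>s''. time s'' \<le> time s' + 3 \<and> I (Suc k) s'')"
      using I e' t t2 by (simp add: I_def)
  next
    show "I k s''" if "I k s'" "same_but {v_c, v_cond} s' s''" for k s' s''
      using that by (simp add: same_but_def I_def)
  qed (use s1 in \<open>simp_all add: I_def\<close>)
  then show ?thesis
    unfolding ex
  proof (rule wp_mono)
    fix s' assume I: "time s' \<le> time s1 + (3 + len * (3 + 3)) \<and> I len s'"
    have "pow_table (mem s')"
      unfolding pow_table_def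
    proof (intro allI impI)
      fix b x assume b: "b < len" and x: "x < (2::nat) ^ b"
      \<comment> \<open>\<open>2 ^ b + x\<close> lies below \<open>2 ^ Suc b\<close>, so the only
        power of two that it can be is \<open>2 ^ b\<close>.\<close>
      have "(\<exists>b'<len. ptab + 2 ^ b + x = ptab + 2 ^ b') \<longleftrightarrow> x = 0"
      proof
        assume "\<exists>b'<len. ptab + 2 ^ b + x = ptab + 2 ^ b'"
        then obtain b' where b': "2 ^ b + x = (2::nat) ^ b'" by auto
        have "(2::nat) ^ b \<le> 2 ^ b'" using b' by linarith
        then have "b \<le> b'" by simp
        have "(2::nat) ^ b' < 2 ^ Suc b" using b' x by simp
        then have "b' < Suc b" by (rule power_less_imp_less_exp[rotated]) simp
        with \<open>b \<le> b'\<close> have "b' = b" by simp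
        then show "x = 0" using b' by simp
      qed (use b in auto)
      then show "odd (mem s' (ptab + 2 ^ b + x)) = (x = 0)" using I by (simp add: I_def)
    qed
    then show "time s' \<le> time s + (4 + len * 6) \<and> pow_table (mem s')" using I s1(4) by simp
  qed
qed

definition total_deg :: "bool \<Rightarrow> nat" where "total_deg sw = (\<Sum>i<n. deg sw i)"

text \<open>With \<open>sw\<close> the rows are columns of \<open>B\<close>, hence the swap of pairs
  in the second part.\<close>

lemma total_deg_nnz: "total_deg False = nnz A" "total_deg True = nnz B"
proof -
  have dims: "dim_row A = n" "dim_col A = n" "dim_row B = n" "dim_col B = n" using A B by auto
  have "nnz A = card (SIGMA i:{..<n}. {k. k < n \<and> ent False i k})"
    unfolding nnz_def by (rule arg_cong[where f = card]) (auto simp: ent_def entry_def dims)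
  then show "total_deg False = nnz A" by (simp add: total_deg_def deg_def)
  have "bij_betw prod.swap (SIGMA i:{..<n}. {k. k < n \<and> ent True i k}) {(i, j). i < dim_row B \<and> j < dim_col B \<and> B $$ (i, j)}"
    by (rule bij_betwI[where g = prod.swap]) (auto simp: ent_def entry_def dims)
  from bij_betw_same_card[OF this] show "total_deg True = nnz B"
    unfolding nnz_def by (simp add: total_deg_def deg_def)
qed

text \<open>\<open>i\<close> and \<open>j\<close> trade places under \<open>sw\<close>; a witness is
  an index common to a row of the first factor and a row of the transposed second factor.\<close>

lemma mw_output_rows:
  assumes "\<forall>i<n. row_ok sw m i n"
  shows "mw_output A B m"
proof -
  have dims: "dim_row A = n" "dim_col A = n" "dim_row B = n" "dim_col B = n" using A B by auto
  show ?thesis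
    unfolding mw_output_def dims
  proof (intro allI impI)
    fix i j assume ij: "i < n" "j < n"
    define a where "a = (if sw then j else i)"
    define b where "b = (if sw then i else j)"
    have ab: "a < n" "b < n" "pos sw a b = i * n + j" using ij by (auto simp: a_def b_def pos_def)
    have "m (pos sw a b) = best sw a b" using assms ab(1,2) unfolding row_ok_def by blast
    then have val: "m (i * n + j) = best sw a b" unfolding ab(3) .
    have com: "common sw a b = witnesses A B i j"
      using ij by (auto simp: common_def witnesses_def ent_def entry_def dims a_def b_def)
    have "bool_prod A B $$ (i, j) \<longleftrightarrow> witnesses A B i j \<noteq> {}"
      using ij by (auto simp: bool_prod_def witnesses_def dims)
    then show "m (i * n + j) = (if bool_prod A B $$ (i, j) then Max (witnesses A B i j) + 1 else 0)"
      unfolding val best_def com by simp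
  qed
qed

definition run_time :: "bool \<Rightarrow> nat" where
  "run_time sw = 150 * (n * n) * w + (3 + (\<Sum>i<n. 4 * n * w ^ 4 * row_cost sw i + 3))"

text \<open>Counting is exact, so \<open>sw\<close> is not random: the branch taken, and with it the
  time bound, is determined by the input.\<close>

lemma program_triple:
  defines "sw \<equiv> total_deg True < total_deg False"
  shows "triple w A B max_witness_prog (init_config n) (run_time sw) (\<lambda>_. True)
    (\<lambda>s'. if mw_output A B (mem s') then 0 else 1) (of_nat n * (of_nat n * (of_nat len * fail_prob)))"
proof -
  let ?e = "of_nat n * (of_nat n * (of_nat len * fail_prob))"
  let ?V = "\<lambda>s'. if mw_output A B (mem s') then 0 else 1 :: ennreal"
  let ?T = "3 + (\<Sum>i<n. 4 * n * w ^ 4 * row_cost sw i + 3)"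
  have "triple w A B max_witness_prog (init_config n)
    ((20 + 6 * n + 4 * len) + ((4 + len * 6) + (62 * (n * n) * w + (62 * (n * n) * w + (?T + 2))))) (\<lambda>_. True) ?V ?e"
    unfolding max_witness_prog_def
  proof (rule triple_Seq_det[OF constants_wp])
    fix s1 assume f1: "frame constants (init_config n) s1" and e1: "env s1"
    have m1: "mem s1 = (\<lambda>_. 0)" and q1: "qst s1 = zero_state" using f1 by (simp_all add: frame_def init_config_def)
    show "triple w A B (Seq power_table (Seq (count False v_m1) (Seq (count True v_m2)
        (Seq (Op v_tmp Less v_m2 v_m1) (If v_tmp (rows True) (rows False)))))) s1
      ((4 + len * 6) + (62 * (n * n) * w + (62 * (n * n) * w + (?T + 2)))) (\<lambda>_. True) ?V ?e"
    proof (rule triple_Seq_det[OF power_table_wp[OF e1 m1]])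
      fix s2 assume f2: "frame power_table s1 s2" and pt2: "pow_table (mem s2)"
      have e2: "env s2" using env_step[OF f2 e1] by simp
      have u2: "blank (qst s2)" using f2 q1 by (simp add: frame_def)
      show "triple w A B (Seq (count False v_m1) (Seq (count True v_m2)
        (Seq (Op v_tmp Less v_m2 v_m1) (If v_tmp (rows True) (rows False))))) s2
        (62 * (n * n) * w + (62 * (n * n) * w + (?T + 2))) (\<lambda>_. True) ?V ?e"
      proof (rule triple_Seq_det[OF count_wp[OF e2 u2]])
        fix s3 assume f3: "frame (count False v_m1) s2 s3"
          and Q3: "blank (qst s3) \<and> vars s3 v_m1 = (\<Sum>i<n. deg False i)"
        have e3: "env s3" "mem s3 = mem s2" using env_step[OF f3 e2] by simp_all
        show "triple w A B (Seq (count True v_m2)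
          (Seq (Op v_tmp Less v_m2 v_m1) (If v_tmp (rows True) (rows False)))) s3
          (62 * (n * n) * w + (?T + 2)) (\<lambda>_. True) ?V ?e"
        proof (rule triple_Seq_det[OF count_wp[OF e3(1) Q3[THEN conjunct1]]])
          fix s4 assume f4: "frame (count True v_m2) s3 s4"
            and Q4: "blank (qst s4) \<and> vars s4 v_m2 = (\<Sum>i<n. deg True i)"
          have e4: "env s4" "mem s4 = mem s3" "vars s4 v_m1 = vars s3 v_m1" using env_step[OF f4 e3(1)] by simp_all
          define s5 where "s5 = tick (set_var v_tmp (of_bool sw) s4)"
          have ex: "exec w A B (Seq (Op v_tmp Less v_m2 v_m1) (If v_tmp (rows True) (rows False))) s4 =
              exec w A B (If v_tmp (rows True) (rows False)) s5"
            unfolding exec_Seq_basic s5_def sw_def total_deg_def using e4 Q3 Q4 by (simp del: exec.simps)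
          have s5: "env s5" "blank (qst s5)" "pow_table (mem s5)" "vars s5 v_tmp = of_bool sw" "time s5 = time s4 + 1"
            using e4 e3 Q4 pt2 by (simp_all add: s5_def)
          have r: "triple w A B (rows sw) (tick s5) ?T (\<lambda>_. True) ?V ?e"
            by (rule triple_conseq[OF rows_triple]) (use s5 mw_output_rows in auto)
          have "triple w A B (If v_tmp (rows True) (rows False)) s5 (?T + 1) (\<lambda>_. True) ?V ?e"
            by (rule triple_If) (use r s5(4) in \<open>cases sw; simp\<close>)+
          then show "triple w A B (Seq (Op v_tmp Less v_m2 v_m1) (If v_tmp (rows True) (rows False))) s4 (?T + 2) (\<lambda>_. True) ?V ?e"
            by (rule triple_step[OF ex s5(5)]) simp
        qed simp
      qed simp
    qed
  qed
  moreover have "(20 + 6 * n + 4 * len) + ((4 + len * 6) + (62 * (n * n) * w + (62 * (n * n) * w + (?T + 2)))) \<le> run_time sw"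
  proof -
    have w: "20 \<le> w" "len * 20 = w" using len_pos by (simp_all add: w_def)
    have nn: "1 \<le> n * n" "n \<le> n * n" using n_pos by simp_all
    have "(n * n) * 20 \<le> (n * n) * w" "1 * w \<le> (n * n) * w" using w nn by (auto intro: mult_left_mono mult_right_mono)
    then have "26 + 6 * n + 10 * len \<le> 26 * ((n * n) * w)" using nn w by linarith
    then show ?thesis unfolding run_time_def mult.assoc by simp
  qed
  ultimately show ?thesis by (rule triple_conseq) auto
qed

section \<open>Error probability and running time\<close>

text \<open>With \<open>x = 2 ^ len\<close>, the bounds \<open>n \<le> x\<close> and
  \<open>len \<le> x / 2\<close> leave \<open>1 / (2 * x)\<close>, and \<open>x\<close> is at least
  2.\<close>

lemma error_le: "of_nat n * (of_nat n * (of_nat len * fail_prob)) \<le> ennreal (1 / 4)"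
proof -
  have nl: "real n \<le> 2 ^ len" using n_less by (metis less_imp_le of_nat_le_iff of_nat_numeral of_nat_power)
  have "real (2 * len) \<le> real (2 ^ len)" using double_le_power[OF len_pos] by (rule of_nat_mono)
  then have ll: "real len \<le> 2 ^ len / 2" by simp
  have l2: "(2::real) \<le> 2 ^ len" using power_increasing[of 1 len "2::real"] len_pos by simp
  let ?x = "(2::real) ^ len"
  have "(2 :: real) ^ (4 * len) = 2 ^ (len + len + len + len)" by (rule arg_cong[where f = "(^) 2"]) simp
  then have half: "(1 / 2 :: real) ^ (4 * len) = 1 / (?x * ?x * ?x * ?x)"
    by (simp add: power_one_over power_add)
  have "real n * (real n * (real len * (1 / (?x * ?x * ?x * ?x)))) \<le> ?x * (?x * (?x / 2 * (1 / (?x * ?x * ?x * ?x))))"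
    using nl ll by (intro mult_mono mult_right_mono) auto
  moreover have "?x * (?x * (?x / 2 * (1 / (?x * ?x * ?x * ?x)))) = 1 / (2 * ?x)" by simp
  moreover have "1 / (2 * ?x) \<le> 1 / 4" using l2 by (intro divide_left_mono) auto
  ultimately have "real n * (real n * (real len * (1 / 2) ^ (4 * len))) \<le> 1 / 4" unfolding half by linarith
  then have "ennreal (real n * (real n * (real len * (1 / 2) ^ (4 * len)))) \<le> ennreal (1 / 4)" by (rule ennreal_leI)
  then show ?thesis
    by (simp add: fail_prob_def ennreal_mult ennreal_of_nat_eq_real_of_nat)
qed

lemma run_eq: "run 20 max_witness_prog n A B = exec w A B max_witness_prog (init_config n)"
  by (simp add: run_def w_def len_def)

text \<open>Failure at most 1/4 means success at least 3/4; passing to the complement uses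
  termination with probability 1.\<close>

lemma run_correct:
  "measure (measure_spmf (run 20 max_witness_prog n A B)) {s. mw_output A B (mem s)} \<ge> 2 / 3"
proof -
  let ?p = "exec w A B max_witness_prog (init_config n)" and ?ok = "{s. mw_output A B (mem s)}"
  have wp: "wp ?p (\<lambda>_. True)" and ex: "expect ?p (\<lambda>s'. if mw_output A B (mem s') then 0 else 1) \<le> ennreal (1 / 4)"
    using program_triple error_le unfolding triple_def by (auto elim: wp_mono intro: order_trans)
  have "expect ?p (\<lambda>s'. if mw_output A B (mem s') then 0 else 1) = emeasure (measure_spmf ?p) (- ?ok)"
  proof -
    have "(\<lambda>s'. if mw_output A B (mem s') then 0 else 1) = (indicator (- ?ok) :: config \<Rightarrow> ennreal)"
      by (auto simp: indicator_def)
    then show ?thesis unfolding expect_def by (simp add: nn_integral_indicator)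
  qed
  with ex have "measure (measure_spmf ?p) (- ?ok) \<le> 1 / 4"
    by (simp add: measure_spmf.emeasure_eq_measure)
  moreover have "measure (measure_spmf ?p) (- ?ok) = 1 - measure (measure_spmf ?p) ?ok"
  proof -
    have "measure (measure_spmf ?p) (space (measure_spmf ?p) - ?ok) =
        measure (measure_spmf ?p) (space (measure_spmf ?p)) - measure (measure_spmf ?p) ?ok"
      by (rule measure_spmf.finite_measure_compl) simp
    moreover have "measure (measure_spmf ?p) (space (measure_spmf ?p)) = 1"
      using wp by (simp add: wp_def lossless_spmf_def space_measure_spmf weight_spmf_def)
    ultimately show ?thesis by (simp add: space_measure_spmf Compl_eq_Diff_UNIV)
  qed
  ultimately show ?thesis unfolding run_eq by linarith
qed

lemma sum_sqrt_deg: "(\<Sum>i<n. sqrt (deg sw i)) \<le> sqrt (n * total_deg sw)"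
proof (rule real_le_rsqrt)
  have "(\<Sum>i<n. sqrt (deg sw i))\<^sup>2 \<le> (\<Sum>i<n. (sqrt (deg sw i))\<^sup>2) * card {..<n}"
    by (rule sum_squared_le_sum_of_squares)
  then show "(\<Sum>i<n. sqrt (deg sw i))\<^sup>2 \<le> real (n * total_deg sw)"
    by (simp add: total_deg_def mult.commute)
qed

text \<open>Comes from \<open>18 * (d + 1) \<le> 25 * (sqrt d + 1)\<^sup>2\<close>.\<close>

lemma row_cost_le: "real (row_cost sw i) \<le> 5 * (sqrt (deg sw i) + 1)"
proof -
  have "real ((row_cost sw i)\<^sup>2) \<le> real (18 * (deg sw i + 1))"
    unfolding row_cost_def by (intro of_nat_mono floor_sqrt_power2_le)
  also have "\<dots> \<le> (5 * (sqrt (deg sw i) + 1))\<^sup>2"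
    by (simp add: power2_eq_square algebra_simps)
  finally show ?thesis by (simp add: abs_le_square_iff[symmetric])
qed

text \<open>The summand 1 in the bound of each row cost adds up to order \<open>n\<^sup>2\<close>,
  and the remaining square roots are combined by \<open>sum_sqrt_deg\<close>. The power
  \<open>w ^ 4\<close> dominates all logarithmic factors.\<close>

lemma run_time_le:
  "real (run_time sw) \<le> 1000 * real w ^ 4 * (real n ^ 2 + real n powr (3 / 2) * sqrt (total_deg sw))"
proof -
  let ?w4 = "real w ^ 4" and ?d = "real (total_deg sw)"
  have w1: "1 \<le> real w" using w_pos by simp
  have n1: "1 \<le> real n" using n_pos by simp
  have ww: "real w \<le> ?w4" using w1 by (rule self_le_power) simp
  have w4: "1 \<le> ?w4" using w1 by (rule one_le_power)
  have nn: "1 \<le> real n ^ 2" "real n \<le> real n ^ 2" using n1 by (auto intro: one_le_power self_le_power)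
  have npow: "real n * sqrt n = real n powr (3 / 2)"
  proof -
    have "real n powr (3 / 2) = real n powr (1 + 1 / 2)" by simp
    also have "\<dots> = real n powr 1 * real n powr (1 / 2)" by (rule powr_add)
    also have "\<dots> = real n * sqrt n" using n1 by (simp add: powr_half_sqrt)
    finally show ?thesis by simp
  qed
  define S where "S = real n * sqrt (real n) * sqrt ?d"
  have "(\<Sum>i<n. real (row_cost sw i)) \<le> (\<Sum>i<n. 5 * (sqrt (deg sw i) + 1))"
    by (intro sum_mono row_cost_le)
  also have "\<dots> = 5 * (\<Sum>i<n. sqrt (deg sw i)) + 5 * real n"
    by (simp add: sum.distrib sum_distrib_left distrib_left)
  also have "\<dots> \<le> 5 * sqrt (n * total_deg sw) + 5 * real n" using sum_sqrt_deg[of sw] by simp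
  finally have rc: "(\<Sum>i<n. real (row_cost sw i)) \<le> 5 * (sqrt n * sqrt ?d) + 5 * real n"
    by (simp add: real_sqrt_mult)
  have "real (run_time sw) = 150 * real n ^ 2 * real w + 3 + 4 * real n * ?w4 * (\<Sum>i<n. real (row_cost sw i)) + 3 * real n"
    by (simp add: run_time_def power2_eq_square sum.distrib sum_distrib_left)
  also have "\<dots> \<le> 150 * real n ^ 2 * ?w4 + 3 * (real n ^ 2 * ?w4) + 4 * real n * ?w4 * (5 * (sqrt n * sqrt ?d) + 5 * real n) + 3 * (real n ^ 2 * ?w4)"
  proof -
    have "1 * 1 \<le> real n ^ 2 * ?w4" "real n * 1 \<le> real n ^ 2 * ?w4" using nn w4 by (intro mult_mono; simp)+
    moreover have "150 * real n ^ 2 * real w \<le> 150 * real n ^ 2 * ?w4" using ww by (intro mult_left_mono) auto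
    moreover have "4 * real n * ?w4 * (\<Sum>i<n. real (row_cost sw i)) \<le> 4 * real n * ?w4 * (5 * (sqrt n * sqrt ?d) + 5 * real n)"
      using rc by (intro mult_left_mono) auto
    ultimately show ?thesis by linarith
  qed
  also have "\<dots> = ?w4 * (176 * real n ^ 2 + 20 * S)"
    by (simp add: S_def algebra_simps power2_eq_square)
  also have "\<dots> \<le> ?w4 * (1000 * real n ^ 2 + 1000 * S)"
    by (intro mult_left_mono add_mono) (auto simp: S_def)
  finally show ?thesis unfolding S_def npow by (simp add: algebra_simps)
qed

text \<open>\<open>len - 1\<close> and 1 are both at most \<open>log 2 (real n + 1)\<close>, so
  \<open>w = 20 * len\<close> is at most 40 times this logarithm; the argument \<open>n + 1\<close>
  keeps it positive for \<open>n = 1\<close>.\<close>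

lemma run_halts:
  "halts_within (run 20 max_witness_prog n A B)
    ((1000 * 40 ^ 4) * (real n ^ 2 + real n powr (3 / 2) * sqrt (real (min (nnz A) (nnz B)))) * log 2 (real n + 1) ^ 4)"
proof -
  define sw where "sw \<longleftrightarrow> total_deg True < total_deg False"
  let ?F = "real n ^ 2 + real n powr (3 / 2) * sqrt (real (min (nnz A) (nnz B)))" and ?l = "log 2 (real n + 1)"
  have D: "total_deg sw = min (nnz A) (nnz B)"
    unfolding total_deg_nnz[symmetric] by (cases sw) (auto simp: sw_def)
  have "real w \<le> 40 * ?l"
  proof -
    have "2 ^ (len - 1) \<le> n"
      using floor_log_exp2_le[of n] n_pos by (simp add: len_def bit_length_def)
    then have "real (2 ^ (len - 1)) \<le> real n" by (rule of_nat_mono)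
    moreover have "2 powr real (len - 1) = real (2 ^ (len - 1))" by (simp add: powr_realpow)
    ultimately have "2 powr real (len - 1) \<le> real n + 1" by linarith
    then have "real (len - 1) \<le> ?l" by (subst le_log_iff) auto
    moreover have "1 \<le> ?l" using n_pos by (subst le_log_iff) auto
    moreover have "real (len - 1) = real len - 1" using len_pos by simp
    ultimately have "real len \<le> 2 * ?l" by linarith
    then show ?thesis by (simp add: w_def)
  qed
  then have w4: "real w ^ 4 \<le> (40 * ?l) ^ 4" by (intro power_mono) auto
  have F: "0 \<le> ?F" by simp
  have "real (run_time sw) \<le> 1000 * real w ^ 4 * ?F" using run_time_le[of sw] unfolding D .
  also have "\<dots> \<le> 1000 * (40 * ?l) ^ 4 * ?F" using w4 F by (intro mult_right_mono mult_left_mono) auto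
  also have "\<dots> = (1000 * 40 ^ 4) * ?F * ?l ^ 4" by (simp add: power_mult_distrib)
  finally have T: "real (run_time sw) \<le> (1000 * 40 ^ 4) * ?F * ?l ^ 4" .
  have "wp (run 20 max_witness_prog n A B) (\<lambda>s'. time s' \<le> run_time sw)"
    using program_triple unfolding triple_def run_eq sw_def by (auto simp: init_config_def elim: wp_mono)
  then show ?thesis
    unfolding halts_within_def wp_def using T by (auto intro: order_trans[of "real (time _)" "real (run_time sw)"])
qed

end

theorem theorem2:
  shows "\<exists>(P::com) (c::nat). c \<ge> 1 \<and> solves_MW c P \<and>
           runs_in_soft_O c P
             (\<lambda>n m1 m2. real n ^ 2 + real n powr (3 / 2) * sqrt (real (min m1 m2)))"
proof (intro exI conjI)
  show "(20::nat) \<ge> 1" by simp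
  show "solves_MW 20 max_witness_prog"
    unfolding solves_MW_def by (intro allI ballI impI mw_input.run_correct mw_input.intro)
  show "runs_in_soft_O 20 max_witness_prog
      (\<lambda>n m1 m2. real n ^ 2 + real n powr (3 / 2) * sqrt (real (min m1 m2)))"
    unfolding runs_in_soft_O_def
    by (intro exI[of _ "1000 * 40 ^ 4"] exI[of _ 4] allI ballI impI mw_input.run_halts mw_input.intro)
qed

end
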